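(* Let $\mathcal V$ be a unital commutative associative differential superalgebra, with even derivation $\partial$ and parity $p$. For $k\ge-1$, let $W^{\partial,\mathrm{as}}_k(\Pi\mathcal V)$ be the subspace of $W^\partial_k(\Pi\mathcal V)$ consisting of maps $X:(\Pi\mathcal V)^{\otimes(k+1)}\to\mathbb F_-[\lambda_0,\dots,\lambda_k]\otimes_{\mathbb F[\partial]}\Pi\mathcal V$ satisfying the Leibniz rule, for each $i=0,\dots,k$: $$\begin{aligned}X_{\lambda_0,\dots,\lambda_k}(a_0,\dots,b_ic_i,\dots,a_k)=&(-1)^{p(c_i)(s_{i+1,k}+k-i)}X_{\lambda_0,\dots,\lambda_i+\partial,\dots,\lambda_k}(a_0,\dots,b_i,\dots,a_k)_\to c_i\\&+(-1)^{p(b_i)(p(c_i)+s_{i+1,k}+k-i)}X_{\lambda_0,\dots,\lambda_i+\partial,\dots,\lambda_k}(a_0,\dots,c_i,\dots,a_k)_\to b_i,\end{aligned}$$ where $s_{i+1,k}=p(a_{i+1})+\dots+p(a_k)$. Then $W^{\partial,\mathrm{as}}(\Pi\mathcal V)=\bigoplus_{k\ge-1}W^{\partial,\mathrm{as}}_k(\Pi\mathcal V)$ is a subalgebra of the $\mathbb Z$-graded Lie superalgebra $W^\partial(\Pi\mathcal V)$, such that $W^{\partial,\mathrm{as}}_{-1}(\Pi\mathcal V)=\Pi\mathcal V/\partial\Pi\mathcal V$, and $W_0^{\partial,\mathrm{as}}(\Pi\mathcal V)=\mathrm{Der}^\partial(\mathcal V)$ is the Lie superalgebra of derivations of $\mathcal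 V$ commuting with $\partial$.
   Context: $\mathbb F$ is a field of characteristic $0$. $\Pi\mathcal V$ is $\mathcal V$ with reversed parity $\bar p=p+\bar1$. For an $\mathbb F[\partial]$-module $V$ with compatible parity $\bar p$: $\mathbb F_-[\lambda_0,\dots,\lambda_k]\otimes_{\mathbb F[\partial]}V$ is the quotient of $\mathbb F[\lambda_0,\dots,\lambda_k]\otimes V$ by the image of $\lambda_0+\dots+\lambda_k+\partial$ ($V/\partial V$ for $k=-1$). $W^\partial_k(V)$, $k\ge-1$, is the superspace (parity $\bar p$) of linear maps $X:V^{\otimes(k+1)}\to\mathbb F_-[\lambda_0,\dots,\lambda_k]\otimes_{\mathbb F[\partial]}V$ satisfying sesquilinearity $X_{\lambda_0,\dots,\lambda_k}(v_0,\dots,\partial v_i,\dots,v_k)=-\lambda_iX_{\lambda_0,\dots,\lambda_k}(v_0,\dots,v_k)$ and symmetry $X_{\lambda_0,\dots,\lambda_k}(v_0,\dots,v_k)=\epsilon_v(i_0,\dots,i_k)X_{\lambda_{i_0},\dots,\lambda_{i_k}}(v_{i_0},\dots,v_{i_k})$ for all permutations, where $\epsilon_v(i_0,\dots,i_k)=(-1)^M$, $M$ the number of interchanges of indices of odd $v_i$'s. $W^\partial(V)=\bigoplus_{k\ge-1}W^\partial_k(V)$ is a $\mathbb Z$-graded Lie superalgebra with bracket $[X,Y]=X\Box Y-(-1)^{\bar p(X)\bar p(Y)}Y\Box X$, where for $X\in W^\partial_h(V)$, $Y\in W^\partial_{k-h}(V)$ $$(X\Box Y)_{\lambda_0,\dots,\lambda_k}(v_0,\dots,v_k)=\sum_{\substack{i_0<\dots<i_{k-h}\\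 i_{k-h+1}<\dots<i_k}}\epsilon_v(i_0,\dots,i_k)\,X_{\lambda_{i_0}+\dots+\lambda_{i_{k-h}},\lambda_{i_{k-h+1}},\dots,\lambda_{i_k}}\big(Y_{\lambda_{i_0},\dots,\lambda_{i_{k-h}}}(v_{i_0},\dots,v_{i_{k-h}}),v_{i_{k-h+1}},\dots,v_{i_k}\big)$$ (sum over permutations of $(0,\dots,k)$). $W^\partial_0(V)$ is identified with $\mathrm{End}_{\mathbb F[\partial]}(V)$ via $X(v)=X_{-\partial}(v)$, $\partial$ moved to the left. Arrow notation: if $X_{\lambda_0,\dots,\lambda_k}(\dots)=\sum\lambda_0^{n_0}\cdots\lambda_k^{n_k}x_{n_0,\dots,n_k}$ then $X_{\lambda_0,\dots,\lambda_i+\partial,\dots,\lambda_k}(\dots)_\to c=\sum\big(\prod_{j\ne i}\lambda_j^{n_j}\big)x_{n_0,\dots,n_k}\,(\lambda_i+\partial)^{n_i}c$, i.e. $\partial$ acts on $c$ only (well defined in the quotient space). *)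

theory Defs
  imports "HOL-Library.Poly_Mapping" "HOL-Library.FuncSet" "HOL-Library.Z2"
    "HOL-Combinatorics.Multiset_Permutations"
begin

section \<open>Superspaces and Lie superalgebras on explicit carriers\<close>

text \<open>Parities are elements of the two-element field \<^typ>\<open>bit\<close>; a superspace structure is a family
  of homogeneous parts indexed by parities. The bracket of a Lie superalgebra is a total binary
  operation on the carrier, not only on homogeneous elements.\<close>

record ('f, 'a) superspace_str =
  ss_carrier :: "'a set"
  ss_zero :: 'a
  ss_add :: "'a \<Rightarrow> 'a \<Rightarrow> 'a"
  ss_scale :: "'f \<Rightarrow> 'a \<Rightarrow> 'a"
  ss_part :: "bit \<Rightarrow> 'a set"

record ('f, 'a) lie_str = "('f, 'a) superspace_str" +
  lie_bracket :: "'a \<Rightarrow> 'a \<Rightarrow> 'a"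

definition superspace_iso ::
    "('a \<Rightarrow> 'b) \<Rightarrow> ('f, 'a, 'm) superspace_str_scheme \<Rightarrow> ('f, 'b, 'n) superspace_str_scheme \<Rightarrow> bool"
  where "superspace_iso \<phi> A B \<longleftrightarrow>
    bij_betw \<phi> (ss_carrier A) (ss_carrier B) \<and>
    (\<forall>x\<in>ss_carrier A. \<forall>y\<in>ss_carrier A. \<phi> (ss_add A x y) = ss_add B (\<phi> x) (\<phi> y)) \<and>
    (\<forall>c. \<forall>x\<in>ss_carrier A. \<phi> (ss_scale A c x) = ss_scale B c (\<phi> x)) \<and>
    (\<forall>q. \<phi> ` ss_part A q = ss_part B q)"

definition lie_superalgebra_iso ::
    "('a \<Rightarrow> 'b) \<Rightarrow> ('f, 'a, 'm) lie_str_scheme \<Rightarrow> ('f, 'b, 'n) lie_str_scheme \<Rightarrow> bool"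
  where "lie_superalgebra_iso \<phi> A B \<longleftrightarrow>
    superspace_iso \<phi> A B \<and>
    (\<forall>x\<in>ss_carrier A. \<forall>y\<in>ss_carrier A.
       \<phi> (lie_bracket A x y) = lie_bracket B (\<phi> x) (\<phi> y))"

definition lie_subsuperalgebra :: "'a set \<Rightarrow> ('f, 'a, 'm) lie_str_scheme \<Rightarrow> bool"
  where "lie_subsuperalgebra S L \<longleftrightarrow>
    S \<subseteq> ss_carrier L \<and>
    ss_zero L \<in> S \<and>
    (\<forall>x\<in>S. \<forall>y\<in>S. ss_add L x y \<in> S) \<and>
    (\<forall>c. \<forall>x\<in>S. ss_scale L c x \<in> S) \<and>
    (\<forall>x\<in>S. \<exists>x0\<in>S \<inter> ss_part L 0. \<exists>x1\<in>S \<inter> ss_part L 1. x = ss_add L x0 x1) \<and>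
    (\<forall>x\<in>S. \<forall>y\<in>S. lie_bracket L x y \<in> S)"

definition psign :: "bit \<Rightarrow> 'f::ring_1"
  where "psign p = (if p = 0 then 1 else - 1)"

definition rev_parity :: "(bit \<Rightarrow> 'v set) \<Rightarrow> bit \<Rightarrow> 'v set"
  where "rev_parity G p = G (p + 1)"

text \<open>A permutation \<open>(i\<^sub>0, \<dots>, i\<^sub>k)\<close> is the list of its values, and \<open>ps\<close> is the list of parities of
  \<open>v\<^sub>0, \<dots>, v\<^sub>k\<close>. The exponent of the Koszul sign is the number of inversions among odd entries.\<close>

definition eps :: "bit list \<Rightarrow> nat list \<Rightarrow> 'f::ring_1"
  where "eps ps is = (- 1) ^ card {(j, l). j < l \<and> l < length is \<and> is ! j > is ! l \<and>
    ps ! (is ! j) = 1 \<and> ps ! (is ! l) = 1}"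

text \<open>The condition \<open>b \<le> n\<close> matters: there is no choice of \<open>b\<close> indices among \<open>n < b\<close> of them.\<close>

definition unshuffles :: "nat \<Rightarrow> nat \<Rightarrow> nat list set"
  where "unshuffles b n =
    {is \<in> permutations_of_set {..<n}. b \<le> n \<and> sorted (take b is) \<and> sorted (drop b is)}"

section \<open>Polynomials in \<open>\<lambda>\<^sub>0, \<lambda>\<^sub>1, \<dots>\<close>\<close>

text \<open>\<open>'a lpoly\<close> serves both for \<open>\<bbbF>[\<lambda>\<^sub>0, \<lambda>\<^sub>1, \<dots>]\<close> and, with vector coefficients, for
  \<open>\<bbbF>[\<lambda>\<^sub>0, \<lambda>\<^sub>1, \<dots>] \<otimes> V = V[\<lambda>\<^sub>0, \<lambda>\<^sub>1, \<dots>]\<close>.\<close>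

type_synonym 'a lpoly = "(nat \<Rightarrow>\<^sub>0 nat) \<Rightarrow>\<^sub>0 'a"

definition lvar :: "nat \<Rightarrow> 'f::comm_ring_1 lpoly"
  where "lvar i = Poly_Mapping.single (Poly_Mapping.single i 1) 1"

definition lconst :: "'a::zero \<Rightarrow> 'a lpoly"
  where "lconst c = Poly_Mapping.single 0 c"

definition polys :: "nat \<Rightarrow> 'a::zero lpoly set"
  where "polys n = {P. \<forall>m\<in>Poly_Mapping.keys P. Poly_Mapping.keys m \<subseteq> {..<n}}"

definition rep :: "'a set \<Rightarrow> 'a"
  where "rep A = (SOME x. x \<in> A)"

definition args :: "nat \<Rightarrow> 'v list set"
  where "args n = {vs. length vs = n}"

section \<open>The Lie superalgebra \<open>W\<^sup>\<partial>(V)\<close>\<close>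

context vector_space
begin

definition pact :: "'a lpoly \<Rightarrow> 'b lpoly \<Rightarrow> 'b lpoly"  (infixr \<open>\<odot>\<close> 75)
  where "f \<odot> P = (\<Sum>a\<in>Poly_Mapping.keys f. \<Sum>b\<in>Poly_Mapping.keys P.
    Poly_Mapping.single (a + b) (scale (Poly_Mapping.lookup f a) (Poly_Mapping.lookup P b)))"

text \<open>\<open>lsubst \<phi> P\<close> replaces each variable \<open>\<lambda>\<^sub>i\<close> of \<open>P\<close> by the polynomial \<open>\<phi> i\<close>.\<close>

definition lsubst :: "(nat \<Rightarrow> 'a lpoly) \<Rightarrow> 'b lpoly \<Rightarrow> 'b lpoly"
  where "lsubst \<phi> P = (\<Sum>m\<in>Poly_Mapping.keys P.
    (\<Prod>i\<in>Poly_Mapping.keys m. \<phi> i ^ Poly_Mapping.lookup m i) \<odot> lconst (Poly_Mapping.lookup P m))"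

end

locale superspace = vector_space scale
  for scale :: "'f::field_char_0 \<Rightarrow> 'v::ab_group_add \<Rightarrow> 'v" +
  fixes G :: "bit \<Rightarrow> 'v set"
  assumes subspace_G: "subspace (G p)"
    and G_Int: "G 0 \<inter> G 1 = {0}"
    and G_sum: "\<exists>x\<in>G 0. \<exists>y\<in>G 1. v = x + y"
begin

definition proj :: "bit \<Rightarrow> 'v \<Rightarrow> 'v"
  where "proj p v = (THE x. x \<in> G p \<and> v - x \<in> G (p + 1))"

definition homog :: "bit list \<Rightarrow> 'v list \<Rightarrow> bool"
  where "homog ps vs \<longleftrightarrow> list_all2 (\<lambda>p v. v \<in> G p) ps vs"

end

locale diff_supermodule = superspace scale G
  for scale :: "'f::field_char_0 \<Rightarrow> 'v::ab_group_add \<Rightarrow> 'v" and G :: "bit \<Rightarrow> 'v set" +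
  fixes D :: "'v \<Rightarrow> 'v"
  assumes linear_D: "Vector_Spaces.linear scale scale D"
    and even_D: "v \<in> G p \<Longrightarrow> D v \<in> G p"
begin

text \<open>\<open>quot n\<close> is \<open>\<bbbF>\<^sub>-[\<lambda>\<^sub>0, \<dots>, \<lambda>\<^sub>k] \<otimes>\<^bsub>\<bbbF>[\<partial>]\<^esub> V\<close> for \<open>n = k + 1\<close>, with the cosets of the image of
  \<open>\<lambda>\<^sub>0 + \<dots> + \<lambda>\<^sub>k + \<partial>\<close> as elements. Throughout, objects are indexed by the number \<open>n = k + 1\<close> of
  arguments instead of the degree \<open>k \<ge> -1\<close>. Operations on cosets are computed on representatives;
  wherever they are used below the outcome does not depend on the choice.\<close>

definition lam_im :: "nat \<Rightarrow> 'v lpoly set"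
  where "lam_im n = {(\<Sum>i<n. lvar i) \<odot> R + Poly_Mapping.map D R | R. R \<in> polys n}"

definition cls :: "nat \<Rightarrow> 'v lpoly \<Rightarrow> 'v lpoly set"
  where "cls n P = {P + R | R. R \<in> lam_im n}"

definition quot :: "nat \<Rightarrow> 'v lpoly set set"
  where "quot n = cls n ` polys n"

definition quot_part :: "nat \<Rightarrow> bit \<Rightarrow> 'v lpoly set set"
  where "quot_part n q = cls n ` {P \<in> polys n. \<forall>m. Poly_Mapping.lookup P m \<in> G q}"

definition qadd :: "nat \<Rightarrow> 'v lpoly set \<Rightarrow> 'v lpoly set \<Rightarrow> 'v lpoly set"
  where "qadd n A B = cls n (rep A + rep B)"

definition qsum :: "nat \<Rightarrow> ('i \<Rightarrow> 'v lpoly set) \<Rightarrow> 'i set \<Rightarrow> 'v lpoly set"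
  where "qsum n f I = cls n (\<Sum>i\<in>I. rep (f i))"

definition qact :: "nat \<Rightarrow> 'f lpoly \<Rightarrow> 'v lpoly set \<Rightarrow> 'v lpoly set"
  where "qact n f A = cls n (f \<odot> rep A)"

definition qscale :: "nat \<Rightarrow> 'f \<Rightarrow> 'v lpoly set \<Rightarrow> 'v lpoly set"
  where "qscale n c A = qact n (lconst c) A"

definition qsubst :: "nat \<Rightarrow> (nat \<Rightarrow> 'f lpoly) \<Rightarrow> 'v lpoly set \<Rightarrow> 'v lpoly set"
  where "qsubst n \<phi> A = cls n (lsubst \<phi> (rep A))"

text \<open>Linear maps on \<open>V\<^sup>\<otimes>\<^sup>n\<close> are multilinear functions of \<open>n\<close> vectors, given as a list.\<close>

definition multilin :: "nat \<Rightarrow> ('v list \<Rightarrow> 'v lpoly set) \<Rightarrow> bool"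
  where "multilin n X \<longleftrightarrow> (\<forall>vs\<in>args n. \<forall>i<n. \<forall>c u w.
    X (vs[i := scale c u + w]) = qadd n (qscale n c (X (vs[i := u]))) (X (vs[i := w])))"

definition sesquilin :: "nat \<Rightarrow> ('v list \<Rightarrow> 'v lpoly set) \<Rightarrow> bool"
  where "sesquilin n X \<longleftrightarrow> (\<forall>vs\<in>args n. \<forall>i<n.
    X (vs[i := D (vs ! i)]) = qact n (- lvar i) (X vs))"

definition symm :: "nat \<Rightarrow> ('v list \<Rightarrow> 'v lpoly set) \<Rightarrow> bool"
  where "symm n X \<longleftrightarrow> (\<forall>vs\<in>args n. \<forall>ps. homog ps vs \<longrightarrow> (\<forall>is\<in>permutations_of_set {..<n}.
    X vs = qscale n (eps ps is) (qsubst n (\<lambda>j. lvar (is ! j)) (X (map ((!) vs) is)))))"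

definition W :: "nat \<Rightarrow> ('v list \<Rightarrow> 'v lpoly set) set"
  where "W n = {X \<in> args n \<rightarrow>\<^sub>E quot n. multilin n X \<and> sesquilin n X \<and> symm n X}"

definition W_part :: "nat \<Rightarrow> bit \<Rightarrow> ('v list \<Rightarrow> 'v lpoly set) set"
  where "W_part n q = {X \<in> W n. \<forall>vs\<in>args n. \<forall>ps. homog ps vs \<longrightarrow>
    X vs \<in> quot_part n (q + sum_list ps)}"

definition wzero :: "nat \<Rightarrow> 'v list \<Rightarrow> 'v lpoly set"
  where "wzero n = (\<lambda>vs\<in>args n. cls n 0)"

definition wadd :: "nat \<Rightarrow> ('v list \<Rightarrow> 'v lpoly set) \<Rightarrow> ('v list \<Rightarrow> 'v lpoly set) \<Rightarrow>
    'v list \<Rightarrow> 'v lpoly set"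
  where "wadd n X Y = (\<lambda>vs\<in>args n. qadd n (X vs) (Y vs))"

definition wscale :: "nat \<Rightarrow> 'f \<Rightarrow> ('v list \<Rightarrow> 'v lpoly set) \<Rightarrow> 'v list \<Rightarrow> 'v lpoly set"
  where "wscale n c X = (\<lambda>vs\<in>args n. qscale n c (X vs))"

definition wproj :: "nat \<Rightarrow> bit \<Rightarrow> ('v list \<Rightarrow> 'v lpoly set) \<Rightarrow> 'v list \<Rightarrow> 'v lpoly set"
  where "wproj n q X = (THE Y. Y \<in> W_part n q \<and> (\<exists>Z\<in>W_part n (q + 1). X = wadd n Y Z))"

text \<open>\<open>box_term b X Y is vs\<close> is a polynomial representing
  \<open>X\<^bsub>\<lambda>\<^sub>i\<^sub>0 + \<dots>, \<dots>\<^esub>(Y\<^bsub>\<lambda>\<^sub>i\<^sub>0, \<dots>\<^esub>(v\<^sub>i\<^sub>0, \<dots>), \<dots>)\<close>, where \<open>Y\<close> has \<open>b\<close> arguments: if the inner value is the class of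
  \<open>Q = \<Sum>\<^sub>m \<lambda>\<^sup>m y\<^sub>m\<close>, then the powers of the \<open>\<lambda>\<^sub>j\<close> are relabelled and taken out of \<open>X\<close>.\<close>

definition box_term :: "nat \<Rightarrow> ('v list \<Rightarrow> 'v lpoly set) \<Rightarrow> ('v list \<Rightarrow> 'v lpoly set) \<Rightarrow>
    nat list \<Rightarrow> 'v list \<Rightarrow> 'v lpoly"
  where "box_term b X Y is vs =
    (let Q = rep (Y (map ((!) vs) (take b is)));
         \<phi> = (\<lambda>j. if j = 0 then \<Sum>l<b. lvar (is ! l) else lvar (is ! (b + j - 1)))
     in \<Sum>m\<in>Poly_Mapping.keys Q. (\<Prod>j\<in>Poly_Mapping.keys m. lvar (is ! j) ^ Poly_Mapping.lookup m j) \<odot>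
          lsubst \<phi> (rep (X (Poly_Mapping.lookup Q m # map ((!) vs) (drop b is)))))"

text \<open>For \<open>X\<close> with \<open>a\<close> and \<open>Y\<close> with \<open>b\<close> arguments, \<open>X \<box> Y\<close> has \<open>n = a + b - 1\<close> arguments. The sum
  over \<open>ps\<close> is the multilinear extension from homogeneous to arbitrary arguments.\<close>

definition box :: "nat \<Rightarrow> nat \<Rightarrow> ('v list \<Rightarrow> 'v lpoly set) \<Rightarrow> ('v list \<Rightarrow> 'v lpoly set) \<Rightarrow>
    'v list \<Rightarrow> 'v lpoly set"
  where "box a b X Y = (let n = a + b - 1 in
    (\<lambda>vs\<in>args n. cls n (\<Sum>ps\<in>{ps. length ps = n}. \<Sum>is\<in>unshuffles b n.
      lconst (eps ps is) \<odot> box_term b X Y is (map2 proj ps vs))))"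

text \<open>Bilinear extension of \<open>[X, Y] = X \<box> Y - (-1)\<^sup>p\<^sup>(\<^sup>X\<^sup>)\<^sup>p\<^sup>(\<^sup>Y\<^sup>) Y \<box> X\<close> from homogeneous elements. It is
  used only for \<open>a + b \<ge> 1\<close>: the bracket of two elements of degree \<open>-1\<close> is zero.\<close>

definition wbracket :: "nat \<Rightarrow> nat \<Rightarrow> ('v list \<Rightarrow> 'v lpoly set) \<Rightarrow> ('v list \<Rightarrow> 'v lpoly set) \<Rightarrow>
    'v list \<Rightarrow> 'v lpoly set"
  where "wbracket a b X Y = (let n = a + b - 1 in
    (\<lambda>vs\<in>args n. qsum n (\<lambda>(p, q). qadd n (box a b (wproj a p X) (wproj b q Y) vs)
        (qscale n (- psign (p * q)) (box b a (wproj b q Y) (wproj a p X) vs)))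
      ({0, 1} \<times> {0, 1})))"

definition dsum :: "(nat \<Rightarrow> ('v list \<Rightarrow> 'v lpoly set) set) \<Rightarrow> (nat \<Rightarrow> 'v list \<Rightarrow> 'v lpoly set) set"
  where "dsum S = {X. (\<forall>n. X n \<in> S n) \<and> finite {n. X n \<noteq> wzero n}}"

text \<open>The component of \<open>[X, Y]\<close> with \<open>n\<close> arguments collects the \<open>[X\<^sub>a, Y\<^sub>b]\<close> with
  \<open>(a - 1) + (b - 1) = n - 1\<close>.\<close>

definition W_lie :: "('f, nat \<Rightarrow> 'v list \<Rightarrow> 'v lpoly set) lie_str"
  where "W_lie = \<lparr>ss_carrier = dsum W, ss_zero = wzero,
    ss_add = (\<lambda>X Y n. wadd n (X n) (Y n)),
    ss_scale = (\<lambda>c X n. wscale n c (X n)),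
    ss_part = (\<lambda>q. dsum (\<lambda>n. W_part n q)),
    lie_bracket = (\<lambda>X Y n. (\<lambda>vs\<in>args n.
      qsum n (\<lambda>a. wbracket a (n + 1 - a) (X a) (Y (n + 1 - a)) vs) {..n + 1}))\<rparr>"

definition dcoset :: "'v \<Rightarrow> 'v set"
  where "dcoset v = {v + D u | u. True}"

definition V_mod_D :: "('f, 'v set) superspace_str"
  where "V_mod_D = \<lparr>ss_carrier = range dcoset, ss_zero = dcoset 0,
    ss_add = (\<lambda>A B. dcoset (rep A + rep B)),
    ss_scale = (\<lambda>c A. dcoset (scale c (rep A))),
    ss_part = (\<lambda>q. dcoset ` G q)\<rparr>"

text \<open>The identification of maps with no arguments with elements of \<open>V/\<partial>V\<close>: the value at the empty
  list is a class of constant polynomials.\<close>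

definition W_minus1_ident :: "('v list \<Rightarrow> 'v lpoly set) \<Rightarrow> 'v set"
  where "W_minus1_ident X = (\<lambda>P. Poly_Mapping.lookup P 0) ` X []"

text \<open>The identification \<open>X(v) = X\<^bsub>-\<partial>\<^esub>(v)\<close> of maps with one argument with endomorphisms.\<close>

definition W_0_ident :: "('v list \<Rightarrow> 'v lpoly set) \<Rightarrow> 'v \<Rightarrow> 'v"
  where "W_0_ident X v = (let P = rep (X [v]) in
    \<Sum>m\<in>Poly_Mapping.keys P. ((\<lambda>u. - D u) ^^ Poly_Mapping.lookup m 0) (Poly_Mapping.lookup P m))"

end

section \<open>Differential superalgebras\<close>

text \<open>The sort \<open>{ring, monoid_mult}\<close> rather than \<^class>\<open>ring_1\<close> admits the zero algebra.\<close>

locale comm_diff_superalgebra = diff_supermodule scale G D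
  for scale :: "'f::field_char_0 \<Rightarrow> 'v::{ring, monoid_mult} \<Rightarrow> 'v"
    and G :: "bit \<Rightarrow> 'v set" and D :: "'v \<Rightarrow> 'v" +
  assumes scale_mult_left: "scale c (x * y) = scale c x * y"
    and scale_mult_right: "scale c (x * y) = x * scale c y"
    and mult_G: "x \<in> G p \<Longrightarrow> y \<in> G q \<Longrightarrow> x * y \<in> G (p + q)"
    and one_G: "1 \<in> G 0"
    and supercomm: "x \<in> G p \<Longrightarrow> y \<in> G q \<Longrightarrow> x * y = scale (psign (p * q)) (y * x)"
    and D_mult: "D (x * y) = D x * y + x * D y"

sublocale comm_diff_superalgebra \<subseteq> Pi: diff_supermodule scale "rev_parity G" D
proof
  show "subspace (rev_parity G p)" for p
    by (simp add: rev_parity_def subspace_G)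
  show "rev_parity G 0 \<inter> rev_parity G 1 = {0}"
    using G_Int by (simp add: rev_parity_def Int_commute)
  show "\<exists>x\<in>rev_parity G 0. \<exists>y\<in>rev_parity G 1. v = x + y" for v
    using G_sum[of v] by (simp add: rev_parity_def) (metis add.commute)
  show "v \<in> rev_parity G p \<Longrightarrow> D v \<in> rev_parity G p" for v p
    by (simp add: rev_parity_def even_D)
qed (use linear_D in \<open>auto simp: Vector_Spaces.linear_def module_hom_def module_hom_axioms_def\<close>)

context comm_diff_superalgebra
begin

text \<open>\<open>arrow i P c\<close> is \<open>P(\<lambda>\<^sub>0, \<dots>, \<lambda>\<^sub>i + \<partial>, \<dots>, \<lambda>\<^sub>k)\<^sub>\<rightarrow> c\<close>, with \<open>\<partial>\<close> acting on \<open>c\<close> only.\<close>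

definition lam_D :: "nat \<Rightarrow> 'v lpoly \<Rightarrow> 'v lpoly"
  where "lam_D i Q = lvar i \<odot> Q + Poly_Mapping.map D Q"

definition arrow :: "nat \<Rightarrow> 'v lpoly \<Rightarrow> 'v \<Rightarrow> 'v lpoly"
  where "arrow i P c = (\<Sum>m\<in>Poly_Mapping.keys P. Poly_Mapping.single (Poly_Mapping.update i 0 m) 1 \<odot>
    Poly_Mapping.map ((*) (Poly_Mapping.lookup P m)) ((lam_D i ^^ Poly_Mapping.lookup m i) (lconst c)))"

definition qarrow :: "nat \<Rightarrow> nat \<Rightarrow> 'v lpoly set \<Rightarrow> 'v \<Rightarrow> 'v lpoly set"
  where "qarrow n i A c = cls n (arrow i (rep A) c)"

text \<open>The parities in the Leibniz rule are those of \<open>\<V>\<close>, not of \<open>\<Pi>\<V>\<close>. The entry of \<open>vs\<close> at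
  position \<open>i\<close> is overwritten, and so plays no role; \<open>k - i = n - 1 - i\<close>.\<close>

definition leibniz :: "nat \<Rightarrow> ('v list \<Rightarrow> 'v lpoly set) \<Rightarrow> bool"
  where "leibniz n X \<longleftrightarrow> (\<forall>vs\<in>args n. \<forall>ps i b c pb pc.
    homog ps vs \<and> i < n \<and> b \<in> G pb \<and> c \<in> G pc \<longrightarrow>
    (let t = (\<Sum>j\<in>{i + 1..<n}. ps ! j) + of_nat (n - 1 - i) in
      X (vs[i := b * c]) =
        qadd n (qscale n (psign (pc * t)) (qarrow n i (X (vs[i := b])) c))
          (qscale n (psign (pb * (pc + t))) (qarrow n i (X (vs[i := c])) b))))"

definition Was :: "nat \<Rightarrow> ('v list \<Rightarrow> 'v lpoly set) set"
  where "Was n = {X \<in> Pi.W n. leibniz n X}"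

definition Was_minus1 :: "('f, 'v list \<Rightarrow> 'v lpoly set) superspace_str"
  where "Was_minus1 = \<lparr>ss_carrier = Was 0, ss_zero = wzero 0, ss_add = wadd 0, ss_scale = wscale 0,
    ss_part = (\<lambda>q. Was 0 \<inter> Pi.W_part 0 q)\<rparr>"

definition Was_0 :: "('f, 'v list \<Rightarrow> 'v lpoly set) lie_str"
  where "Was_0 = \<lparr>ss_carrier = Was 1, ss_zero = wzero 1, ss_add = wadd 1, ss_scale = wscale 1,
    ss_part = (\<lambda>q. Was 1 \<inter> Pi.W_part 1 q), lie_bracket = Pi.wbracket 1 1\<rparr>"

definition Der_part :: "bit \<Rightarrow> ('v \<Rightarrow> 'v) set"
  where "Der_part q = {d. Vector_Spaces.linear scale scale d \<and> (\<forall>v. d (D v) = D (d v)) \<and>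
    (\<forall>p. \<forall>x\<in>G p. d x \<in> G (q + p)) \<and>
    (\<forall>p. \<forall>x\<in>G p. \<forall>y. d (x * y) = d x * y + scale (psign (q * p)) (x * d y))}"

definition end_proj :: "bit \<Rightarrow> ('v \<Rightarrow> 'v) \<Rightarrow> 'v \<Rightarrow> 'v"
  where "end_proj q d v = (\<Sum>p\<in>{0, 1}. proj (q + p) (d (proj p v)))"

definition Der_lie :: "('f, 'v \<Rightarrow> 'v) lie_str"
  where "Der_lie = \<lparr>ss_carrier = {\<lambda>v. d v + e v | d e. d \<in> Der_part 0 \<and> e \<in> Der_part 1},
    ss_zero = (\<lambda>v. 0), ss_add = (\<lambda>d e v. d v + e v), ss_scale = (\<lambda>c d v. scale c (d v)),
    ss_part = Der_part,
    lie_bracket = (\<lambda>d e v. \<Sum>(p, q)\<in>{0, 1} \<times> {0, 1}.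
      end_proj p d (end_proj q e v) - scale (psign (p * q)) (end_proj q e (end_proj p d v)))\<rparr>"

end

end

theory Submission
  imports Defs
begin

text \<open>
  Eliminating one variable by \<open>\<lambda>\<^sub>i = - \<Sum>\<^sub>j\<^sub>\<noteq>\<^sub>i \<lambda>\<^sub>j - \<partial>\<close> gives a normal form of the classes in
  \<open>\<bbbF>\<^sub>-[\<lambda>\<^sub>0, \<dots>, \<lambda>\<^sub>k] \<otimes> V\<close>. In this normal form \<open>X\<^bsub>\<dots>,\<lambda>\<^sub>i+\<partial>,\<dots>\<^esub>(\<dots>)\<^sub>\<rightarrow> c\<close> is simply the product of the
  normal form of \<open>X\<^bsub>\<dots>,\<lambda>\<^sub>i,\<dots>\<^esub>(\<dots>)\<close> with \<open>c\<close>, so the Leibniz rule says that \<open>X\<close>, with \<open>\<lambda>\<^sub>i\<close> eliminated, is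
  a superderivation in its \<open>i\<close>-th argument.

  A summand of \<open>X \<box> Y\<close> depends, up to congruence, only on the set of arguments that go into \<open>Y\<close>. Hence
  \<open>X \<box> Y\<close> is symmetric, and for the bracket the Leibniz rule need only be checked in the last argument
  \<open>c d\<close>. The summands in which \<open>c d\<close> is an argument of \<open>X\<close> obey it. If \<open>c d\<close> is an argument of \<open>Y\<close>, the
  Leibniz rules of \<open>Y\<close> and then of \<open>X\<close> leave as defect the products \<open>X(d, a\<^sub>J) Y(a\<^sub>I, c)\<close> and
  \<open>X(c, a\<^sub>J) Y(a\<^sub>I, d)\<close> of normal forms. By supercommutativity these are, up to the sign
  \<open>(-1)\<^sup>p\<^sup>(\<^sup>X\<^sup>)\<^sup>p\<^sup>(\<^sup>Y\<^sup>)\<close>, the defects of \<open>Y \<box> X\<close> with \<open>I\<close> and \<open>J\<close> exchanged, and cancel in the bracket.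
\<close>

section \<open>Polynomials with coefficients in a vector space\<close>

text \<open>The obstacle is the choice of representatives. \<open>box_term\<close> feeds the
  coefficients of one chosen representative into another map, and a map of chosen representatives is
  additive, sesquilinear and symmetric only modulo the image of the total derivative. The box
  product is therefore studied on polynomial valued functions up to the congruence
  \<open>eqv\<close>. A change of the inner representative is harmless because \<partial> in the
  first slot of the outer map is minus the sum of the inner variables. Only normal forms are
  additive on the nose, so the Leibniz computation is done there. Which variable to eliminate in
  each factor is forced. If the last argument, with variable \<lambda>_k, is fed to Y, then X sees
  \<lambda>_k only through its first variable, which stands for the sum of all inner variables.
  Eliminating \<lambda>_k thus means eliminating the last variable of Y and the first one of X, and
  the two factors of a defect have no variables in common. Signs are exponents in the two-element
  field, with parities of \<Pi>V for arguments and of V for factors of a product.\<close>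

abbreviation (input) lk :: "('k \<Rightarrow>\<^sub>0 'c::zero) \<Rightarrow> 'k \<Rightarrow> 'c" where "lk \<equiv> Poly_Mapping.lookup"

text \<open>The action \<open>pact\<close>, evaluation \<open>evl\<close>, elimination
  \<open>elim\<close> and \<open>arrow_poly\<close> are all sums of this form, so additivity and the
  effect of multiplying by a variable are proved once for all of them.\<close>

definition ksum :: "('k \<Rightarrow> 'c::zero \<Rightarrow> 'd::comm_monoid_add) \<Rightarrow> ('k \<Rightarrow>\<^sub>0 'c) \<Rightarrow> 'd"
  where "ksum H P = (\<Sum>m\<in>Poly_Mapping.keys P. H m (lk P m))"

lemma ksum_zero [simp]: "ksum H 0 = 0"
  by (simp add: ksum_def)

lemma ksum_cong:
  "(\<And>m. m \<in> Poly_Mapping.keys P \<Longrightarrow> H m (lk P m) = H' m (lk P m)) \<Longrightarrow> ksum H P = ksum H' P"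
  by (simp add: ksum_def)

lemma ksum_single: "H m 0 = 0 \<Longrightarrow> ksum H (Poly_Mapping.single m v) = H m v"
  by (simp add: ksum_def)

text \<open>The three sums run over different key sets, so they are first padded to a common finite
  set; the padding costs only values \<open>H m 0\<close>, which lie in \<open>N\<close>. The
  subgroup \<open>N\<close> is zero for exact additivity and the range of \<open>total_D\<close> for
  additivity up to congruence.\<close>

lemma ksum_add_mod:
  fixes H :: "'k \<Rightarrow> 'c::ab_group_add \<Rightarrow> 'd::ab_group_add"
  assumes N: "0 \<in> N" "\<And>x y. x \<in> N \<Longrightarrow> y \<in> N \<Longrightarrow> x - y \<in> N"
    and H: "\<And>m u v. H m (u + v) - (H m u + H m v) \<in> N"
  shows "ksum H (P + Q) - (ksum H P + ksum H Q) \<in> N"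
proof -
  have Nadd: "x + y \<in> N" if "x \<in> N" "y \<in> N" for x y
    using N(2)[OF that(1) N(2)[OF N(1) that(2)]] by simp
  have Nsum: "sum g S \<in> N" if "\<And>x. x \<in> S \<Longrightarrow> g x \<in> N" for g and S :: "'k set"
    using that by (induction S rule: infinite_finite_induct) (auto simp: N Nadd)
  have H0: "H m 0 \<in> N" for m
    using N(2)[OF N(1) H[of m 0 0]] by simp
  define A where "A = Poly_Mapping.keys P \<union> Poly_Mapping.keys Q \<union> Poly_Mapping.keys (P + Q)"
  have A: "finite A" by (simp add: A_def)
  have 1: "(\<Sum>m\<in>A. H m (lk R m)) - ksum H R \<in> N" if "Poly_Mapping.keys R \<subseteq> A" for R
  proof -
    have "(\<Sum>m\<in>A. H m (lk R m)) = ksum H R + (\<Sum>m\<in>A - Poly_Mapping.keys R. H m (lk R m))"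
      unfolding ksum_def using sum.subset_diff[OF that A] by (metis add.commute)
    moreover have "(\<Sum>m\<in>A - Poly_Mapping.keys R. H m (lk R m)) \<in> N"
      by (rule Nsum) (simp add: in_keys_iff H0)
    ultimately show ?thesis by simp
  qed
  let ?S = "\<lambda>R. \<Sum>m\<in>A. H m (lk R m)"
  have "?S (P + Q) - (?S P + ?S Q) \<in> N"
    by (simp add: sum.distrib[symmetric] sum_subtractf[symmetric] lookup_add) (intro Nsum H)
  moreover have "?S (P + Q) - ksum H (P + Q) \<in> N" "?S P - ksum H P \<in> N" "?S Q - ksum H Q \<in> N"
    by (rule 1, force simp: A_def)+
  ultimately have "?S (P + Q) - (?S P + ?S Q) - (?S (P + Q) - ksum H (P + Q))
      + (?S P - ksum H P) + (?S Q - ksum H Q) \<in> N"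
    by (blast intro: N(2) Nadd)
  then show ?thesis by (simp add: algebra_simps)
qed

lemma ksum_add:
  fixes H :: "'k \<Rightarrow> 'c::ab_group_add \<Rightarrow> 'd::ab_group_add"
  assumes "\<And>m u v. H m (u + v) = H m u + H m v"
  shows "ksum H (P + Q) = ksum H P + ksum H Q"
  using ksum_add_mod[of "{0}" H P Q] assms by simp

lemma single_sum: "(\<Sum>m\<in>Poly_Mapping.keys P. Poly_Mapping.single m (lk P m)) = P"
  by (rule poly_mapping_eqI)
    (simp add: lookup_sum lookup_single when_def in_keys_iff)

text \<open>The last case is required only for terms that occur in \<open>P\<close>, so that facts
  about the monomials of \<open>P\<close> stay available.\<close>

lemma lpoly_single_induct [case_names zero add single]:
  assumes "Pr 0" "\<And>P Q. Pr P \<Longrightarrow> Pr Q \<Longrightarrow> Pr (P + Q)"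
    "\<And>m. m \<in> Poly_Mapping.keys P \<Longrightarrow> Pr (Poly_Mapping.single m (lk P m))"
  shows "Pr (P :: 'k \<Rightarrow>\<^sub>0 'c::comm_monoid_add)"
proof -
  have "Pr (\<Sum>m\<in>S. Poly_Mapping.single m (lk P m))" if "S \<subseteq> Poly_Mapping.keys P" for S
    using finite_subset[OF that finite_keys] that
    by (induction S rule: finite_induct) (auto intro: assms)
  from this[OF order_refl] show ?thesis by (simp add: single_sum)
qed

lemma lookup_map: "f 0 = 0 \<Longrightarrow> lk (Poly_Mapping.map f P) m = f (lk P m)"
  by (simp add: Poly_Mapping.map.rep_eq when_def)

lemma lconst_0 [simp]: "lconst 0 = 0"
  by (simp add: lconst_def)

lemma lconst_add: "lconst (u + v) = lconst u + lconst v"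
  by (simp add: lconst_def single_add)

lemma lconst_1: "lconst (1::'f::comm_ring_1) = 1"
  by (simp add: lconst_def)

lemma lconst_uminus: "lconst (- u) = - lconst u"
  by (simp add: lconst_def single_uminus)

lemma lconst_mult: "lconst (u * v) = lconst u * lconst v"
  by (simp add: lconst_def mult_single)

lemma lconst_inject [simp]: "lconst u = lconst v \<longleftrightarrow> u = v"
  by (metis lconst_def lookup_single_eq)

lemma lookup_lconst: "lk (lconst v) m = (if m = 0 then v else 0)"
  by (simp add: lconst_def lookup_single when_def)

lemma polys_0 [simp]: "0 \<in> polys n"
  by (simp add: polys_def)

lemma polys_add: "P \<in> polys n \<Longrightarrow> Q \<in> polys n \<Longrightarrow> P + Q \<in> polys n"
  using Poly_Mapping.keys_add[of P Q] by (fastforce simp: polys_def)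

lemma polys_sum: "(\<And>i. i \<in> I \<Longrightarrow> f i \<in> polys n) \<Longrightarrow> sum f I \<in> polys n"
  by (induction I rule: infinite_finite_induct) (auto intro: polys_add)

lemma polys_lconst [simp]: "lconst v \<in> polys n"
  by (auto simp: polys_def lconst_def)

lemma polys_lvar: "i < n \<Longrightarrow> lvar i \<in> polys n"
  by (auto simp: polys_def lvar_def)

lemma polys_uminus: "P \<in> polys n \<Longrightarrow> - (P :: 'a::ab_group_add lpoly) \<in> polys n"
  by (simp add: polys_def in_keys_iff)

lemma polys_diff:
  "P \<in> polys n \<Longrightarrow> Q \<in> polys n \<Longrightarrow> P - (Q :: 'a::ab_group_add lpoly) \<in> polys n"
  using polys_add[OF _ polys_uminus, of P n Q] by simp

lemma polys_map: "f 0 = 0 \<Longrightarrow> P \<in> polys n \<Longrightarrow> Poly_Mapping.map f P \<in> polys n"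
  by (auto simp: polys_def in_keys_iff lookup_map)

lemma map_add:
  assumes "\<And>u v. f (u + v) = f u + (f v :: 'c::ab_group_add)"
  shows "Poly_Mapping.map f (P + Q) = Poly_Mapping.map f P + Poly_Mapping.map f (Q :: 'k \<Rightarrow>\<^sub>0 'b::ab_group_add)"
proof -
  have "f 0 = 0" using assms[of 0 0] by simp
  then show ?thesis by (intro poly_mapping_eqI) (simp add: lookup_map lookup_add assms)
qed

lemma map_lconst: "f 0 = 0 \<Longrightarrow> Poly_Mapping.map f (lconst v) = lconst (f v)"
  by (rule poly_mapping_eqI) (simp add: lookup_map lookup_lconst)

context vector_space
begin

lemma pact_ksum: "f \<odot> P = ksum (\<lambda>a c. ksum (\<lambda>b v. Poly_Mapping.single (a + b) (scale c v)) P) f"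
  by (simp add: pact_def ksum_def)

lemma pact_add_right: "f \<odot> (P + Q) = f \<odot> P + f \<odot> Q"
  unfolding pact_ksum
  by (subst ksum_add) (simp_all add: scale_right_distrib single_add ksum_def sum.distrib)

lemma pact_add_left: "(f + g) \<odot> P = f \<odot> P + g \<odot> P"
  unfolding pact_ksum
  by (subst ksum_add) (simp_all add: scale_left_distrib single_add ksum_def sum.distrib)

lemma pact_zero [simp]: "f \<odot> 0 = 0" "0 \<odot> P = 0"
  by (simp_all add: pact_ksum ksum_def)

lemma pact_single:
  "Poly_Mapping.single a c \<odot> Poly_Mapping.single b v = Poly_Mapping.single (a + b) (scale c v)"
  by (simp add: pact_ksum ksum_single)

lemma pact_one: "1 \<odot> P = P"
proof (induction P rule: lpoly_single_induct)
  case (single m)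
  then show ?case using pact_single[of 0 1 m] by simp
qed (simp_all add: pact_add_right)

lemma pact_mult: "f \<odot> g \<odot> P = (f * g) \<odot> P"
proof (induction P rule: lpoly_single_induct)
  case (single m)
  show ?case
  proof (induction f rule: lpoly_single_induct)
    case (single k)
    show ?case
      by (induction g rule: lpoly_single_induct)
        (simp_all add: pact_add_left pact_add_right distrib_left pact_single mult_single add.assoc)
  qed (simp_all add: pact_add_left distrib_right)
qed (simp_all add: pact_add_right)

sublocale pact: module pact
  by unfold_locales (simp_all add: pact_add_left pact_add_right pact_mult pact_one)

lemma lookup_lconst_pact: "lk (lconst c \<odot> P) m = scale c (lk P m)"
proof (induction P rule: lpoly_single_induct)
  case (single k)
  show ?case using pact_single[of 0 c k] by (simp add: lconst_def lookup_single when_def)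
qed (simp_all add: pact_add_right lookup_add scale_right_distrib)

lemma lconst_pact_lconst [simp]: "lconst c \<odot> lconst v = lconst (scale c v)"
  by (simp add: lconst_def pact_single)

lemma lvar_pact_single: "lvar i \<odot> Poly_Mapping.single m v = Poly_Mapping.single (Poly_Mapping.single i 1 + m) v"
  by (simp add: lvar_def pact_single)

lemma lvar_pact:
  "lvar i \<odot> P = (\<Sum>m\<in>Poly_Mapping.keys P. Poly_Mapping.single (Poly_Mapping.single i 1 + m) (lk P m))"
  by (simp add: pact_def lvar_def)

lemma keys_lvar_pact:
  "Poly_Mapping.keys (lvar i \<odot> P) = (\<lambda>m. Poly_Mapping.single i 1 + m) ` Poly_Mapping.keys P"
proof -
  have l: "lk (lvar i \<odot> P) k = (\<Sum>m\<in>Poly_Mapping.keys P. if Poly_Mapping.single i 1 + m = k then lk P m else 0)" for k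
    by (simp add: lvar_pact lookup_sum lookup_single when_def)
  show ?thesis
  proof (intro set_eqI iffI)
    fix k assume "k \<in> Poly_Mapping.keys (lvar i \<odot> P)"
    then show "k \<in> (\<lambda>m. Poly_Mapping.single i 1 + m) ` Poly_Mapping.keys P"
      unfolding in_keys_iff l
      by (elim sum.not_neutral_contains_not_neutral) (auto simp: in_keys_iff split: if_splits)
  next
    fix k assume "k \<in> (\<lambda>m. Poly_Mapping.single i 1 + m) ` Poly_Mapping.keys P"
    then obtain m where "m \<in> Poly_Mapping.keys P" "k = Poly_Mapping.single i 1 + m" by auto
    then show "k \<in> Poly_Mapping.keys (lvar i \<odot> P)"
      by (simp add: in_keys_iff l)
  qed
qed

lemma lookup_lvar_pact: "lk (lvar i \<odot> P) (Poly_Mapping.single i 1 + m) = lk P m"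
  by (simp add: lvar_pact lookup_sum lookup_single when_def in_keys_iff)

text \<open>Multiplication by a variable is injective on monomials and keeps the coefficients, so it
  merely reindexes the keys.\<close>

lemma ksum_lvar_pact:
  "ksum H (lvar i \<odot> P) = ksum (\<lambda>m. H (Poly_Mapping.single i 1 + m)) P"
  unfolding ksum_def keys_lvar_pact
  by (subst sum.reindex) (auto simp: inj_on_def lookup_lvar_pact simp del: One_nat_def)

lemma polys_pact:
  assumes "f \<in> polys n" "P \<in> polys n" shows "f \<odot> P \<in> polys n"
proof -
  have "Poly_Mapping.single (a + b) v \<in> polys n"
    if "a \<in> Poly_Mapping.keys f" "b \<in> Poly_Mapping.keys P" for a b and v :: 'b
    using that assms Poly_Mapping.keys_add[of a b] by (fastforce simp: polys_def)
  then show ?thesis unfolding pact_def by (intro polys_sum)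
qed

text \<open>Induction on the total degree of a monomial splits off one variable at a time. Maps that
  are additive and compatible with the variables then need to be compared on constants only.\<close>

lemma lpoly_induct [consumes 1, case_names const add lvar]:
  fixes P :: "'b lpoly"
  assumes P: "P \<in> polys n" and const: "\<And>v. Pr (lconst v)"
    and add: "\<And>P Q. P \<in> polys n \<Longrightarrow> Q \<in> polys n \<Longrightarrow> Pr P \<Longrightarrow> Pr Q \<Longrightarrow> Pr (P + Q)"
    and lvar: "\<And>i P. i < n \<Longrightarrow> P \<in> polys n \<Longrightarrow> Pr P \<Longrightarrow> Pr (lvar i \<odot> P)"
  shows "Pr P"
proof -
  have single: "Poly_Mapping.single m v \<in> polys n \<and> Pr (Poly_Mapping.single m v)"
    if "Poly_Mapping.keys m \<subseteq> {..<n}" for m v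
    using that
  proof (induction "\<Sum>i\<in>Poly_Mapping.keys m. lk m i" arbitrary: m rule: less_induct)
    case less
    show ?case
    proof (cases "m = 0")
      case True
      then show ?thesis using const[of v] by (simp add: lconst_def polys_def)
    next
      case False
      then obtain i where i: "i \<in> Poly_Mapping.keys m" by (metis keys_eq_empty ex_in_conv)
      define m' where "m' = m - Poly_Mapping.single i 1"
      have l: "lk m' j = (if j = i then lk m i - 1 else lk m j)" for j
        by (simp add: m'_def lookup_minus lookup_single when_def)
      have m: "m = Poly_Mapping.single i 1 + m'"
        using i by (intro poly_mapping_eqI) (auto simp: lookup_add l lookup_single when_def in_keys_iff)
      have k: "Poly_Mapping.keys m' \<subseteq> Poly_Mapping.keys m" by (auto simp: in_keys_iff l split: if_splits)
      have "(\<Sum>j\<in>Poly_Mapping.keys m'. lk m' j) = (\<Sum>j\<in>Poly_Mapping.keys m. lk m' j)"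
        by (rule sum.mono_neutral_left) (use k in \<open>auto simp: in_keys_iff\<close>)
      also have "\<dots> < (\<Sum>j\<in>Poly_Mapping.keys m. lk m j)"
        by (rule sum_strict_mono_ex1) (use i in \<open>auto simp: l in_keys_iff intro!: bexI[of _ i]\<close>)
      finally have "Poly_Mapping.single m' v \<in> polys n \<and> Pr (Poly_Mapping.single m' v)"
        using less k by blast
      moreover have "i < n" using i less.prems by auto
      ultimately have "lvar i \<odot> Poly_Mapping.single m' v \<in> polys n \<and> Pr (lvar i \<odot> Poly_Mapping.single m' v)"
        using lvar polys_pact polys_lvar by metis
      then show ?thesis by (simp only: lvar_pact_single flip: m)
    qed
  qed
  note addI = add and singleI = single
  have "P \<in> polys n \<and> Pr P"
  proof (induction P rule: lpoly_single_induct)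
    case zero show ?case using const[of 0] by simp
  next
    case (add P Q) then show ?case
      by (simp add: polys_add addI)
  next
    case (single m)
    then show ?case using singleI[of m] P by (auto simp: polys_def)
  qed
  then show ?thesis ..
qed

end

section \<open>Evaluation of polynomials, substitution, and the derivation on coefficients\<close>

context diff_supermodule
begin

declare pact.scale_scale [simp del]

text \<open>\<open>evl \<rho> g\<close> sends \<open>\<lambda>\<^sup>m v\<close> to \<open>\<rho>\<^sup>m \<odot> g v\<close>; both \<^const>\<open>lsubst\<close> and the sum in
  \<^const>\<open>box_term\<close> are of this form.\<close>

definition evl :: "(nat \<Rightarrow> 'f lpoly) \<Rightarrow> ('v \<Rightarrow> 'v lpoly) \<Rightarrow> 'v lpoly \<Rightarrow> 'v lpoly"
  where "evl \<rho> g = ksum (\<lambda>m v. (\<Prod>j\<in>Poly_Mapping.keys m. \<rho> j ^ lk m j) \<odot> g v)"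

lemma lsubst_evl: "lsubst \<phi> = evl \<phi> lconst"
  by (rule ext) (simp add: lsubst_def evl_def ksum_def)

lemma prod_pow_single_add:
  "(\<Prod>j\<in>Poly_Mapping.keys (Poly_Mapping.single i 1 + m). \<rho> j ^ lk (Poly_Mapping.single i 1 + m) j)
    = (\<rho> i :: 'c::comm_ring_1) * (\<Prod>j\<in>Poly_Mapping.keys m. \<rho> j ^ lk m j)"
proof -
  let ?A = "insert i (Poly_Mapping.keys m)"
  have k: "Poly_Mapping.keys (Poly_Mapping.single i 1 + m) = ?A"
    by (auto simp: in_keys_iff lookup_add lookup_single when_def split: if_splits)
  have "(\<Prod>j\<in>?A. \<rho> j ^ lk (Poly_Mapping.single i 1 + m) j)
      = (\<Prod>j\<in>?A. (if j = i then \<rho> i else 1) * \<rho> j ^ lk m j)"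
    by (rule prod.cong) (auto simp: lookup_add lookup_single when_def)
  also have "\<dots> = \<rho> i * (\<Prod>j\<in>?A. \<rho> j ^ lk m j)"
    by (simp add: prod.distrib prod.delta)
  also have "(\<Prod>j\<in>?A. \<rho> j ^ lk m j) = (\<Prod>j\<in>Poly_Mapping.keys m. \<rho> j ^ lk m j)"
    by (rule prod.mono_neutral_right) (auto simp: in_keys_iff)
  finally show ?thesis by (simp only: k)
qed

lemma evl_0 [simp]: "evl \<rho> g 0 = 0"
  by (simp add: evl_def)

lemma evl_lvar: "evl \<rho> g (lvar i \<odot> P) = \<rho> i \<odot> evl \<rho> g P"
  unfolding evl_def ksum_lvar_pact prod_pow_single_add
  by (simp add: ksum_def pact.scale_sum_right pact_mult)

lemma evl_add:
  assumes "\<And>u v. g (u + v) = g u + g v"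
  shows "evl \<rho> g (P + Q) = evl \<rho> g P + evl \<rho> g Q"
  unfolding evl_def by (rule ksum_add) (simp add: assms pact.scale_right_distrib)

lemma evl_lconst: "g 0 = 0 \<Longrightarrow> evl \<rho> g (lconst v) = g v"
  unfolding evl_def lconst_def by (subst ksum_single) auto

lemma evl_cong:
  assumes "P \<in> polys n" "\<And>j. j < n \<Longrightarrow> \<rho> j = \<rho>' j"
    "\<And>m. m \<in> Poly_Mapping.keys P \<Longrightarrow> g (lk P m) = g' (lk P m)"
  shows "evl \<rho> g P = evl \<rho>' g' P"
  unfolding evl_def
proof (rule ksum_cong)
  fix m assume m: "m \<in> Poly_Mapping.keys P"
  have "(\<Prod>j\<in>Poly_Mapping.keys m. \<rho> j ^ lk m j) = (\<Prod>j\<in>Poly_Mapping.keys m. \<rho>' j ^ lk m j)"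
  proof (rule prod.cong)
    fix j assume "j \<in> Poly_Mapping.keys m"
    then have "j < n" using m assms(1) by (auto simp: polys_def)
    then show "\<rho> j ^ lk m j = \<rho>' j ^ lk m j" by (simp add: assms(2))
  qed simp
  then show "(\<Prod>j\<in>Poly_Mapping.keys m. \<rho> j ^ lk m j) \<odot> g (lk P m)
      = (\<Prod>j\<in>Poly_Mapping.keys m. \<rho>' j ^ lk m j) \<odot> g' (lk P m)"
    by (simp add: assms(3) m)
qed

lemma polys_prod_pow:
  fixes \<rho> :: "nat \<Rightarrow> 'f lpoly"
  assumes "\<And>j. j \<in> A \<Longrightarrow> \<rho> j \<in> polys n"
  shows "(\<Prod>j\<in>A. \<rho> j ^ k j) \<in> polys n" (is "?P \<in> _")
proof -
  have mult: "f * g \<in> polys n" if "f \<in> polys n" "g \<in> polys n" for f g :: "'f lpoly"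
    unfolding polys_def
  proof (intro CollectI ballI)
    fix m assume "m \<in> Poly_Mapping.keys (f * g)"
    then obtain u v where m: "m = u + v" "u \<in> Poly_Mapping.keys f" "v \<in> Poly_Mapping.keys g"
      using Poly_Mapping.keys_mult[of f g] by auto
    then have "Poly_Mapping.keys u \<subseteq> {..<n}" "Poly_Mapping.keys v \<subseteq> {..<n}"
      using that by (auto simp: polys_def)
    then show "Poly_Mapping.keys m \<subseteq> {..<n}"
      using Poly_Mapping.keys_add[of u v] m(1) by blast
  qed
  have one: "(1 :: 'f lpoly) \<in> polys n" by (metis lconst_1 polys_lconst)
  have "\<rho> j ^ i \<in> polys n" if "j \<in> A" for i j
    by (induction i) (auto intro: one mult assms that)
  then show ?thesis
    by (induction A rule: infinite_finite_induct) (auto intro: one mult)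
qed

lemma polys_evl:
  assumes "P \<in> polys a" "\<And>j. j < a \<Longrightarrow> \<rho> j \<in> polys n"
    "\<And>m. m \<in> Poly_Mapping.keys P \<Longrightarrow> g (lk P m) \<in> polys n"
  shows "evl \<rho> g P \<in> polys n"
  unfolding evl_def ksum_def
  by (intro polys_sum polys_pact polys_prod_pow assms) (use assms(1) in \<open>auto simp: polys_def\<close>)

lemma lsubst_add: "lsubst \<phi> (P + Q) = lsubst \<phi> P + lsubst \<phi> Q"
  unfolding lsubst_evl by (rule evl_add) (simp add: lconst_add)

lemma lsubst_lvar: "lsubst \<phi> (lvar i \<odot> P) = \<phi> i \<odot> lsubst \<phi> P"
  unfolding lsubst_evl by (rule evl_lvar)

lemma lsubst_lconst [simp]: "lsubst \<phi> (lconst v) = lconst v"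
  unfolding lsubst_evl by (simp add: evl_lconst)

lemma lsubst_cong:
  "P \<in> polys n \<Longrightarrow> (\<And>j. j < n \<Longrightarrow> \<phi> j = \<psi> j) \<Longrightarrow> lsubst \<phi> P = lsubst \<psi> P"
  unfolding lsubst_evl by (erule evl_cong) auto

lemma polys_lsubst:
  "P \<in> polys a \<Longrightarrow> (\<And>j. j < a \<Longrightarrow> \<phi> j \<in> polys n) \<Longrightarrow> lsubst \<phi> P \<in> polys n"
  unfolding lsubst_evl by (rule polys_evl) auto

lemma polys_UN: "\<exists>n. (P :: 'a::zero lpoly) \<in> polys n"
proof -
  have "finite (\<Union>m\<in>Poly_Mapping.keys P. Poly_Mapping.keys m)" by auto
  then obtain n where "\<forall>i\<in>(\<Union>m\<in>Poly_Mapping.keys P. Poly_Mapping.keys m). i < n"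
    unfolding finite_nat_set_iff_bounded by blast
  then show ?thesis unfolding polys_def by blast
qed

text \<open>A polynomial involves finitely many variables, so no bound on them has to be carried
  along.\<close>

lemma lpoly_induct_all [case_names const add lvar]:
  fixes P :: "'v lpoly"
  assumes "\<And>v. Pr (lconst v)" "\<And>P Q. Pr P \<Longrightarrow> Pr Q \<Longrightarrow> Pr (P + Q)"
    "\<And>i P. Pr P \<Longrightarrow> Pr (lvar i \<odot> P)"
  shows "Pr P"
proof -
  obtain n where "P \<in> polys n" using polys_UN by blast
  then show ?thesis by (induction P rule: lpoly_induct) (auto intro: assms)
qed

lemma evl_smult:
  assumes "\<And>u v. g (u + v) = g u + g v" "\<And>v. g (scale c v) = lconst c \<odot> g v"
  shows "evl \<rho> g (lconst c \<odot> P) = lconst c \<odot> evl \<rho> g P"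
proof (induction P rule: lpoly_induct_all)
  case (const v)
  have g0: "g 0 = 0" using assms(1)[of 0 0] by simp
  then show ?case by (simp add: evl_lconst assms)
next
  case (add P Q)
  then show ?case by (simp add: evl_add assms pact.scale_right_distrib)
next
  case (lvar i P)
  have "evl \<rho> g (lconst c \<odot> lvar i \<odot> P) = evl \<rho> g (lvar i \<odot> lconst c \<odot> P)"
    by (metis pact.scale_left_commute)
  also have "\<dots> = lconst c \<odot> evl \<rho> g (lvar i \<odot> P)"
    by (simp only: evl_lvar lvar) (rule pact.scale_left_commute)
  finally show ?case .
qed

lemma lsubst_smult: "lsubst \<phi> (lconst c \<odot> P) = lconst c \<odot> lsubst \<phi> P"
  unfolding lsubst_evl by (rule evl_smult) (simp_all add: lconst_add)

definition D_poly :: "'v lpoly \<Rightarrow> 'v lpoly" where "D_poly = Poly_Mapping.map D"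

lemma D_add: "D (u + v) = D u + D v" and D_scale: "D (scale c v) = scale c (D v)"
  using linear_D by (auto simp: Vector_Spaces.linear_iff)

lemma D_0 [simp]: "D 0 = 0" using D_add[of 0 0] by simp

lemma D_poly_add: "D_poly (P + Q) = D_poly P + D_poly Q"
  unfolding D_poly_def by (rule map_add) (rule D_add)

lemma D_poly_lconst [simp]: "D_poly (lconst v) = lconst (D v)"
  unfolding D_poly_def by (rule map_lconst) simp

lemma lookup_D_poly: "lk (D_poly P) m = D (lk P m)"
  by (simp add: D_poly_def lookup_map)

lemma D_poly_0 [simp]: "D_poly 0 = 0"
  by (rule poly_mapping_eqI) (simp add: lookup_D_poly)

lemma D_poly_pact: "D_poly (f \<odot> P) = f \<odot> D_poly P"
proof (induction P rule: lpoly_single_induct)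
  case zero show ?case by simp
next
  case (add P Q) then show ?case by (simp add: pact.scale_right_distrib D_poly_add)
next
  case (single m)
  have s: "D_poly (Poly_Mapping.single k v) = Poly_Mapping.single k (D v)" for k v
    by (rule poly_mapping_eqI) (simp add: lookup_D_poly lookup_single when_def)
  show ?case
    by (induction f rule: lpoly_single_induct)
      (simp_all add: pact.scale_left_distrib D_poly_add pact_single s D_scale)
qed

lemma D_poly_minus: "D_poly (- P) = - D_poly P"
  using D_poly_add[of P "-P"] by (simp add: eq_neg_iff_add_eq_0 add.commute)

lemma polys_D_poly: "P \<in> polys n \<Longrightarrow> D_poly P \<in> polys n"
  unfolding D_poly_def by (rule polys_map) simp

lemma lsubst_D_poly: "lsubst \<phi> (D_poly P) = D_poly (lsubst \<phi> P)"
  by (induction P rule: lpoly_induct_all) (simp_all add: D_poly_add lsubst_add D_poly_pact lsubst_lvar)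

section \<open>Congruence modulo the total derivative\<close>

abbreviation "lsum n \<equiv> (\<Sum>i<n. lvar i :: 'f lpoly)"

text \<open>Congruence modulo the image of \<open>\<lambda>\<^sub>0 + \<dots> + \<lambda>\<^sub>k + \<partial>\<close> on polynomials in arbitrarily many variables; on
  \<open>polys n\<close> this is the congruence that defines \<^const>\<open>quot\<close>.\<close>

definition total_D :: "nat \<Rightarrow> 'v lpoly \<Rightarrow> 'v lpoly" where "total_D n R = lsum n \<odot> R + D_poly R"

definition eqv :: "nat \<Rightarrow> 'v lpoly \<Rightarrow> 'v lpoly \<Rightarrow> bool"
  where "eqv n P Q \<longleftrightarrow> P - Q \<in> range (total_D n)"

lemma total_D_add: "total_D n (P + Q) = total_D n P + total_D n Q"
  by (simp add: total_D_def pact.scale_right_distrib D_poly_add)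

lemma total_D_minus: "total_D n (- P) = - total_D n P"
  by (simp add: total_D_def D_poly_minus)

lemma total_D_pact: "total_D n (f \<odot> P) = f \<odot> total_D n P"
  by (simp add: total_D_def pact.scale_right_distrib D_poly_pact pact.scale_left_commute)

lemma total_D_0 [simp]: "total_D n 0 = 0"
  by (simp add: total_D_def)

lemma range_total_D_add: "P \<in> range (total_D n) \<Longrightarrow> Q \<in> range (total_D n) \<Longrightarrow> P + Q \<in> range (total_D n)"
  by (auto simp flip: total_D_add)

lemma range_total_D_minus: "P \<in> range (total_D n) \<Longrightarrow> - P \<in> range (total_D n)"
  by (auto simp flip: total_D_minus)

lemma range_total_D_0: "0 \<in> range (total_D n)"
  by (metis rangeI total_D_0)

lemma range_total_D_diff: "P \<in> range (total_D n) \<Longrightarrow> Q \<in> range (total_D n) \<Longrightarrow> P - Q \<in> range (total_D n)"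
  using range_total_D_add[OF _ range_total_D_minus, of P n Q] by simp

lemma eqv_refl [simp]: "eqv n P P"
  by (simp add: eqv_def range_total_D_0)

lemma eqv_sym: "eqv n P Q \<Longrightarrow> eqv n Q P"
  unfolding eqv_def using range_total_D_minus[of "P - Q"] by simp

lemma eqv_trans [trans]: "eqv n P Q \<Longrightarrow> eqv n Q R \<Longrightarrow> eqv n P R"
  unfolding eqv_def using range_total_D_add[of "P - Q" n "Q - R"] by simp

lemma eqv_add: "eqv n P Q \<Longrightarrow> eqv n P' Q' \<Longrightarrow> eqv n (P + P') (Q + Q')"
  unfolding eqv_def by (metis range_total_D_add add_diff_add)

lemma eqv_minus: "eqv n P Q \<Longrightarrow> eqv n (- P) (- Q)"
  unfolding eqv_def using range_total_D_minus[of "P - Q"] by simp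

lemma eqv_sum: "(\<And>i. i \<in> I \<Longrightarrow> eqv n (f i) (g i)) \<Longrightarrow> eqv n (sum f I) (sum g I)"
  by (induction I rule: infinite_finite_induct) (auto intro: eqv_add)

lemma eqv_pact: "eqv n P Q \<Longrightarrow> eqv n (f \<odot> P) (f \<odot> Q)"
  unfolding eqv_def by (auto simp flip: pact.scale_right_diff_distrib total_D_pact)

lemma eqv_0_iff: "eqv n P Q \<longleftrightarrow> eqv n (P - Q) 0"
  by (simp add: eqv_def)

lemma lsubst_pact_lsum: "lsubst \<phi> (lsum a \<odot> P) = (\<Sum>i<a. \<phi> i) \<odot> lsubst \<phi> P"
proof -
  have "lsubst \<phi> 0 = 0" by (simp add: lsubst_def)
  then have "lsubst \<phi> (\<Sum>i\<in>A. lvar i \<odot> P) = (\<Sum>i\<in>A. \<phi> i \<odot> lsubst \<phi> P)" for A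
    by (induction A rule: infinite_finite_induct) (auto simp: lsubst_add lsubst_lvar)
  then show ?thesis by (simp add: pact.scale_sum_left)
qed

lemma lsubst_diff: "lsubst \<phi> (P - Q) = lsubst \<phi> P - lsubst \<phi> Q"
  using lsubst_add[of \<phi> "P - Q" Q] by simp

text \<open>Such a substitution intertwines the total derivatives for \<open>a\<close> and
  \<open>n\<close> variables: it commutes with the derivation on coefficients and carries one sum of
  variables to the other.\<close>

lemma eqv_lsubst:
  assumes "eqv a P Q" "(\<Sum>i<a. \<phi> i) = lsum n"
  shows "eqv n (lsubst \<phi> P) (lsubst \<phi> Q)"
proof -
  obtain R where "P - Q = total_D a R" using assms(1) by (auto simp: eqv_def)
  then have "lsubst \<phi> P - lsubst \<phi> Q = total_D n (lsubst \<phi> R)"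
    by (simp add: total_D_def lsubst_add lsubst_pact_lsum assms(2) lsubst_D_poly flip: lsubst_diff)
  then show ?thesis by (simp add: eqv_def)
qed

lemma evl_add_eqv:
  assumes "\<And>u v. eqv n (g (u + v)) (g u + g v)"
  shows "eqv n (evl \<rho> g (P + Q)) (evl \<rho> g P + evl \<rho> g Q)"
  unfolding eqv_def evl_def
proof (rule ksum_add_mod)
  fix m and u v :: 'v
  show "(\<Prod>j\<in>Poly_Mapping.keys m. \<rho> j ^ lk m j) \<odot> g (u + v) -
      ((\<Prod>j\<in>Poly_Mapping.keys m. \<rho> j ^ lk m j) \<odot> g u +
       (\<Prod>j\<in>Poly_Mapping.keys m. \<rho> j ^ lk m j) \<odot> g v) \<in> range (total_D n)" (is "?f \<odot> _ - _ \<in> _")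
    using eqv_pact[OF assms, of ?f u v] by (simp add: eqv_def pact.scale_right_distrib)
qed (auto intro: range_total_D_0 range_total_D_diff)

lemma evl_eqv_cong:
  "(\<And>v. eqv n (g v) (g' v)) \<Longrightarrow> eqv n (evl \<rho> g P) (evl \<rho> g' P)"
  unfolding evl_def ksum_def by (intro eqv_sum eqv_pact) auto

lemma evl_lconst_eqv: "eqv n (g 0) 0 \<Longrightarrow> eqv n (evl \<rho> g (lconst v)) (g v)"
  by (cases "v = 0") (auto simp: evl_def lconst_def ksum_def eqv_sym)

text \<open>A preimage under \<open>total_D n\<close> may contain further variables. Setting these
  to zero changes neither \<open>R\<close> nor the sum of the first \<open>n\<close> variables, so a
  preimage in \<open>polys n\<close> exists as well.\<close>

lemma lam_im_iff: "R \<in> lam_im n \<longleftrightarrow> R \<in> polys n \<and> R \<in> range (total_D n)"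
proof
  assume "R \<in> lam_im n"
  then obtain S where S: "S \<in> polys n" "R = total_D n S"
    by (auto simp: lam_im_def total_D_def D_poly_def)
  then show "R \<in> polys n \<and> R \<in> range (total_D n)"
    by (auto simp: total_D_def intro!: polys_add polys_pact polys_D_poly polys_sum polys_lvar)
next
  assume R: "R \<in> polys n \<and> R \<in> range (total_D n)"
  then obtain S where S: "R = total_D n S" by auto
  let ?\<phi> = "\<lambda>i. if i < n then lvar i else 0"
  have id: "lsubst ?\<phi> P = P" if "P \<in> polys n" for P
    using that
    by (induction P rule: lpoly_induct) (auto simp: lsubst_add lsubst_lvar)
  have "R = lsubst ?\<phi> (total_D n S)" using id R S by metis
  also have "\<dots> = total_D n (lsubst ?\<phi> S)"
    by (simp add: total_D_def lsubst_add lsubst_pact_lsum lsubst_D_poly)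
  finally have "R = total_D n (lsubst ?\<phi> S)" .
  moreover obtain k where "S \<in> polys k" using polys_UN by blast
  then have "lsubst ?\<phi> S \<in> polys n"
    by (rule polys_lsubst) (auto intro: polys_lvar)
  ultimately show "R \<in> lam_im n"
    by (auto simp: lam_im_def total_D_def D_poly_def)
qed

section \<open>Classes and their representatives\<close>

lemma cls_eq:
  assumes "P \<in> polys n" shows "cls n P = {Q \<in> polys n. eqv n Q P}"
proof (intro set_eqI iffI)
  fix Q assume "Q \<in> cls n P"
  then obtain R where "Q = P + R" "R \<in> lam_im n" by (auto simp: cls_def)
  then show "Q \<in> {Q \<in> polys n. eqv n Q P}"
    using assms polys_add[of P n R] by (simp add: lam_im_iff eqv_def)
next
  fix Q assume "Q \<in> {Q \<in> polys n. eqv n Q P}"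
  then have "Q - P \<in> lam_im n" "Q = P + (Q - P)"
    using assms by (auto simp: lam_im_iff eqv_def polys_diff)
  then show "Q \<in> cls n P" unfolding cls_def by blast
qed

lemma cls_eq_iff: "P \<in> polys n \<Longrightarrow> Q \<in> polys n \<Longrightarrow> cls n P = cls n Q \<longleftrightarrow> eqv n P Q"
  by (auto simp: cls_eq intro: eqv_trans eqv_sym)

lemma quot_rep:
  assumes "A \<in> quot n" shows "rep A \<in> polys n" "cls n (rep A) = A"
proof -
  obtain P where P: "P \<in> polys n" "A = cls n P" using assms by (auto simp: quot_def)
  then have "P \<in> A" by (simp add: cls_eq)
  then have "rep A \<in> A" unfolding rep_def by (rule someI)
  then show "rep A \<in> polys n" "cls n (rep A) = A"
    using P by (auto simp: cls_eq intro: eqv_trans eqv_sym)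
qed

lemma rep_cls:
  assumes "P \<in> polys n" shows "rep (cls n P) \<in> polys n" "eqv n (rep (cls n P)) P"
proof -
  have "cls n P \<in> quot n" using assms by (auto simp: quot_def)
  from quot_rep[OF this] show "rep (cls n P) \<in> polys n" "eqv n (rep (cls n P)) P"
    using assms cls_eq_iff by blast+
qed

lemma cls_quot: "P \<in> polys n \<Longrightarrow> cls n P \<in> quot n"
  by (auto simp: quot_def)

end

section \<open>Koszul signs\<close>

declare add_bit_eq_xor [simp del] mult_bit_eq_and [simp del]

lemma bit_add_self [simp]: "(p::bit) + p = 0"
  by (cases p) auto

lemma bit_add_self_left [simp]: "(p::bit) + (p + q) = q"
  by (cases p; cases q) auto

lemma psign_add: "psign (p + q) = psign p * psign q"
  by (cases p; cases q) (simp_all add: psign_def)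

lemma psign_0 [simp]: "psign 0 = 1"
  by (simp add: psign_def)

lemma psign_of_nat: "psign (of_nat k) = (- 1 :: 'a::ring_1) ^ k"
  by (induction k) (simp_all add: psign_add, simp add: psign_def)

text \<open>The exponent of the Koszul sign in the two-element field: a product of parities is 1
  exactly for two odd entries. The recursion over the list replaces counting a set of pairs of
  positions.\<close>

fun epar :: "bit list \<Rightarrow> nat list \<Rightarrow> bit" where
  "epar ps [] = 0"
| "epar ps (x # xs) = (\<Sum>y\<leftarrow>xs. if y < x then ps ! x * ps ! y else 0) + epar ps xs"

definition cross :: "bit list \<Rightarrow> nat list \<Rightarrow> nat list \<Rightarrow> bit"
  where "cross ps xs ys = (\<Sum>x\<leftarrow>xs. \<Sum>y\<leftarrow>ys. if y < x then ps ! x * ps ! y else 0)"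

lemma of_nat_card_nth:
  "of_nat (card {l. l < length xs \<and> P (xs ! l)}) = (\<Sum>y\<leftarrow>xs. if P y then 1 else (0 :: 'a::semiring_1))"
proof (induction xs)
  case (Cons x xs)
  have "{l. l < length (x # xs) \<and> P ((x # xs) ! l)}
      = (if P x then {0} else {}) \<union> Suc ` {l. l < length xs \<and> P (xs ! l)}"
    by (auto simp: less_Suc_eq_0_disj)
  then show ?case using Cons by (simp add: card_image)
qed simp

lemma eps_epar: "eps ps is = (psign (epar ps is) :: 'a::ring_1)"
proof -
  define S where "S = (\<lambda>is. {(j, l). j < l \<and> l < length is \<and> is ! j > is ! l \<and>
    ps ! (is ! j) = 1 \<and> ps ! (is ! l) = 1})"
  have fin: "finite (S is)" for "is"
    by (rule finite_subset[of _ "{..<length is} \<times> {..<length is}"]) (auto simp: S_def)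
  have "of_nat (card (S is)) = epar ps is" for "is"
  proof (induction "is")
    case Nil show ?case by (simp add: S_def)
  next
    case (Cons x xs)
    let ?P = "\<lambda>y. y < x \<and> ps ! x = 1 \<and> ps ! y = 1"
    let ?A = "Pair (0 :: nat) ` Suc ` {l. l < length xs \<and> ?P (xs ! l)}"
    let ?B = "map_prod Suc Suc ` S xs"
    \<comment> \<open>Inversions with first position 0, and the inversions of the tail with both
      positions shifted.\<close>
    have "S (x # xs) = ?A \<union> ?B"
    proof (intro set_eqI iffI)
      fix z assume "z \<in> S (x # xs)"
      then obtain j l where "z = (j, Suc l)" "(j, Suc l) \<in> S (x # xs)"
        unfolding S_def by (cases "snd z") auto
      then show "z \<in> ?A \<union> ?B"
        by (cases j) (auto simp: S_def image_iff)
    qed (auto simp: S_def)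
    moreover have "card (?A \<union> ?B) = card ?A + card ?B"
      using fin[of xs] by (subst card_Un_disjoint) auto
    moreover have "card ?A = card {l. l < length xs \<and> ?P (xs ! l)}"
      by (simp add: card_image inj_on_def)
    moreover have "card ?B = card (S xs)"
      by (rule card_image) (auto simp: inj_on_def)
    ultimately have "of_nat (card (S (x # xs)))
        = (of_nat (card {l. l < length xs \<and> ?P (xs ! l)}) :: bit) + of_nat (card (S xs))" by simp
    also have "of_nat (card {l. l < length xs \<and> ?P (xs ! l)})
        = (\<Sum>y\<leftarrow>xs. if ?P y then 1 else 0 :: bit)"
      by (rule of_nat_card_nth)
    also have "\<dots> = (\<Sum>y\<leftarrow>xs. if y < x then ps ! x * ps ! y else 0)"
    proof -
      have "(if ?P y then 1 else 0) = (if y < x then ps ! x * ps ! y else 0)" for y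
        by (cases "ps ! x"; cases "ps ! y") auto
      then show ?thesis by presburger
    qed
    finally show ?case using Cons by simp
  qed
  moreover have "eps ps is = (- 1 :: 'a) ^ card (S is)" by (simp add: eps_def S_def)
  ultimately show ?thesis by (simp flip: psign_of_nat)
qed

lemma epar_append: "epar ps (xs @ ys) = epar ps xs + epar ps ys + cross ps xs ys"
  by (induction xs) (auto simp: cross_def algebra_simps)

lemma epar_cong: "(\<And>x. x \<in> set xs \<Longrightarrow> ps ! x = qs ! x) \<Longrightarrow> epar ps xs = epar qs xs"
  by (induction xs) (auto intro!: arg_cong[of _ _ sum_list] map_cong)

lemma cross_mset:
  "mset xs = mset xs' \<Longrightarrow> mset ys = mset ys' \<Longrightarrow> cross ps xs ys = cross ps xs' ys'"
  unfolding cross_def sum_mset_sum_list[symmetric] mset_map by simp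

lemma epar_sorted: "sorted xs \<Longrightarrow> epar ps xs = 0"
proof (induction xs)
  case (Cons x xs)
  then have "(\<Sum>y\<leftarrow>xs. if y < x then ps ! x * ps ! y else 0) = (\<Sum>y\<leftarrow>xs. 0)"
    by (intro arg_cong[of _ _ sum_list] map_cong) auto
  with Cons show ?case by simp
qed simp

abbreviation lpar :: "bit list \<Rightarrow> nat list \<Rightarrow> bit" where "lpar ps xs \<equiv> \<Sum>x\<leftarrow>xs. ps ! x"

text \<open>Two entries from disjoint lists are inverted in exactly one of the two orders, so every
  pair is counted once.\<close>

lemma cross_swap:
  assumes "set xs \<inter> set ys = {}"
  shows "cross ps xs ys + cross ps ys xs = lpar ps xs * lpar ps ys"
  using assms
proof (induction xs)
  case (Cons x xs)
  have 1: "cross ps (x # xs) ys = (\<Sum>y\<leftarrow>ys. if y < x then ps ! x * ps ! y else 0) + cross ps xs ys"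
    by (simp add: cross_def)
  have 2: "cross ps ys (x # xs) = (\<Sum>y\<leftarrow>ys. if x < y then ps ! y * ps ! x else 0) + cross ps ys xs"
    by (simp add: cross_def sum_list_addf)
  have "(\<Sum>y\<leftarrow>ys. if y < x then ps ! x * ps ! y else 0) + (\<Sum>y\<leftarrow>ys. if x < y then ps ! y * ps ! x else 0)
      = (\<Sum>y\<leftarrow>ys. ps ! x * ps ! y)"
    unfolding sum_list_addf[symmetric] using Cons.prems
    by (intro arg_cong[of _ _ sum_list] map_cong) (auto simp: mult.commute)
  also have "\<dots> = ps ! x * lpar ps ys" by (rule sum_list_const_mult)
  finally show ?case using Cons unfolding 1 2 by (simp add: algebra_simps)
qed (simp add: cross_def)

lemma epar_block_swap:
  "set xs \<inter> set ys = {} \<Longrightarrow> epar ps (ys @ xs) = epar ps (xs @ ys) + lpar ps xs * lpar ps ys"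
  using cross_swap[of xs ys ps] unfolding epar_append
  by (metis (no_types, lifting) add.assoc add.commute bit_add_self_left)

lemma cross_le:
  assumes "\<And>x y. x \<in> set xs \<Longrightarrow> y \<in> set ys \<Longrightarrow> x \<le> y" shows "cross ps xs ys = 0"
proof -
  have "cross ps xs ys = (\<Sum>x\<leftarrow>xs. \<Sum>y\<leftarrow>ys. 0)"
    unfolding cross_def using assms by (intro arg_cong[of _ _ sum_list] map_cong refl) force
  then show ?thesis by simp
qed

lemma epar_last:
  assumes "set xs \<union> set ys \<subseteq> {..<length qs}"
  shows "epar (qs @ [t]) (xs @ ys @ [length qs]) = epar qs (xs @ ys)"
proof -
  have "epar (qs @ [t]) (xs @ ys @ [length qs]) = epar (qs @ [t]) ((xs @ ys) @ [length qs])" by simp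
  also have "\<dots> = epar (qs @ [t]) (xs @ ys)"
    unfolding epar_append[of _ "xs @ ys"] using assms by (subst cross_le) auto
  also have "\<dots> = epar qs (xs @ ys)"
    by (rule epar_cong) (use assms in \<open>auto simp: nth_append\<close>)
  finally show ?thesis .
qed

text \<open>The inserted index exceeds all others, so it is inverted exactly with the entries of
  \<open>ys\<close> behind it.\<close>

lemma epar_middle:
  assumes "set xs \<union> set ys \<subseteq> {..<length qs}"
  shows "epar (qs @ [t]) (xs @ length qs # ys) = epar qs (xs @ ys) + t * lpar qs ys"
proof -
  have s: "epar (qs @ [t]) zs = epar qs zs" "lpar (qs @ [t]) zs = lpar qs zs"
    if "set zs \<subseteq> {..<length qs}" for zs
  proof -
    have m: "(qs @ [t]) ! x = qs ! x" if "x \<in> set zs" for x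
      using that \<open>set zs \<subseteq> {..<length qs}\<close> by (auto simp: nth_append)
    show "epar (qs @ [t]) zs = epar qs zs" by (rule epar_cong) (rule m)
    show "lpar (qs @ [t]) zs = lpar qs zs"
      by (intro arg_cong[of _ _ sum_list] map_cong refl m)
  qed
  have "epar (qs @ [t]) (xs @ length qs # ys)
      = epar (qs @ [t]) xs + epar (qs @ [t]) (length qs # ys) + cross (qs @ [t]) xs (length qs # ys)"
    by (rule epar_append)
  also have "cross (qs @ [t]) xs (length qs # ys) = cross (qs @ [t]) xs ys"
    unfolding cross_def using assms by (intro arg_cong[of _ _ sum_list], intro map_cong) auto
  also have "epar (qs @ [t]) (length qs # ys) = (\<Sum>y\<leftarrow>ys. t * (qs @ [t]) ! y) + epar (qs @ [t]) ys"
    using assms by (auto intro!: arg_cong[of _ _ sum_list] map_cong)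
  also have "(\<Sum>y\<leftarrow>ys. t * (qs @ [t]) ! y) = t * lpar qs ys"
    using s(2)[of ys] assms by (simp add: sum_list_const_mult)
  finally have "epar (qs @ [t]) (xs @ length qs # ys) = epar (qs @ [t]) (xs @ ys) + t * lpar qs ys"
    by (simp add: epar_append algebra_simps)
  then show ?thesis using s(1)[of "xs @ ys"] assms by simp
qed

text \<open>The cycle that moves index \<open>i\<close> behind all the others; it reduces statements
  about the \<open>i\<close>-th argument to the last one.\<close>

abbreviation to_end :: "nat \<Rightarrow> nat \<Rightarrow> nat list"
  where "to_end n i \<equiv> [0..<i] @ [Suc i..<n] @ [i]"

lemma epar_to_end:
  "epar ps (to_end n i) = ps ! i * (\<Sum>j\<in>{Suc i..<n}. ps ! j)"
proof -
  have "epar ps ([Suc i..<n] @ [i]) = cross ps [Suc i..<n] [i]"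
    by (simp add: epar_append epar_sorted)
  also have "\<dots> = (\<Sum>x\<leftarrow>[Suc i..<n]. ps ! i * ps ! x)"
    unfolding cross_def by (intro arg_cong[of _ _ sum_list] map_cong) (auto simp: mult.commute)
  also have "\<dots> = ps ! i * (\<Sum>j\<in>{Suc i..<n}. ps ! j)"
    by (simp add: sum_list_const_mult sum_list_distinct_conv_sum_set)
  finally show ?thesis
    by (subst epar_append, subst cross_le) (auto simp: epar_sorted)
qed

lemma epar_pairs:
  "epar ps is = (\<Sum>l<length is. \<Sum>j<l. if is ! l < is ! j then ps ! (is ! j) * ps ! (is ! l) else 0)"
proof (induction "is")
  case (Cons x xs)
  show ?case
    by (simp add: sum.lessThan_Suc_shift Cons sum.distrib sum_list_sum_nth atLeast0LessThan
        del: sum.lessThan_Suc cong: if_cong)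
qed simp

text \<open>A permutation acts on unordered pairs, and the summand depends only on the unordered
  pair. In the proof a pair is stored with its larger element first.\<close>

lemma sum_pairs_permute:
  fixes g :: "nat \<Rightarrow> nat \<Rightarrow> 'a::comm_monoid_add"
  assumes \<tau>: "bij_betw \<tau> {..<n} {..<n}" and sym: "\<And>a b. a \<noteq> b \<Longrightarrow> g a b = g b a"
  shows "(\<Sum>l<n. \<Sum>j<l. g (\<tau> j) (\<tau> l)) = (\<Sum>l<n. \<Sum>j<l. g j l)"
proof -
  define P where "P = (SIGMA l:{..<n}. {..<l})"
  define f where "f = (\<lambda>(l, j). (max (\<tau> j) (\<tau> l), min (\<tau> j) (\<tau> l)))"
  have inj: "\<tau> a = \<tau> b \<longleftrightarrow> a = b" if "a < n" "b < n" for a b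
    using \<tau> that unfolding bij_betw_def by (auto dest: inj_onD)
  have lt: "\<tau> a < n" if "a < n" for a using bij_betwE[OF \<tau>] that by auto
  have "f ` P \<subseteq> P"
  proof
    fix z assume "z \<in> f ` P"
    then obtain l j where "j < l" "l < n" "z = f (l, j)" by (auto simp: P_def)
    then show "z \<in> P" using inj[of j l] lt[of l] lt[of j]
      by (auto simp: f_def P_def min_def max_def)
  qed
  moreover have "inj_on f P"
  proof (rule inj_onI)
    fix z w assume "z \<in> P" "w \<in> P" and eq: "f z = f w"
    then obtain l j l' j' where z: "z = (l, j)" "j < l" "l < n" "w = (l', j')" "j' < l'" "l' < n"
      by (auto simp: P_def)
    have "(\<tau> j = \<tau> j' \<and> \<tau> l = \<tau> l') \<or> (\<tau> j = \<tau> l' \<and> \<tau> l = \<tau> j')"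
      using eq unfolding z f_def by (auto simp: min_def max_def split: if_splits)
    then show "z = w" using z inj[of j j'] inj[of l l'] inj[of j l'] inj[of l j'] by auto
  qed
  moreover have "finite P" by (simp add: P_def)
  ultimately have bij: "bij_betw f P P" by (simp add: bij_betw_def endo_inj_surj)
  have "(\<Sum>l<n. \<Sum>j<l. g j l) = (\<Sum>(l, j)\<in>P. g j l)"
    by (simp add: P_def sum.Sigma)
  also have "\<dots> = (\<Sum>z\<in>P. case f z of (l, j) \<Rightarrow> g j l)"
    by (rule sum.reindex_bij_betw[OF bij, symmetric])
  also have "\<dots> = (\<Sum>(l, j)\<in>P. g (\<tau> j) (\<tau> l))"
    using inj by (intro sum.cong) (auto simp: f_def P_def min_def max_def intro!: sym)
  also have "\<dots> = (\<Sum>l<n. \<Sum>j<l. g (\<tau> j) (\<tau> l))"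
    by (simp add: P_def sum.Sigma)
  finally show ?thesis by simp
qed

abbreviation perms :: "nat \<Rightarrow> nat list set" where "perms n \<equiv> permutations_of_set {..<n}"

lemma perms_bij:
  assumes "\<tau> \<in> perms n" shows "length \<tau> = n" "bij_betw ((!) \<tau>) {..<n} {..<n}"
proof -
  have \<tau>: "set \<tau> = {..<n}" "distinct \<tau>" using assms by (auto dest: permutations_of_setD)
  then show len: "length \<tau> = n" using distinct_card by fastforce
  show "bij_betw ((!) \<tau>) {..<n} {..<n}"
    using bij_betw_nth[OF \<tau>(2)] len \<tau>(1) by blast
qed

text \<open>For a pair of positions let \<open>a\<close>, \<open>b\<close> be its images under
  \<open>\<tau>\<close>. Then \<open>h\<close> records an inversion of the composite and
  \<open>h'\<close> one of \<open>\<tau>\<close>. Modulo 2 their sum \<open>g\<close> is symmetric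
  in \<open>a\<close> and \<open>b\<close>: it is the inversion of \<open>\<sigma>\<close> at this
  pair. So the sum over pairs can be permuted back.\<close>

lemma epar_compose:
  assumes \<sigma>: "distinct \<sigma>" "length \<sigma> = n" and \<tau>: "\<tau> \<in> perms n"
  shows "epar ps (map ((!) \<sigma>) \<tau>) = epar ps \<sigma> + epar (map ((!) ps) \<sigma>) \<tau>"
proof -
  note len = perms_bij(1)[OF \<tau>] and bij = perms_bij(2)[OF \<tau>]
  have lt: "\<tau> ! j < n" if "j < n" for j using bij_betwE[OF bij] that by auto
  have inj: "\<tau> ! a = \<tau> ! b \<longleftrightarrow> a = b" if "a < n" "b < n" for a b
    using bij that unfolding bij_betw_def by (auto dest: inj_onD)
  have inj\<sigma>: "\<sigma> ! a = \<sigma> ! b \<longleftrightarrow> a = b" if "a < n" "b < n" for a b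
    using \<sigma> that nth_eq_iff_index_eq by blast
  define h where "h = (\<lambda>a b. if \<sigma> ! b < \<sigma> ! a then ps ! (\<sigma> ! a) * ps ! (\<sigma> ! b) else 0)"
  define h' where "h' = (\<lambda>a b. if b < a then ps ! (\<sigma> ! a) * ps ! (\<sigma> ! b) else 0 :: bit)"
  define g where "g = (\<lambda>a b. if a < b then h a b else h b a)"
  have g: "h a b + h' a b = g a b" if "a < n" "b < n" "a \<noteq> b" for a b
    using inj\<sigma>[OF that(1,2)] that by (auto simp: h_def h'_def g_def mult.commute)
  have "epar ps (map ((!) \<sigma>) \<tau>) + epar (map ((!) ps) \<sigma>) \<tau>
      = (\<Sum>l<n. \<Sum>j<l. h (\<tau> ! j) (\<tau> ! l) + h' (\<tau> ! j) (\<tau> ! l))"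
    unfolding epar_pairs sum.distrib h_def h'_def using lt \<sigma>(2) len
    by (intro arg_cong2[of _ _ _ _ "(+)"] sum.cong) auto
  also have "\<dots> = (\<Sum>l<n. \<Sum>j<l. g (\<tau> ! j) (\<tau> ! l))"
    using lt inj by (intro sum.cong g) auto
  also have "\<dots> = (\<Sum>l<n. \<Sum>j<l. g j l)"
    by (rule sum_pairs_permute[OF bij]) (auto simp: g_def)
  also have "\<dots> = epar ps \<sigma>"
    unfolding epar_pairs g_def h_def using \<sigma>(2) by (intro sum.cong) auto
  finally show ?thesis
    by (metis add.assoc bit_add_self add.right_neutral)
qed

section \<open>Cochains of polynomials\<close>

text \<open>Keeping the sign as an exponent lets \<open>sg_sg\<close> reduce comparisons of signs to
  identities in the two-element field.\<close>

definition sg :: "bit \<Rightarrow> 'a::ab_group_add \<Rightarrow> 'a" where "sg p x = (if p = 0 then x else - x)"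

lemma sg_0 [simp]: "sg 0 x = x" and sg_zero [simp]: "sg p 0 = 0"
  by (simp_all add: sg_def)

lemma sg_add: "sg p (x + y) = sg p x + sg p y"
  by (simp add: sg_def)

lemma sg_minus: "sg p (- x) = - sg p x"
  by (simp add: sg_def)

lemma sg_sum: "sg p (sum f A) = (\<Sum>x\<in>A. sg p (f x))"
  by (simp add: sg_def sum_negf)

lemma sg_sg [simp]: "sg p (sg q x) = sg (p + q) x"
  by (cases p; cases q) (simp_all add: sg_def)

lemma sg_add_1: "sg (p + 1) x = - sg p x"
  by (cases p) (simp_all add: sg_def)

lemma args_Cons [simp]: "v # vs \<in> args n \<longleftrightarrow> (\<exists>m. n = Suc m \<and> vs \<in> args m)"
  by (auto simp: args_def)

lemma args_update [simp]: "vs[i := v] \<in> args n \<longleftrightarrow> vs \<in> args n"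
  by (simp add: args_def)

context diff_supermodule
begin

lemma psign_pact: "lconst (psign p) \<odot> P = sg p P"
proof (cases "p = 0")
  case True
  then show ?thesis using pact.scale_one by (simp add: lconst_1)
next
  case False
  have "lconst (- 1) \<odot> P = - P" using pact.scale_one[of P]
    by (simp add: lconst_uminus lconst_1)
  then show ?thesis using False by (simp add: sg_def psign_def)
qed

lemma psign_scale: "scale (psign p) v = sg p v"
  by (cases p) (simp_all add: sg_def psign_def)

lemma pact_sg: "f \<odot> sg p P = sg p (f \<odot> P)"
  by (simp add: sg_def)

lemma eqv_sg: "eqv n P Q \<Longrightarrow> eqv n (sg p P) (sg p Q)"
  by (auto simp: sg_def intro: eqv_minus)

lemma polys_sg: "(P :: 'v lpoly) \<in> polys n \<Longrightarrow> sg p P \<in> polys n"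
  by (auto simp: sg_def intro: polys_uminus)

lemma lsubst_zero [simp]: "lsubst \<phi> 0 = 0"
  by (simp add: lsubst_def)

lemma lsubst_sg: "lsubst \<phi> (sg p P) = sg p (lsubst \<phi> P)"
  using lsubst_diff[of \<phi> 0 P] by (simp add: sg_def)

text \<open>Elements of \<^const>\<open>W\<close> are handled through representatives: a cochain is a function with polynomial
  values that satisfies the defining conditions of \<^const>\<open>W\<close> up to congruence.\<close>

definition pval :: "nat \<Rightarrow> ('v list \<Rightarrow> 'v lpoly) \<Rightarrow> bool"
  where "pval n x \<longleftrightarrow> (\<forall>vs\<in>args n. x vs \<in> polys n)"

definition multi :: "nat \<Rightarrow> ('v list \<Rightarrow> 'v lpoly) \<Rightarrow> bool"
  where "multi n x \<longleftrightarrow> (\<forall>vs\<in>args n. \<forall>i<n. \<forall>c u w.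
    eqv n (x (vs[i := scale c u + w])) (lconst c \<odot> x (vs[i := u]) + x (vs[i := w])))"

definition sesq :: "nat \<Rightarrow> ('v list \<Rightarrow> 'v lpoly) \<Rightarrow> bool"
  where "sesq n x \<longleftrightarrow> (\<forall>vs\<in>args n. \<forall>i<n.
    eqv n (x (vs[i := D (vs ! i)])) (- (lvar i \<odot> x vs)))"

definition sym_on :: "nat \<Rightarrow> ('v list \<Rightarrow> 'v lpoly) \<Rightarrow> bool"
  where "sym_on n x \<longleftrightarrow> (\<forall>vs\<in>args n. \<forall>ps. homog ps vs \<longrightarrow> (\<forall>\<tau>\<in>perms n.
    eqv n (x vs) (sg (epar ps \<tau>) (lsubst (\<lambda>j. lvar (\<tau> ! j)) (x (map ((!) vs) \<tau>))))))"

definition cochain :: "nat \<Rightarrow> ('v list \<Rightarrow> 'v lpoly) \<Rightarrow> bool"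
  where "cochain n x \<longleftrightarrow> pval n x \<and> multi n x \<and> sesq n x \<and> sym_on n x"

definition mk :: "nat \<Rightarrow> ('v list \<Rightarrow> 'v lpoly) \<Rightarrow> 'v list \<Rightarrow> 'v lpoly set"
  where "mk n x = (\<lambda>vs\<in>args n. cls n (x vs))"

abbreviation rp :: "('v list \<Rightarrow> 'v lpoly set) \<Rightarrow> 'v list \<Rightarrow> 'v lpoly"
  where "rp X \<equiv> \<lambda>vs. rep (X vs)"

lemma qadd_cls: "P \<in> polys n \<Longrightarrow> Q \<in> polys n \<Longrightarrow> qadd n (cls n P) (cls n Q) = cls n (P + Q)"
  unfolding qadd_def by (subst cls_eq_iff) (auto intro: polys_add eqv_add rep_cls)

lemma qact_cls: "f \<in> polys n \<Longrightarrow> P \<in> polys n \<Longrightarrow> qact n f (cls n P) = cls n (f \<odot> P)"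
  unfolding qact_def by (subst cls_eq_iff) (auto intro: polys_pact eqv_pact rep_cls)

lemma qscale_cls: "P \<in> polys n \<Longrightarrow> qscale n c (cls n P) = cls n (lconst c \<odot> P)"
  unfolding qscale_def by (rule qact_cls) auto

lemma qsum_cls:
  "(\<And>i. i \<in> I \<Longrightarrow> f i \<in> polys n) \<Longrightarrow> qsum n (\<lambda>i. cls n (f i)) I = cls n (sum f I)"
  unfolding qsum_def by (subst cls_eq_iff) (auto intro!: polys_sum eqv_sum intro: rep_cls)

lemma lsum_perm:
  assumes "\<tau> \<in> perms n" shows "(\<Sum>j<n. lvar (\<tau> ! j) :: 'f lpoly) = lsum n"
  by (rule sum.reindex_bij_betw[OF perms_bij(2)[OF assms]])

lemma perms_lt: "\<tau> \<in> perms n \<Longrightarrow> j < n \<Longrightarrow> \<tau> ! j < n"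
  using bij_betwE[OF perms_bij(2)] by auto

lemma polys_lsubst_perm:
  "\<tau> \<in> perms n \<Longrightarrow> P \<in> polys n \<Longrightarrow> lsubst (\<lambda>j. lvar (\<tau> ! j)) P \<in> polys n"
  by (rule polys_lsubst) (auto intro: polys_lvar perms_lt)

lemma qsubst_cls:
  "\<tau> \<in> perms n \<Longrightarrow> P \<in> polys n \<Longrightarrow>
    qsubst n (\<lambda>j. lvar (\<tau> ! j)) (cls n P) = cls n (lsubst (\<lambda>j. lvar (\<tau> ! j)) P)"
  unfolding qsubst_def
  by (subst cls_eq_iff) (auto intro: polys_lsubst_perm eqv_lsubst lsum_perm rep_cls)

lemma perms_args: "\<tau> \<in> perms n \<Longrightarrow> map f \<tau> \<in> args n"
  by (simp add: args_def perms_bij)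

text \<open>Each coset operation in the definition of \<open>W\<close> agrees with the polynomial
  operation up to congruence, so the three conditions translate one by one.\<close>

lemma mk_in_W_iff:
  assumes "pval n x"
  shows "mk n x \<in> W n \<longleftrightarrow> cochain n x"
proof -
  have p [simp]: "x vs \<in> polys n" if "vs \<in> args n" for vs using assms that by (simp add: pval_def)
  have pn: "- lvar i \<in> polys n" if "i < n" for i
    using polys_uminus[OF polys_lvar[OF that]] .
  have "multilin n (mk n x) \<longleftrightarrow> multi n x"
    unfolding multilin_def multi_def
    by (intro ball_cong refl all_cong all_cong1)
      (simp add: mk_def qscale_cls qadd_cls polys_pact polys_add cls_eq_iff)
  moreover have "sesquilin n (mk n x) \<longleftrightarrow> sesq n x"
    unfolding sesquilin_def sesq_def
    by (intro ball_cong refl all_cong)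
      (simp add: mk_def qact_cls polys_pact pn polys_uminus polys_lvar cls_eq_iff)
  moreover have "symm n (mk n x) \<longleftrightarrow> sym_on n x"
    unfolding symm_def sym_on_def
    by (intro ball_cong refl all_cong imp_cong)
      (simp add: mk_def qsubst_cls perms_args polys_lsubst_perm qscale_cls polys_sg
        eps_epar psign_pact cls_eq_iff)
  moreover have "mk n x \<in> args n \<rightarrow>\<^sub>E quot n"
    by (auto simp: mk_def intro: cls_quot)
  ultimately show ?thesis using assms by (simp add: W_def cochain_def)
qed

lemma mk_rp:
  assumes "X \<in> args n \<rightarrow>\<^sub>E quot n" shows "mk n (rp X) = X" "pval n (rp X)"
proof -
  have q: "X vs \<in> quot n" if "vs \<in> args n" for vs using PiE_mem[OF assms that] .
  show "mk n (rp X) = X"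
    using quot_rep(2)[OF q] PiE_arb[OF assms] by (auto simp: mk_def fun_eq_iff restrict_def)
  show "pval n (rp X)" using quot_rep(1)[OF q] by (simp add: pval_def)
qed

lemma W_E: "X \<in> W n \<Longrightarrow> mk n (rp X) = X" "X \<in> W n \<Longrightarrow> cochain n (rp X)"
  using mk_rp[of X n] mk_in_W_iff[of n "rp X"] by (auto simp: W_def)

lemma mk_W: "cochain n x \<Longrightarrow> mk n x \<in> W n"
  using mk_in_W_iff by (auto simp: cochain_def)

lemma mk_eq_iff:
  "pval n x \<Longrightarrow> pval n y \<Longrightarrow> mk n x = mk n y \<longleftrightarrow> (\<forall>vs\<in>args n. eqv n (x vs) (y vs))"
  by (auto simp: mk_def pval_def fun_eq_iff cls_eq_iff restrict_def)

lemma rp_mk: "pval n x \<Longrightarrow> vs \<in> args n \<Longrightarrow> eqv n (rp (mk n x) vs) (x vs)"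
  by (simp add: mk_def pval_def rep_cls)

lemma cochainD:
  assumes "cochain n x" shows "pval n x" "multi n x" "sesq n x" "sym_on n x"
  using assms by (auto simp: cochain_def)

lemma pvalD: "pval n x \<Longrightarrow> length vs = n \<Longrightarrow> x vs \<in> polys n"
  by (simp add: pval_def args_def)

lemma multi_lin:
  "multi n x \<Longrightarrow> length vs = n \<Longrightarrow> i < n \<Longrightarrow>
    eqv n (x (vs[i := scale c u + w])) (lconst c \<odot> x (vs[i := u]) + x (vs[i := w]))"
  by (simp add: multi_def args_def)

lemma multi_add:
  "multi n x \<Longrightarrow> length vs = n \<Longrightarrow> i < n \<Longrightarrow>
    eqv n (x (vs[i := u + w])) (x (vs[i := u]) + x (vs[i := w]))"
  using multi_lin[of n x vs i 1 u w] pact.scale_one by (simp add: lconst_1)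

lemma eqv_cancel_0: "eqv n P (P + P) \<Longrightarrow> eqv n P 0"
  unfolding eqv_def using range_total_D_minus[of "P - (P + P)"] by simp

lemma multi_zero:
  assumes "multi n x" "length vs = n" "i < n" "vs ! i = 0" shows "eqv n (x vs) 0"
  using multi_add[OF assms(1-3), of 0 0] assms(4) list_update_id[of vs i]
  by (auto intro: eqv_cancel_0)

lemma multi_scale:
  assumes "multi n x" "length vs = n" "i < n"
  shows "eqv n (x (vs[i := scale c u])) (lconst c \<odot> x (vs[i := u]))"
proof -
  have "eqv n (x (vs[i := scale c u])) (lconst c \<odot> x (vs[i := u]) + x (vs[i := 0]))"
    using multi_lin[OF assms, of c u 0] by simp
  also have "eqv n \<dots> (lconst c \<odot> x (vs[i := u]) + 0)"
    using assms by (intro eqv_add multi_zero[where i = i]) auto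
  finally show ?thesis by simp
qed

lemma sesqD:
  "sesq n x \<Longrightarrow> length vs = n \<Longrightarrow> i < n \<Longrightarrow>
    eqv n (x (vs[i := D v])) (- (lvar i \<odot> x (vs[i := v])))"
  unfolding sesq_def by (drule bspec[of _ _ "vs[i := v]"]) (auto simp: args_def)

lemma sym_onD:
  "sym_on n x \<Longrightarrow> length vs = n \<Longrightarrow> homog ps vs \<Longrightarrow> \<tau> \<in> perms n \<Longrightarrow>
    eqv n (x vs) (sg (epar ps \<tau>) (lsubst (\<lambda>j. lvar (\<tau> ! j)) (x (map ((!) vs) \<tau>))))"
  by (simp add: sym_on_def args_def)

lemma homog_nth: "homog ps vs \<Longrightarrow> i < length vs \<Longrightarrow> vs ! i \<in> G (ps ! i)"
  by (simp add: homog_def list_all2_conv_all_nth)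

lemma homog_length: "homog ps vs \<Longrightarrow> length ps = length vs"
  by (auto simp: homog_def dest: list_all2_lengthD)

lemma homogI: "length ps = length vs \<Longrightarrow> (\<And>i. i < length vs \<Longrightarrow> vs ! i \<in> G (ps ! i)) \<Longrightarrow> homog ps vs"
  by (simp add: homog_def list_all2_conv_all_nth)

lemma homog_map: "homog ps vs \<Longrightarrow> set xs \<subseteq> {..<length vs} \<Longrightarrow> homog (map ((!) ps) xs) (map ((!) vs) xs)"
  by (rule homogI) (auto intro!: homog_nth dest: nth_mem)

section \<open>Homogeneous vectors and parity projections\<close>

lemma G_0 [simp]: "0 \<in> G p"
  using subspace_G subspace_0 by blast

lemma G_add: "u \<in> G p \<Longrightarrow> v \<in> G p \<Longrightarrow> u + v \<in> G p"
  using subspace_G subspace_add by blast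

lemma G_diff: "u \<in> G p \<Longrightarrow> v \<in> G p \<Longrightarrow> u - v \<in> G p"
  using subspace_G subspace_diff by blast

lemma G_scale: "u \<in> G p \<Longrightarrow> scale c u \<in> G p"
  using subspace_G subspace_scale by blast

lemma G_both: "u \<in> G p \<Longrightarrow> u \<in> G (p + 1) \<Longrightarrow> u = 0"
  using G_Int by (cases p) auto

lemma G_decomp: "\<exists>x\<in>G p. v - x \<in> G (p + 1)"
proof -
  obtain x y where "x \<in> G 0" "y \<in> G 1" "v = x + y" using G_sum by blast
  then show ?thesis
    by (cases p) (auto intro: bexI[of _ x] bexI[of _ y])
qed

lemma proj_eqI:
  assumes "x \<in> G p" "v - x \<in> G (p + 1)" shows "proj p v = x"
  unfolding proj_def
proof (rule the_equality)
  fix y assume y: "y \<in> G p \<and> v - y \<in> G (p + 1)"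
  have "x - y \<in> G (p + 1)" "x - y \<in> G p"
    using y assms G_diff[of "v - y" _ "v - x"] by (auto intro: G_diff)
  then show "y = x" using G_both[of "x - y" p] by simp
qed (use assms in simp)

lemma proj_G [simp]: "proj p v \<in> G p" and proj_compl: "v - proj p v \<in> G (p + 1)"
  using G_decomp[of p v] proj_eqI by auto

lemma proj_id: "v \<in> G p \<Longrightarrow> proj p v = v"
  by (rule proj_eqI) auto

lemma proj_other: "v \<in> G p \<Longrightarrow> q \<noteq> p \<Longrightarrow> proj q v = 0"
  by (rule proj_eqI) (cases p; cases q; simp)+

lemma proj_add: "proj p (u + v) = proj p u + proj p v"
  using G_add[OF proj_compl proj_compl, of u p v] by (intro proj_eqI) (auto intro: G_add simp: algebra_simps)

lemma proj_scale: "proj p (scale c v) = scale c (proj p v)"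
  using G_scale[OF proj_compl, of c v p] by (intro proj_eqI) (auto intro: G_scale simp: scale_right_diff_distrib)

lemma proj_0 [simp]: "proj p 0 = 0"
  by (rule proj_id) simp

lemma D_diff: "D (u - v) = D u - D v"
  using D_add[of "u - v" v] by simp

lemma proj_D: "proj p (D v) = D (proj p v)"
  using even_D[OF proj_compl, of v p] by (intro proj_eqI) (auto intro: even_D simp: D_diff)

lemma proj_sum: "proj p v + proj (p + 1) v = v"
proof -
  have "proj (p + 1) v = v - proj p v"
    by (rule proj_eqI) (auto simp: proj_compl)
  then show ?thesis by simp
qed

lemma bit_lists_finite: "finite {ps :: bit list. length ps = n}"
proof -
  have "(UNIV :: bit set) = {0, 1}" by (auto intro: bit.exhaust)
  then have "finite (UNIV :: bit set)" by (metis finite.emptyI finite_insert)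
  from finite_lists_length_eq[OF this, of n] show ?thesis by simp
qed

text \<open>The multilinear function with prescribed values \<open>f ps\<close> on homogeneous arguments of
  parities \<open>ps\<close>.\<close>

definition multi_ext :: "nat \<Rightarrow> (bit list \<Rightarrow> 'v list \<Rightarrow> 'v lpoly) \<Rightarrow> 'v list \<Rightarrow> 'v lpoly"
  where "multi_ext n f vs = (\<Sum>ps\<in>{ps. length ps = n}. f ps (map2 proj ps vs))"

lemma map2_update:
  "length ps = length vs \<Longrightarrow> i < length vs \<Longrightarrow> map2 h ps (vs[i := v]) = (map2 h ps vs)[i := h (ps ! i) v]"
  by (rule nth_equalityI) (auto simp: nth_list_update)

lemma pval_multi_ext: "(\<And>ps. length ps = n \<Longrightarrow> pval n (f ps)) \<Longrightarrow> pval n (multi_ext n f)"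
  unfolding multi_ext_def pval_def by (auto intro!: polys_sum simp: args_def)

lemma multi_multi_ext:
  assumes "\<And>ps. length ps = n \<Longrightarrow> multi n (f ps)" shows "multi n (multi_ext n f)"
  unfolding multi_def multi_ext_def pact.scale_sum_right sum.distrib[symmetric]
proof (intro ballI allI impI eqv_sum)
  fix vs :: "'v list" and i c u w and ps :: "bit list" assume "vs \<in> args n" "i < n" "ps \<in> {ps. length ps = n}"
  then show "eqv n (f ps (map2 proj ps (vs[i := scale c u + w])))
      (lconst c \<odot> f ps (map2 proj ps (vs[i := u])) + f ps (map2 proj ps (vs[i := w])))"
    using multi_lin[OF assms, of ps "map2 proj ps vs" i]
    by (simp add: args_def map2_update proj_add proj_scale)
qed

lemma sesq_multi_ext:
  assumes "\<And>ps. length ps = n \<Longrightarrow> sesq n (f ps)" shows "sesq n (multi_ext n f)"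
  unfolding sesq_def multi_ext_def pact.scale_sum_right sum_negf[symmetric]
proof (intro ballI allI impI eqv_sum)
  fix vs :: "'v list" and i and ps :: "bit list" assume "vs \<in> args n" "i < n" "ps \<in> {ps. length ps = n}"
  then show "eqv n (f ps (map2 proj ps (vs[i := D (vs ! i)]))) (- (lvar i \<odot> f ps (map2 proj ps vs)))"
    using sesqD[OF assms, of ps "map2 proj ps vs" i "proj (ps ! i) (vs ! i)"]
      list_update_id[of "map2 proj ps vs" i]
    by (simp add: args_def map2_update proj_D)
qed

lemma map2_proj_homog: "homog ps vs \<Longrightarrow> map2 proj ps vs = vs"
  by (rule nth_equalityI) (auto simp: homog_length proj_id homog_nth)

text \<open>For any other list of parities some argument is projected to zero, and multilinearity
  makes that term congruent to zero.\<close>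

lemma multi_ext_homog:
  assumes f: "\<And>ps. length ps = n \<Longrightarrow> multi n (f ps)" and vs: "length vs = n" "homog ps vs"
  shows "eqv n (multi_ext n f vs) (f ps vs)"
proof -
  have "eqv n (multi_ext n f vs) (\<Sum>qs\<in>{qs. length qs = n}. if qs = ps then f ps vs else 0)"
    unfolding multi_ext_def
  proof (rule eqv_sum)
    fix qs :: "bit list" assume qs: "qs \<in> {qs. length qs = n}"
    show "eqv n (f qs (map2 proj qs vs)) (if qs = ps then f ps vs else 0)"
    proof (cases "qs = ps")
      case True
      then show ?thesis using map2_proj_homog[OF vs(2)] by simp
    next
      case False
      then obtain i where i: "i < n" "qs ! i \<noteq> ps ! i"
        using qs vs homog_length[OF vs(2)] by (metis mem_Collect_eq nth_equalityI)
      then have "map2 proj qs vs ! i = 0"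
        using qs vs by (auto intro!: proj_other homog_nth)
      then show ?thesis using False qs vs i multi_zero[OF f, of qs "map2 proj qs vs" i] by simp
    qed
  qed
  then show ?thesis using homog_length[OF vs(2)] vs(1) by (simp add: bit_lists_finite)
qed

lemma sym_multi_ext:
  assumes f: "\<And>ps. length ps = n \<Longrightarrow> multi n (f ps)"
    and "\<And>ps vs \<tau>. length vs = n \<Longrightarrow> homog ps vs \<Longrightarrow> \<tau> \<in> perms n \<Longrightarrow>
      eqv n (f ps vs) (sg (epar ps \<tau>) (lsubst (\<lambda>j. lvar (\<tau> ! j)) (f (map ((!) ps) \<tau>) (map ((!) vs) \<tau>))))"
  shows "sym_on n (multi_ext n f)"
  unfolding sym_on_def
proof (intro ballI allI impI)
  fix vs ps \<tau> assume a: "vs \<in> args n" "homog ps vs" "\<tau> \<in> perms n"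
  then have len: "length vs = n" by (simp add: args_def)
  have h: "homog (map ((!) ps) \<tau>) (map ((!) vs) \<tau>)"
    using a len by (intro homog_map) (auto dest: permutations_of_setD)
  have "eqv n (multi_ext n f vs) (f ps vs)" by (rule multi_ext_homog) (use f len a in auto)
  also have "eqv n \<dots> (sg (epar ps \<tau>) (lsubst (\<lambda>j. lvar (\<tau> ! j)) (f (map ((!) ps) \<tau>) (map ((!) vs) \<tau>))))"
    using assms(2) a len by blast
  also have "eqv n \<dots> (sg (epar ps \<tau>) (lsubst (\<lambda>j. lvar (\<tau> ! j)) (multi_ext n f (map ((!) vs) \<tau>))))"
    by (intro eqv_sg eqv_lsubst[of n] lsum_perm a eqv_sym[OF multi_ext_homog[OF f _ h]])
      (use perms_bij[OF a(3)] in auto)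
  finally show "eqv n (multi_ext n f vs) \<dots>" .
qed

text \<open>Arguments are split into their parity components one position at a time; in the
  induction \<open>j\<close> counts the leading positions that may still be inhomogeneous.\<close>

lemma multi_homog_ext:
  assumes x: "multi n x" and y: "multi n y"
    and hom: "\<And>ps vs. length vs = n \<Longrightarrow> homog ps vs \<Longrightarrow> eqv n (x vs) (y vs)"
    and "length vs = n"
  shows "eqv n (x vs) (y vs)"
proof -
  have "eqv n (x vs) (y vs)"
    if "j \<le> n" "length vs = n" "\<And>i. j \<le> i \<Longrightarrow> i < n \<Longrightarrow> \<exists>p. vs ! i \<in> G p" for j vs
    using that
  proof (induction j arbitrary: vs)
    case 0
    then have "\<forall>i. \<exists>p. i < n \<longrightarrow> vs ! i \<in> G p" by auto
    then obtain p where "\<And>i. i < n \<Longrightarrow> vs ! i \<in> G (p i)" by metis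
    then have "homog (map p [0..<n]) vs" using 0 by (intro homogI) auto
    then show ?case using hom 0 by blast
  next
    case (Suc j)
    have e: "eqv n (x (vs[j := proj p (vs ! j)])) (y (vs[j := proj p (vs ! j)]))" for p
    proof (rule Suc.IH)
      fix i assume "j \<le> i" "i < n"
      then show "\<exists>q. vs[j := proj p (vs ! j)] ! i \<in> G q"
        using Suc.prems by (cases "i = j") (auto intro: proj_G)
    qed (use Suc.prems in auto)
    have "vs[j := proj 0 (vs ! j) + proj 1 (vs ! j)] = vs"
      using proj_sum[of 0 "vs ! j"] by simp
    then have "eqv n (x vs) (x (vs[j := proj 0 (vs ! j)]) + x (vs[j := proj 1 (vs ! j)]))"
      "eqv n (y vs) (y (vs[j := proj 0 (vs ! j)]) + y (vs[j := proj 1 (vs ! j)]))"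
      using multi_add[OF x, of vs j] multi_add[OF y, of vs j] Suc.prems by (metis Suc_le_lessD)+
    then show ?case using eqv_add[OF e e] by (meson eqv_sym eqv_trans)
  qed
  from this[of n vs] show ?thesis using assms(4) by simp
qed

end

section \<open>The box product is a cochain\<close>

lemma ex_perm_map:
  assumes "distinct xs" "distinct ys" "set xs = set ys"
  obtains \<tau> where "\<tau> \<in> perms (length xs)" "ys = map ((!) xs) \<tau>"
proof -
  have "\<forall>z\<in>set ys. \<exists>k<length xs. xs ! k = z" using assms(3) by (auto simp: in_set_conv_nth)
  then obtain f where f: "\<And>z. z \<in> set ys \<Longrightarrow> f z < length xs \<and> xs ! f z = z" by metis
  have inj: "inj_on f (set ys)" by (rule inj_on_inverseI[of _ "(!) xs"]) (use f in auto)
  have "f ` set ys = {..<length xs}"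
    by (rule card_subset_eq)
      (use f assms distinct_card[OF assms(1)] in \<open>auto simp: card_image[OF inj]\<close>)
  then have "map f ys \<in> perms (length xs)"
    using assms inj by (auto simp: permutations_of_set_def distinct_map)
  moreover have "ys = map ((!) xs) (map f ys)" by (auto simp: map_idI f)
  ultimately show ?thesis using that by blast
qed

lemma epar_map_Suc: "epar (p # qs) (map Suc \<tau>) = epar qs \<tau>"
  by (induction \<tau>) (auto simp: comp_def cong: if_cong)

lemma perms_Cons_Suc: "\<tau> \<in> perms m \<Longrightarrow> 0 # map Suc \<tau> \<in> perms (Suc m)"
  by (auto simp: permutations_of_set_def distinct_map lessThan_Suc_eq_insert_0)

lemma perms_compose:
  assumes "\<sigma> \<in> perms n" "\<tau> \<in> perms n" shows "map ((!) \<sigma>) \<tau> \<in> perms n"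
proof -
  have "bij_betw ((!) \<sigma>) {..<n} {..<n}" using perms_bij(2)[OF assms(1)] .
  moreover have "set \<tau> = {..<n}" "distinct \<tau>" using assms(2) by (auto dest: permutations_of_setD)
  ultimately show ?thesis by (auto simp: permutations_of_set_def distinct_map bij_betw_def)
qed

text \<open>An unshuffle is determined by the set of indices handed to the inner map, and
  permutations act more conveniently on these sets.\<close>

definition unsh :: "nat \<Rightarrow> nat set \<Rightarrow> nat list"
  where "unsh n S = sorted_list_of_set S @ sorted_list_of_set ({..<n} - S)"

lemma unsh_perm:
  assumes "S \<subseteq> {..<n}" shows "unsh n S \<in> perms n" "take (card S) (unsh n S) = sorted_list_of_set S"
    "drop (card S) (unsh n S) = sorted_list_of_set ({..<n} - S)"
  using assms finite_subset[OF assms] by (auto simp: unsh_def permutations_of_set_def)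

lemma unshuffles_eq: "unshuffles b n = unsh n ` {S. S \<subseteq> {..<n} \<and> card S = b}"
proof (intro set_eqI iffI)
  fix xs assume "xs \<in> unshuffles b n"
  then have xs: "set xs = {..<n}" "distinct xs" "b \<le> n" "sorted (take b xs)" "sorted (drop b xs)"
    by (auto simp: unshuffles_def dest: permutations_of_setD)
  have len: "length xs = n" using xs distinct_card by fastforce
  let ?S = "set (take b xs)"
  have "{..<n} = ?S \<union> set (drop b xs)" "?S \<inter> set (drop b xs) = {}"
    using xs(1,2) by (metis append_take_drop_id set_append, metis append_take_drop_id distinct_append)
  then have d: "{..<n} - ?S = set (drop b xs)" by blast
  have "xs = unsh n ?S"
    unfolding unsh_def d using xs
    by (simp add: sorted_list_of_set.idem_if_sorted_distinct)
  moreover have "?S \<subseteq> {..<n}" using xs(1) set_take_subset by metis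
  moreover have "card ?S = b" using xs len by (simp add: distinct_card)
  ultimately show "xs \<in> unsh n ` {S. S \<subseteq> {..<n} \<and> card S = b}" by blast
next
  fix xs assume "xs \<in> unsh n ` {S. S \<subseteq> {..<n} \<and> card S = b}"
  then obtain S where S: "S \<subseteq> {..<n}" "card S = b" "xs = unsh n S" by auto
  then have "b \<le> n" using card_mono[of "{..<n}" S] by simp
  then show "xs \<in> unshuffles b n" using unsh_perm[OF S(1)] S by (simp add: unshuffles_def)
qed

lemma sum_unshuffles:
  "(\<Sum>is\<in>unshuffles b n. h is) = (\<Sum>S\<in>{S. S \<subseteq> {..<n} \<and> card S = b}. h (unsh n S))"
proof -
  have "inj_on (unsh n) {S. S \<subseteq> {..<n} \<and> card S = b}"
  proof (rule inj_onI)
    fix S T assume S: "S \<in> {S. S \<subseteq> {..<n} \<and> card S = b}" and T: "T \<in> {S. S \<subseteq> {..<n} \<and> card S = b}"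
      and eq: "unsh n S = unsh n T"
    have "sorted_list_of_set S = sorted_list_of_set T"
      using unsh_perm(2)[of S n] unsh_perm(2)[of T n] S T eq by simp
    then show "S = T"
      using S T by (metis (mono_tags) finite_lessThan finite_subset mem_Collect_eq set_sorted_list_of_set)
  qed
  then show ?thesis unfolding unshuffles_eq by (subst sum.reindex) auto
qed

context diff_supermodule
begin

lemma lsubst_pact_sum: "lsubst \<psi> ((\<Sum>l\<in>A. lvar (s l)) \<odot> P) = (\<Sum>l\<in>A. \<psi> (s l)) \<odot> lsubst \<psi> P"
  by (induction A rule: infinite_finite_induct)
    (auto simp: pact.scale_left_distrib lsubst_add lsubst_lvar)

lemma lsubst_pact_prod:
  "lsubst \<psi> ((\<Prod>j\<in>A. lvar (s j) ^ k j) \<odot> P) = (\<Prod>j\<in>A. \<psi> (s j) ^ k j) \<odot> lsubst \<psi> P"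
proof -
  have pow: "lsubst \<psi> (lvar i ^ m \<odot> Q) = \<psi> i ^ m \<odot> lsubst \<psi> Q" for i m Q
    by (induction m) (auto simp: pact_one lsubst_lvar simp flip: pact_mult)
  show ?thesis
    by (induction A rule: infinite_finite_induct) (auto simp: pact_one pow simp flip: pact_mult)
qed

lemma lsubst_sum: "lsubst \<psi> (sum f A) = (\<Sum>i\<in>A. lsubst \<psi> (f i))"
  by (induction A rule: infinite_finite_induct) (auto simp: lsubst_add)

lemma lsubst_evl_lvar:
  "lsubst \<psi> (evl (\<lambda>j. lvar (s j)) g P) = evl (\<lambda>j. \<psi> (s j)) (\<lambda>v. lsubst \<psi> (g v)) P"
  unfolding evl_def ksum_def by (simp add: lsubst_sum lsubst_pact_prod)

lemma lsubst_lsubst_lvar: "lsubst \<phi> (lsubst (\<lambda>j. lvar (s j)) P) = lsubst (\<lambda>j. \<phi> (s j)) P"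
  unfolding lsubst_evl[of "\<lambda>j. lvar (s j)"] lsubst_evl_lvar by (simp add: lsubst_evl[symmetric])

lemma evl_fun_add: "evl \<rho> (\<lambda>v. g v + g' v) P = evl \<rho> g P + evl \<rho> g' P"
  by (simp add: evl_def ksum_def pact.scale_right_distrib sum.distrib)

lemma evl_fun_pact: "evl \<rho> (\<lambda>v. f \<odot> g v) P = f \<odot> evl \<rho> g P"
  by (simp add: evl_def ksum_def pact.scale_sum_right pact.scale_left_commute)

lemma evl_fun_minus: "evl \<rho> (\<lambda>v. - g v) P = - evl \<rho> g P"
  by (simp add: evl_def ksum_def sum_negf)

lemma evl_fun_sg: "evl \<rho> (\<lambda>v. sg p (g v)) P = sg p (evl \<rho> g P)"
  by (simp add: sg_def evl_fun_minus)

lemma evl_lconst_indep: "evl \<rho> g (lconst v) = evl \<rho>' g (lconst v)"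
  by (rule evl_cong[of _ 0]) auto

subsection \<open>Evaluation along maps that are additive modulo the total derivative\<close>

text \<open>The model is the outer map of a box product as a function of its first slot: its values
  are chosen representatives, so it is additive only up to congruence.\<close>

definition additive_mod :: "nat \<Rightarrow> ('v \<Rightarrow> 'v lpoly) \<Rightarrow> bool"
  where "additive_mod n g \<longleftrightarrow> (\<forall>u v. eqv n (g (u + v)) (g u + g v))"

lemma additive_mod_evl: "additive_mod n g \<Longrightarrow> eqv n (evl \<rho> g (P + Q)) (evl \<rho> g P + evl \<rho> g Q)"
  by (rule evl_add_eqv) (simp add: additive_mod_def)

lemma additive_mod_evl_lconst: "additive_mod n g \<Longrightarrow> eqv n (evl \<rho> g (lconst v)) (g v)"
proof (rule evl_lconst_eqv)
  assume "additive_mod n g"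
  then have "eqv n (g (0 + 0)) (g 0 + g 0)" unfolding additive_mod_def by blast
  then show "eqv n (g 0) 0" by (auto intro: eqv_cancel_0)
qed

lemma additive_mod_evl_minus:
  assumes "additive_mod n g" shows "eqv n (evl \<rho> g (- P)) (- evl \<rho> g P)"
  using eqv_sym[OF additive_mod_evl[OF assms, of \<rho> "- P" P]] by (simp add: eqv_0_iff[of n _ "- _"])

lemma additive_mod_evl_sg: "additive_mod n g \<Longrightarrow> eqv n (evl \<rho> g (sg p P)) (sg p (evl \<rho> g P))"
  by (auto simp: sg_def additive_mod_evl_minus)

lemma additive_mod_evl_smult:
  assumes "additive_mod n g" "\<And>v. eqv n (g (scale c v)) (lconst c \<odot> g v)"
  shows "eqv n (evl \<rho> g (lconst c \<odot> P)) (lconst c \<odot> evl \<rho> g P)"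
proof (induction P rule: lpoly_induct_all)
  case (const v)
  show ?case
    using additive_mod_evl_lconst[OF assms(1), of \<rho> "scale c v"] assms(2)[of v]
      eqv_pact[OF eqv_sym[OF additive_mod_evl_lconst[OF assms(1), of \<rho> v]]]
    by (auto intro: eqv_trans)
next
  case (add P Q)
  have "eqv n (evl \<rho> g (lconst c \<odot> (P + Q))) (evl \<rho> g (lconst c \<odot> P) + evl \<rho> g (lconst c \<odot> Q))"
    unfolding pact.scale_right_distrib by (rule additive_mod_evl[OF assms(1)])
  also have "eqv n \<dots> (lconst c \<odot> evl \<rho> g P + lconst c \<odot> evl \<rho> g Q)"
    by (rule eqv_add[OF add])
  also have "eqv n \<dots> (lconst c \<odot> evl \<rho> g (P + Q))"
    unfolding pact.scale_right_distrib[symmetric]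
    by (rule eqv_pact[OF eqv_sym[OF additive_mod_evl[OF assms(1)]]])
  finally show ?case .
next
  case (lvar i P)
  show ?case unfolding pact.scale_left_commute[of "lconst c" "lvar i"] evl_lvar
    using eqv_pact[OF lvar, of "\<rho> i"] by (simp add: pact.scale_left_commute)
qed

lemma additive_mod_evl_D_poly:
  assumes "additive_mod n g" "\<And>v. eqv n (g (D v)) (- (f \<odot> g v))"
  shows "eqv n (evl \<rho> g (D_poly P)) (- (f \<odot> evl \<rho> g P))"
proof (induction P rule: lpoly_induct_all)
  case (const v)
  have "eqv n (evl \<rho> g (lconst (D v))) (- (f \<odot> g v))"
    using additive_mod_evl_lconst[OF assms(1), of \<rho> "D v"] assms(2)[of v] by (rule eqv_trans)
  also have "eqv n \<dots> (- (f \<odot> evl \<rho> g (lconst v)))"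
    by (rule eqv_minus[OF eqv_pact[OF eqv_sym[OF additive_mod_evl_lconst[OF assms(1)]]]])
  finally show ?case by simp
next
  case (add P Q)
  have "eqv n (evl \<rho> g (D_poly (P + Q))) (evl \<rho> g (D_poly P) + evl \<rho> g (D_poly Q))"
    unfolding D_poly_add by (rule additive_mod_evl[OF assms(1)])
  also have "eqv n \<dots> (- (f \<odot> evl \<rho> g P) + - (f \<odot> evl \<rho> g Q))"
    by (rule eqv_add[OF add])
  also have "- (f \<odot> evl \<rho> g P) + - (f \<odot> evl \<rho> g Q) = - (f \<odot> (evl \<rho> g P + evl \<rho> g Q))"
    by (simp add: pact.scale_right_distrib)
  also have "eqv n \<dots> (- (f \<odot> evl \<rho> g (P + Q)))"
    by (rule eqv_minus[OF eqv_pact[OF eqv_sym[OF additive_mod_evl[OF assms(1)]]]])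
  finally show ?case .
next
  case (lvar i P)
  show ?case using eqv_pact[OF lvar, of "\<rho> i"]
    by (simp add: D_poly_pact evl_lvar pact.scale_left_commute)
qed

lemma additive_mod_evl_lsum:
  assumes "additive_mod n g"
  shows "eqv n (evl \<rho> g (lsum b \<odot> P)) ((\<Sum>j<b. \<rho> j) \<odot> evl \<rho> g P)"
proof (induction b)
  case (Suc b)
  have "eqv n (evl \<rho> g (lsum (Suc b) \<odot> P)) (evl \<rho> g (lsum b \<odot> P) + evl \<rho> g (lvar b \<odot> P))"
    unfolding sum.lessThan_Suc pact.scale_left_distrib by (rule additive_mod_evl[OF assms])
  also have "eqv n \<dots> ((\<Sum>j<b. \<rho> j) \<odot> evl \<rho> g P + \<rho> b \<odot> evl \<rho> g P)"
    by (intro eqv_add Suc) (simp add: evl_lvar)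
  finally show ?case by (simp add: pact.scale_left_distrib)
qed simp

text \<open>This is the independence from the representative of the inner value. On a total
  derivative the sum of the inner variables contributes the sum of the \<open>\<rho> j\<close>, and
  the derivation contributes the negative of it by the second hypothesis.\<close>

lemma additive_mod_evl_resp:
  assumes g: "additive_mod n g" "\<And>v. eqv n (g (D v)) (- ((\<Sum>j<b. \<rho> j) \<odot> g v))" and "eqv b P Q"
  shows "eqv n (evl \<rho> g P) (evl \<rho> g Q)"
proof -
  obtain R where "P - Q = total_D b R" using assms(3) by (auto simp: eqv_def)
  then have P: "P = total_D b R + Q" by (simp add: algebra_simps)
  have "eqv n (evl \<rho> g (total_D b R))
      ((\<Sum>j<b. \<rho> j) \<odot> evl \<rho> g R + - ((\<Sum>j<b. \<rho> j) \<odot> evl \<rho> g R))"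
    unfolding total_D_def
    by (rule eqv_trans[OF additive_mod_evl[OF g(1)]]) (intro eqv_add additive_mod_evl_lsum additive_mod_evl_D_poly g)
  then have "eqv n (evl \<rho> g (total_D b R) + evl \<rho> g Q) (0 + evl \<rho> g Q)"
    by (intro eqv_add) auto
  then show ?thesis unfolding P using additive_mod_evl[OF g(1), of \<rho> "total_D b R" Q]
    by (auto intro: eqv_trans)
qed

lemma additive_mod_evl_lsubst:
  assumes "additive_mod n g"
  shows "eqv n (evl \<rho> g (lsubst (\<lambda>j. lvar (s j)) P)) (evl (\<lambda>j. \<rho> (s j)) g P)"
proof (induction P rule: lpoly_induct_all)
  case (const v)
  show ?case by (simp add: evl_lconst_indep[of \<rho> g v "\<lambda>j. \<rho> (s j)"])
next
  case (add P Q)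
  show ?case unfolding lsubst_add
    by (rule eqv_trans[OF additive_mod_evl[OF assms]], rule eqv_trans[OF eqv_add[OF add]])
      (rule eqv_sym[OF additive_mod_evl[OF assms]])
next
  case (lvar i P)
  show ?case unfolding lsubst_lvar evl_lvar by (rule eqv_pact[OF lvar])
qed

subsection \<open>A single summand of the box product\<close>

definition phi :: "nat \<Rightarrow> nat list \<Rightarrow> nat \<Rightarrow> 'f lpoly"
  where "phi b is j = (if j = 0 then \<Sum>l<b. lvar (is ! l) else lvar (is ! (b + j - 1)))"

lemma phi_0: "phi b is 0 = (\<Sum>l<b. lvar (is ! l))"
  and phi_Suc: "phi b is (Suc j) = lvar (is ! (b + j))"
  by (simp_all add: phi_def)

text \<open>\<open>box_summand b x y is ws\<close> is the summand for the permutation \<open>is\<close>, where \<open>ws\<close> are the arguments already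
  arranged in the order \<open>is\<close>.\<close>

definition outer_val :: "nat \<Rightarrow> ('v list \<Rightarrow> 'v lpoly) \<Rightarrow> nat list \<Rightarrow> 'v list \<Rightarrow> 'v \<Rightarrow> 'v lpoly"
  where "outer_val b x is w v = lsubst (phi b is) (x (v # w))"

definition box_summand :: "nat \<Rightarrow> ('v list \<Rightarrow> 'v lpoly) \<Rightarrow> ('v list \<Rightarrow> 'v lpoly) \<Rightarrow> nat list \<Rightarrow> 'v list \<Rightarrow> 'v lpoly"
  where "box_summand b x y is ws = evl (\<lambda>j. lvar (is ! j)) (outer_val b x is (drop b ws)) (y (take b ws))"

lemma box_term_box_summand: "box_term b X Y is vs = box_summand b (rp X) (rp Y) is (map ((!) vs) is)"
  unfolding box_term_def box_summand_def outer_val_def phi_def[abs_def] evl_def ksum_def Let_def take_map drop_map ..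

text \<open>Slot 0 collects the inner variables and the other slots take the remaining ones; this is
  the condition that \<open>eqv_lsubst\<close> asks for.\<close>

lemma phi_sum:
  assumes "is \<in> perms n" "a + b = Suc n" "b \<le> n"
  shows "(\<Sum>j<a. phi b is j) = lsum n"
proof -
  obtain a' where a: "a = Suc a'" "n = b + a'" using assms by (cases a) auto
  have "(\<Sum>l<b + k. lvar (is ! l) :: 'f lpoly) = (\<Sum>l<b. lvar (is ! l)) + (\<Sum>j<k. lvar (is ! (b + j)))" for k
    by (induction k) (simp_all add: add.assoc)
  then have "(\<Sum>j<a. phi b is j) = (\<Sum>l<n. lvar (is ! l))"
    unfolding a sum.lessThan_Suc_shift by (simp add: phi_def)
  then show ?thesis using lsum_perm[OF assms(1)] by simp
qed

lemma phi_polys: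
  assumes "is \<in> perms n" "a + b = Suc n" "b \<le> n" "j < a" shows "phi b is j \<in> polys n"
  using assms by (auto simp: phi_def intro!: polys_sum polys_lvar perms_lt)

lemma outer_val_add:
  assumes "is \<in> perms n" "a + b = Suc n" "b \<le> n" "multi a x" "length w + 1 = a"
  shows "additive_mod n (outer_val b x is w)"
  unfolding additive_mod_def outer_val_def lsubst_add[symmetric]
proof (intro allI eqv_lsubst[OF _ phi_sum[OF assms(1-3)]])
  fix u v show "eqv a (x ((u + v) # w)) (x (u # w) + x (v # w))"
    using multi_add[OF assms(4), of "0 # w" 0 u v] assms(5) by simp
qed

lemma outer_val_scale:
  assumes "is \<in> perms n" "a + b = Suc n" "b \<le> n" "multi a x" "length w + 1 = a"
  shows "eqv n (outer_val b x is w (scale c v)) (lconst c \<odot> outer_val b x is w v)"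
  unfolding outer_val_def lsubst_smult[symmetric]
  using multi_scale[OF assms(4), of "0 # w" 0 c v] assms(5)
  by (intro eqv_lsubst[OF _ phi_sum[OF assms(1-3)]]) simp

lemma outer_val_D:
  assumes "is \<in> perms n" "a + b = Suc n" "b \<le> n" "sesq a x" "length w + 1 = a"
  shows "eqv n (outer_val b x is w (D v)) (- ((\<Sum>j<b. lvar (is ! j)) \<odot> outer_val b x is w v))"
proof -
  have "eqv n (lsubst (phi b is) (x (D v # w))) (lsubst (phi b is) (- (lvar 0 \<odot> x (v # w))))"
    using sesqD[OF assms(4), of "0 # w" 0 v] assms(5)
    by (intro eqv_lsubst[OF _ phi_sum[OF assms(1-3)]]) simp
  also have "lsubst (phi b is) (- (lvar 0 \<odot> x (v # w))) = - (phi b is 0 \<odot> lsubst (phi b is) (x (v # w)))"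
    using lsubst_sg[of "phi b is" 1] by (simp add: sg_def lsubst_lvar)
  finally show ?thesis by (simp add: outer_val_def phi_0)
qed

lemma box_summand_polys:
  assumes "is \<in> perms n" "a + b = Suc n" "b \<le> n" "pval a x" "pval b y" "length ws = n"
  shows "box_summand b x y is ws \<in> polys n"
  unfolding box_summand_def outer_val_def
proof (rule polys_evl[of _ b])
  show "y (take b ws) \<in> polys b" using assms by (intro pvalD) auto
  show "lvar (is ! j) \<in> polys n" if "j < b" for j
    using that assms by (intro polys_lvar perms_lt) auto
  show "lsubst (phi b is) (x (v # drop b ws)) \<in> polys n" for v
    using assms by (intro polys_lsubst[OF _ phi_polys[OF assms(1-3)]] pvalD) auto
qed

lemma box_summand_multi:
  assumes i: "is \<in> perms n" "a + b = Suc n" "b \<le> n" and x: "multi a x" "sesq a x" and y: "multi b y"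
  shows "multi n (box_summand b x y is)"
  unfolding multi_def
proof (intro ballI allI impI)
  fix ws :: "'v list" and i c u w assume "ws \<in> args n" and i': "i < n"
  then have ws: "length ws = n" by (simp add: args_def)
  have g: "additive_mod n (outer_val b x is w)" "eqv n (outer_val b x is w (D v)) (- ((\<Sum>j<b. lvar (is ! j)) \<odot> outer_val b x is w v))"
      "eqv n (outer_val b x is w (scale c v)) (lconst c \<odot> outer_val b x is w v)"
    if "length w + 1 = a" for w c v
    using that by (auto intro: outer_val_add[OF i x(1)] outer_val_D[OF i x(2)] outer_val_scale[OF i x(1)])
  let ?e = "\<lambda>g. evl (\<lambda>j. lvar (is ! j)) g"
  show "eqv n (box_summand b x y is (ws[i := scale c u + w])) (lconst c \<odot> box_summand b x y is (ws[i := u]) + box_summand b x y is (ws[i := w]))"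
  proof (cases "i < b")
    case True
    let ?y = "\<lambda>v. y ((take b ws)[i := v])" and ?g = "outer_val b x is (drop b ws)"
    have l: "length (drop b ws) + 1 = a" using i ws by simp
    have t: "box_summand b x y is (ws[i := v]) = ?e ?g (?y v)" for v
      using True by (simp add: box_summand_def take_update_swap)
    have "eqv n (?e ?g (?y (scale c u + w))) (?e ?g (lconst c \<odot> ?y u + ?y w))"
      by (rule additive_mod_evl_resp[OF g(1,2)[OF l]]) (rule multi_lin[OF y], use True ws i in auto)
    also have "eqv n \<dots> (?e ?g (lconst c \<odot> ?y u) + ?e ?g (?y w))"
      by (rule additive_mod_evl[OF g(1)[OF l]])
    also have "eqv n \<dots> (lconst c \<odot> ?e ?g (?y u) + ?e ?g (?y w))"
      by (intro eqv_add eqv_refl additive_mod_evl_smult g l)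
    finally show ?thesis unfolding t .
  next
    case False
    let ?g = "\<lambda>v. outer_val b x is ((drop b ws)[i - b := v])"
    have t: "box_summand b x y is (ws[i := v]) = ?e (?g v) (y (take b ws))" for v
      using False by (simp add: box_summand_def drop_update_swap)
    have "eqv n (?e (?g (scale c u + w)) (y (take b ws)))
        (?e (\<lambda>v. lconst c \<odot> ?g u v + ?g w v) (y (take b ws)))"
    proof (rule evl_eqv_cong)
      fix v
      show "eqv n (?g (scale c u + w) v) (lconst c \<odot> ?g u v + ?g w v)"
        unfolding outer_val_def lsubst_smult[symmetric] lsubst_add[symmetric]
        using multi_lin[OF x(1), of "v # drop b ws" "Suc (i - b)" c u w] ws i i' False
        by (intro eqv_lsubst[OF _ phi_sum[OF i]]) simp
    qed
    then show ?thesis unfolding t evl_fun_add evl_fun_pact .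
  qed
qed

text \<open>A variable of the inner map comes out as a coefficient, and slot
  \<open>i - b + 1\<close> of the outer map carries the variable of its own index; so both cases
  give the variable with index \<open>is ! i\<close>.\<close>

lemma box_summand_sesq:
  assumes i: "is \<in> perms n" "a + b = Suc n" "b \<le> n" and x: "multi a x" "sesq a x" and y: "sesq b y"
    and ws: "length ws = n" and i': "i < n"
  shows "eqv n (box_summand b x y is (ws[i := D (ws ! i)])) (- (lvar (is ! i) \<odot> box_summand b x y is ws))"
proof -
  let ?e = "\<lambda>g. evl (\<lambda>j. lvar (is ! j)) g"
  show ?thesis
  proof (cases "i < b")
    case True
    let ?g = "outer_val b x is (drop b ws)"
    have l: "length (drop b ws) + 1 = a" using i ws by simp
    have "eqv n (?e ?g (y ((take b ws)[i := D (ws ! i)]))) (?e ?g (- (lvar i \<odot> y (take b ws))))"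
      by (rule additive_mod_evl_resp[OF outer_val_add[OF i x(1) l] outer_val_D[OF i x(2) l]])
        (use sesqD[OF y, of "take b ws" i "ws ! i"] True ws i list_update_id[of "take b ws" i] in auto)
    also have "eqv n \<dots> (- ?e ?g (lvar i \<odot> y (take b ws)))"
      by (rule additive_mod_evl_minus[OF outer_val_add[OF i x(1) l]])
    finally show ?thesis using True by (simp add: box_summand_def take_update_swap evl_lvar)
  next
    case False
    let ?w = "drop b ws"
    have "eqv n (?e (outer_val b x is (?w[i - b := D (ws ! i)])) (y (take b ws)))
        (?e (\<lambda>v. - (lvar (is ! i) \<odot> outer_val b x is ?w v)) (y (take b ws)))"
    proof (rule evl_eqv_cong)
      fix v
      have w: "?w[i - b := ws ! i] = ?w"
        using list_update_id[of ?w "i - b"] False i' ws by simp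
      have "eqv n (lsubst (phi b is) (x (v # ?w[i - b := D (ws ! i)])))
          (lsubst (phi b is) (- (lvar (Suc (i - b)) \<odot> x (v # ?w))))"
        using sesqD[OF x(2), of "v # ?w" "Suc (i - b)" "ws ! i"] ws i i' False w
        by (intro eqv_lsubst[OF _ phi_sum[OF i]]) simp
      also have "lsubst (phi b is) (- (lvar (Suc (i - b)) \<odot> x (v # ?w)))
          = - (phi b is (Suc (i - b)) \<odot> lsubst (phi b is) (x (v # ?w)))"
        using lsubst_sg[of "phi b is" 1] by (simp add: sg_def lsubst_lvar)
      finally show "eqv n (outer_val b x is (?w[i - b := D (ws ! i)]) v) (- (lvar (is ! i) \<odot> outer_val b x is ?w v))"
        using False by (simp add: outer_val_def phi_Suc)
    qed
    then show ?thesis using False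
      by (simp add: box_summand_def drop_update_swap evl_fun_minus evl_fun_pact)
  qed
qed

text \<open>The outer map sees the inner variables only through their sum, so it does not notice a
  reordering of the inner block, and the symmetry of \<open>y\<close> gives the sign.\<close>

lemma box_summand_perm_inner:
  assumes i: "I @ J \<in> perms n" "a + b = Suc n" "b \<le> n" "length I = b"
    and x: "multi a x" "sesq a x" and y: "pval b y" "sym_on b y"
    and \<tau>: "\<tau> \<in> perms b" and u: "length u = b" "homog qs u" and w: "length w + 1 = a"
  shows "eqv n (box_summand b x y (I @ J) (u @ w))
    (sg (epar qs \<tau>) (box_summand b x y (map ((!) I) \<tau> @ J) (map ((!) u) \<tau> @ w)))"
proof -
  let ?g = "outer_val b x (I @ J) w" and ?y = "y (map ((!) u) \<tau>)" and ?I = "map ((!) I) \<tau>"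
  have l\<tau>: "length \<tau> = b" using perms_bij(1)[OF \<tau>] .
  have phi: "phi b (?I @ J) = phi b (I @ J)"
  proof
    fix j
    have "(\<Sum>l<b. lvar ((?I @ J) ! l) :: 'f lpoly) = (\<Sum>l<b. lvar ((I @ J) ! (\<tau> ! l)))"
      using i(4) l\<tau> perms_lt[OF \<tau>] by (intro sum.cong) (auto simp: nth_append)
    also have "\<dots> = (\<Sum>l<b. lvar ((I @ J) ! l))"
      by (rule sum.reindex_bij_betw[OF perms_bij(2)[OF \<tau>]])
    finally show "phi b (?I @ J) j = (phi b (I @ J) j :: 'f lpoly)"
      using i(4) l\<tau> by (cases j) (simp_all add: phi_0 phi_Suc nth_append)
  qed
  note g = outer_val_add[OF i(1-3) x(1) w] outer_val_D[OF i(1-3) x(2) w]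
  let ?e = "evl (\<lambda>j. lvar ((I @ J) ! j)) ?g"
  have "eqv n (?e (y u)) (?e (sg (epar qs \<tau>) (lsubst (\<lambda>j. lvar (\<tau> ! j)) ?y)))"
    by (rule additive_mod_evl_resp[OF g]) (rule sym_onD[OF y(2) u \<tau>])
  also have "eqv n \<dots> (sg (epar qs \<tau>) (?e (lsubst (\<lambda>j. lvar (\<tau> ! j)) ?y)))"
    by (rule additive_mod_evl_sg[OF g(1)])
  also have "eqv n \<dots> (sg (epar qs \<tau>) (evl (\<lambda>j. lvar ((I @ J) ! (\<tau> ! j))) ?g ?y))"
    by (rule eqv_sg[OF additive_mod_evl_lsubst[OF g(1)]])
  also have "evl (\<lambda>j. lvar ((I @ J) ! (\<tau> ! j))) ?g ?y = evl (\<lambda>j. lvar ((?I @ J) ! j)) ?g ?y"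
    using i(4) l\<tau> perms_lt[OF \<tau>] y(1)
    by (intro evl_cong[of _ b] pvalD) (auto simp: nth_append)
  finally show ?thesis
    using u(1) l\<tau> by (simp add: box_summand_def) (simp only: outer_val_def[abs_def] phi)
qed

text \<open>The symmetry of \<open>x\<close> is used for a permutation that fixes slot 0, whose
  entry therefore contributes no sign.\<close>

lemma box_summand_perm_outer:
  assumes i: "I @ J \<in> perms n" "a + b = Suc n" "b \<le> n" "length I = b"
    and x: "pval a x" "multi a x" "sym_on a x" and y: "pval b y"
    and \<tau>: "\<tau> \<in> perms (length J)" and u: "length u = b" and w: "length w + 1 = a" "homog qs w"
  shows "eqv n (box_summand b x y (I @ J) (u @ w))
    (sg (epar qs \<tau>) (box_summand b x y (I @ map ((!) J) \<tau>) (u @ map ((!) w) \<tau>)))"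
proof -
  have "length (I @ J) = n" using perms_bij(1)[OF i(1)] .
  then have lJ: "length J + 1 = a" using i by simp
  have l\<tau>: "length \<tau> = length J" using perms_bij(1)[OF \<tau>] .
  let ?J = "map ((!) J) \<tau>" and ?w = "map ((!) w) \<tau>"
  define \<sigma> where "\<sigma> = 0 # map Suc \<tau>"
  have \<sigma>: "\<sigma> \<in> perms a" using perms_Cons_Suc[OF \<tau>] lJ by (simp add: \<sigma>_def)
  \<comment> \<open>The entry \<open>v\<close> is a coefficient of the inner value and need not be
    homogeneous, so it is split into its parity parts before the symmetry of \<open>x\<close>
    applies.\<close>
  have xw: "eqv a (x (v # w)) (sg (epar qs \<tau>) (lsubst (\<lambda>j. lvar (\<sigma> ! j)) (x (v # ?w))))" for v
  proof -
    have h: "eqv a (x (v # w)) (sg (epar qs \<tau>) (lsubst (\<lambda>j. lvar (\<sigma> ! j)) (x (v # ?w))))"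
      if "v \<in> G p" for v p
    proof -
      have "homog (p # qs) (v # w)" using w(2) that by (simp add: homog_def)
      from sym_onD[OF x(3) _ this \<sigma>] w(1) show ?thesis
        by (simp add: \<sigma>_def epar_map_Suc sum_list_0 comp_def cong: if_cong)
    qed
    have s: "eqv a (x (v # zs)) (x (proj 0 v # zs) + x (proj 1 v # zs))" if "length zs + 1 = a" for zs
      using multi_add[OF x(2), of "0 # zs" 0 "proj 0 v" "proj 1 v"] proj_sum[of 0 v] that by simp
    have lw: "length ?w + 1 = a" using l\<tau> lJ by simp
    have "eqv a (x (v # w)) (x (proj 0 v # w) + x (proj 1 v # w))" by (rule s[OF w(1)])
    also have "eqv a \<dots> (sg (epar qs \<tau>) (lsubst (\<lambda>j. lvar (\<sigma> ! j)) (x (proj 0 v # ?w)))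
        + sg (epar qs \<tau>) (lsubst (\<lambda>j. lvar (\<sigma> ! j)) (x (proj 1 v # ?w))))"
      by (intro eqv_add; rule h, rule proj_G)
    also have "eqv a \<dots> (sg (epar qs \<tau>) (lsubst (\<lambda>j. lvar (\<sigma> ! j)) (x (v # ?w))))"
      unfolding sg_add[symmetric] lsubst_add[symmetric]
      by (intro eqv_sg eqv_lsubst[of a] lsum_perm \<sigma> eqv_sym[OF s[OF lw]])
    finally show ?thesis .
  qed
  have "eqv n (outer_val b x (I @ J) w v) (sg (epar qs \<tau>) (outer_val b x (I @ ?J) ?w v))" for v
  proof -
    have "eqv n (outer_val b x (I @ J) w v)
        (lsubst (phi b (I @ J)) (sg (epar qs \<tau>) (lsubst (\<lambda>j. lvar (\<sigma> ! j)) (x (v # ?w)))))"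
      unfolding outer_val_def by (rule eqv_lsubst[OF xw phi_sum[OF i(1-3)]])
    also have "\<dots> = sg (epar qs \<tau>) (lsubst (\<lambda>j. phi b (I @ J) (\<sigma> ! j)) (x (v # ?w)))"
      by (simp add: lsubst_sg lsubst_lsubst_lvar)
    also have "lsubst (\<lambda>j. phi b (I @ J) (\<sigma> ! j)) (x (v # ?w)) = outer_val b x (I @ ?J) ?w v"
      unfolding outer_val_def
    proof (rule lsubst_cong[of _ a])
      show "x (v # ?w) \<in> polys a" using x(1) l\<tau> lJ by (intro pvalD) auto
      show "phi b (I @ J) (\<sigma> ! j) = (phi b (I @ ?J) j :: 'f lpoly)" if "j < a" for j
        using that l\<tau> lJ i(4) by (cases j) (auto simp: \<sigma>_def phi_0 phi_Suc nth_append)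
    qed
    finally show ?thesis .
  qed
  then have "eqv n (evl (\<lambda>j. lvar ((I @ J) ! j)) (outer_val b x (I @ J) w) (y u))
      (sg (epar qs \<tau>) (evl (\<lambda>j. lvar ((I @ J) ! j)) (outer_val b x (I @ ?J) ?w) (y u)))"
    unfolding evl_fun_sg[symmetric] by (rule evl_eqv_cong)
  also have "evl (\<lambda>j. lvar ((I @ J) ! j)) (outer_val b x (I @ ?J) ?w) (y u)
      = evl (\<lambda>j. lvar ((I @ ?J) ! j)) (outer_val b x (I @ ?J) ?w) (y u)"
    using y u i(4) by (intro evl_cong[of _ b] pvalD) (auto simp: nth_append)
  finally show ?thesis using u by (simp add: box_summand_def)
qed

definition signed_summand :: "nat \<Rightarrow> ('v list \<Rightarrow> 'v lpoly) \<Rightarrow> ('v list \<Rightarrow> 'v lpoly) \<Rightarrow> bit list \<Rightarrow> 'v list \<Rightarrow>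
    nat list \<Rightarrow> 'v lpoly"
  where "signed_summand b x y ps vs is = sg (epar ps is) (box_summand b x y is (map ((!) vs) is))"

definition box_poly :: "nat \<Rightarrow> nat \<Rightarrow> ('v list \<Rightarrow> 'v lpoly) \<Rightarrow> ('v list \<Rightarrow> 'v lpoly) \<Rightarrow> bit list \<Rightarrow> 'v list \<Rightarrow> 'v lpoly"
  where "box_poly n b x y ps vs = (\<Sum>is\<in>unshuffles b n. signed_summand b x y ps vs is)"

lemma box_mk: "a + b = Suc n \<Longrightarrow> box a b X Y = mk n (multi_ext n (box_poly n b (rp X) (rp Y)))"
  by (simp add: box_def mk_def multi_ext_def box_poly_def signed_summand_def box_term_box_summand eps_epar psign_pact Let_def
      del: mem_Collect_eq)

text \<open>Permutations with the same inner set differ by a reordering of each block. Inversions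
  between the blocks are the same for both, so the Koszul sign changes exactly by the signs of the
  two reorderings.\<close>

lemma signed_summand_block:
  assumes i: "is \<in> perms n" "is' \<in> perms n" "set (take b is) = set (take b is')"
    and ab: "a + b = Suc n" "b \<le> n" and x: "cochain a x" and y: "cochain b y"
    and vs: "length vs = n" "homog ps vs"
  shows "eqv n (signed_summand b x y ps vs is) (signed_summand b x y ps vs is')"
proof -
  define I J I' J' where "I = take b is" "J = drop b is" "I' = take b is'" "J' = drop b is'"
  note defs = this
  have len: "length is = n" "length is' = n" using i perms_bij by auto
  have l: "length I = b" "length J + 1 = a" "length I' = b" "length J' + 1 = a"
    using len ab by (auto simp: defs)
  have s: "is = I @ J" "is' = I' @ J'" by (simp_all add: defs)
  have d: "distinct (I @ J)" "distinct (I' @ J')" "set (I @ J) = {..<n}" "set (I' @ J') = {..<n}"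
    using i by (auto simp flip: s dest: permutations_of_setD)
  have I: "set I = set I'" using i(3) by (simp add: defs)
  have J: "set J = set J'" using d I by auto
  obtain \<tau> where \<tau>: "\<tau> \<in> perms b" "I' = map ((!) I) \<tau>"
    using ex_perm_map[of I I'] d I l by auto
  obtain \<sigma> where \<sigma>: "\<sigma> \<in> perms (length J)" "J' = map ((!) J) \<sigma>"
    using ex_perm_map[of J J'] d J l by auto
  let ?q = "\<lambda>xs. map ((!) ps) xs" and ?v = "\<lambda>xs. map ((!) vs) xs"
  have h: "homog (?q I) (?v I)" "homog (?q J) (?v J)"
    using d(3) vs by (auto intro!: homog_map)
  have m: "?v I' = map ((!) (?v I)) \<tau>" "?v J' = map ((!) (?v J)) \<sigma>"
    using \<tau> \<sigma> perms_lt[OF \<tau>(1)] perms_lt[OF \<sigma>(1)] l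
    by (auto simp: in_set_conv_nth dest: permutations_of_setD)
  have i'': "I' @ J \<in> perms n" using d I by (auto simp: permutations_of_set_def)
  have "eqv n (box_summand b x y (I @ J) (?v I @ ?v J)) (sg (epar (?q I) \<tau>) (box_summand b x y (I' @ J) (?v I' @ ?v J)))"
    unfolding m unfolding \<tau>(2)
    by (rule box_summand_perm_inner[where a = a])
      (use i(1) ab l cochainD[OF x] cochainD[OF y] \<tau>(1) h in \<open>auto simp: s\<close>)
  also have "eqv n \<dots> (sg (epar (?q I) \<tau>) (sg (epar (?q J) \<sigma>) (box_summand b x y (I' @ J') (?v I' @ ?v J'))))"
    unfolding m(2) unfolding \<sigma>(2)
    by (rule eqv_sg, rule box_summand_perm_outer[where a = a])
      (use i'' ab l cochainD[OF x] cochainD[OF y] \<sigma>(1) h in auto)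
  finally have "eqv n (sg (epar ps is) (box_summand b x y is (?v is)))
      (sg (epar ps is) (sg (epar (?q I) \<tau> + epar (?q J) \<sigma>) (box_summand b x y is' (?v is'))))"
    unfolding s by (intro eqv_sg) simp
  moreover have "epar ps is' = epar ps is + (epar (?q I) \<tau> + epar (?q J) \<sigma>)"
  proof -
    have "epar ps I' = epar ps I + epar (?q I) \<tau>"
      unfolding \<tau>(2) by (rule epar_compose) (use \<tau> d l in auto)
    moreover have "epar ps J' = epar ps J + epar (?q J) \<sigma>"
      unfolding \<sigma>(2) by (rule epar_compose) (use \<sigma> d l in auto)
    moreover have "cross ps I' J' = cross ps I J"
      using d I J by (intro cross_mset) (auto simp: set_eq_iff_mset_eq_distinct)
    ultimately show ?thesis unfolding s epar_append by (simp add: algebra_simps)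
  qed
  ultimately show ?thesis by (simp add: signed_summand_def)
qed

text \<open>An equation and not only a congruence, because both maps are evaluated at the same
  arguments and only variables are renamed.\<close>

lemma box_summand_relabel:
  assumes i: "is \<in> perms n" "a + b = Suc n" "b \<le> n" and \<tau>: "\<tau> \<in> perms n"
    and x: "pval a x" and y: "pval b y" and ws: "length ws = n"
  shows "lsubst (\<lambda>j. lvar (\<tau> ! j)) (box_summand b x y is ws) = box_summand b x y (map ((!) \<tau>) is) ws"
proof -
  have len: "length is = n" using perms_bij(1)[OF i(1)] .
  let ?is = "map ((!) \<tau>) is"
  have phi: "lsubst (\<lambda>j. lvar (\<tau> ! j)) (lsubst (phi b is) P) = lsubst (phi b ?is) P" if "P \<in> polys a" for P
    using that
  proof (induction P rule: lpoly_induct)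
    case (lvar k P)
    have "lsubst (\<lambda>j. lvar (\<tau> ! j)) (phi b is k \<odot> Q) = phi b ?is k \<odot> lsubst (\<lambda>j. lvar (\<tau> ! j)) Q" for Q
      using len i lvar.hyps by (cases k) (auto simp: phi_0 phi_Suc lsubst_pact_sum lsubst_lvar)
    then show ?case by (simp add: lsubst_lvar lvar.IH)
  qed (simp_all add: lsubst_add)
  have "lsubst (\<lambda>j. lvar (\<tau> ! j)) (box_summand b x y is ws)
      = evl (\<lambda>j. lvar (\<tau> ! (is ! j))) (\<lambda>v. lsubst (\<lambda>j. lvar (\<tau> ! j)) (outer_val b x is (drop b ws) v)) (y (take b ws))"
    unfolding box_summand_def by (rule lsubst_evl_lvar)
  also have "\<dots> = box_summand b x y ?is ws"
    unfolding box_summand_def outer_val_def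
    by (rule evl_cong[of _ b])
      (use x y ws len i in \<open>auto intro!: phi pvalD\<close>)
  finally show ?thesis .
qed

lemma signed_summand_relabel:
  assumes i: "is \<in> perms n" "a + b = Suc n" "b \<le> n" and \<tau>: "\<tau> \<in> perms n"
    and x: "pval a x" and y: "pval b y" and vs: "length vs = n"
  shows "sg (epar ps \<tau>) (lsubst (\<lambda>j. lvar (\<tau> ! j)) (signed_summand b x y (map ((!) ps) \<tau>) (map ((!) vs) \<tau>) is))
    = signed_summand b x y ps vs (map ((!) \<tau>) is)"
proof -
  have "set is = {..<n}" "length \<tau> = n" "distinct \<tau>"
    using i(1) \<tau> perms_bij(1) by (auto dest: permutations_of_setD)
  then have m: "map ((!) (map ((!) vs) \<tau>)) is = map ((!) vs) (map ((!) \<tau>) is)"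
    "epar ps (map ((!) \<tau>) is) = epar ps \<tau> + epar (map ((!) ps) \<tau>) is"
    using epar_compose[of \<tau> n "is" ps] i(1) by auto
  have "length (map ((!) vs) (map ((!) \<tau>) is)) = n" using perms_bij(1)[OF i(1)] by simp
  from box_summand_relabel[OF i \<tau> x y this] show ?thesis
    by (simp only: signed_summand_def lsubst_sg sg_sg m)
qed

lemma box_poly_sum: "box_poly n b x y ps vs = (\<Sum>S\<in>{S. S \<subseteq> {..<n} \<and> card S = b}. signed_summand b x y ps vs (unsh n S))"
  by (simp add: box_poly_def sum_unshuffles)

lemma perms_image:
  assumes "\<tau> \<in> perms n" shows "bij_betw ((`) ((!) \<tau>)) {S. S \<subseteq> {..<n} \<and> card S = b} {S. S \<subseteq> {..<n} \<and> card S = b}"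
proof -
  let ?A = "{S. S \<subseteq> {..<n} \<and> card S = b}" and ?f = "(`) ((!) \<tau>)"
  have inj: "inj_on ((!) \<tau>) {..<n}" and im: "(!) \<tau> ` {..<n} = {..<n}"
    using perms_bij(2)[OF assms] by (auto simp: bij_betw_def)
  have "finite ?A" by (rule finite_subset[of _ "Pow {..<n}"]) auto
  moreover have "inj_on ?f ?A"
    by (rule inj_onI) (metis (mono_tags) inj inj_on_image_eq_iff mem_Collect_eq)
  moreover have "?f ` ?A \<subseteq> ?A"
  proof
    fix T assume "T \<in> ?f ` ?A"
    then obtain S where S: "S \<subseteq> {..<n}" "card S = b" "T = (!) \<tau> ` S" by auto
    have "(!) \<tau> ` S \<subseteq> (!) \<tau> ` {..<n}" using S(1) by (rule image_mono)
    moreover have "card ((!) \<tau> ` S) = b" using card_image[OF inj_on_subset[OF inj S(1)]] S(2) by simp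
    ultimately show "T \<in> ?A" using im S(3) by simp
  qed
  ultimately show ?thesis using endo_inj_surj[of ?A ?f] unfolding bij_betw_def by blast
qed

lemma cochain_box:
  assumes ab: "a + b = Suc n" and x: "cochain a x" and y: "cochain b y"
  shows "cochain n (multi_ext n (box_poly n b x y))" and "multi n (box_poly n b x y ps)"
proof -
  note x' = cochainD[OF x] and y' = cochainD[OF y]
  have U: "is \<in> perms n" "b \<le> n" if "is \<in> unshuffles b n" for "is"
    using that by (auto simp: unshuffles_def)
  have args: "map ((!) vs) is \<in> args n" if "is \<in> perms n" for vs :: "'v list" and "is"
    using that by (rule perms_args)
  \<comment> \<open>After the rearrangement the \<open>i\<close>-th argument stands at a single
    position \<open>k\<close>.\<close>
  have upd: "\<exists>k<n. is ! k = i \<and> (\<forall>u. map ((!) (vs[i := u])) is = (map ((!) vs) is)[k := u])"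
    if i: "i < n" and "is": "is \<in> perms n" and "length vs = n" for vs :: "'v list" and i "is"
  proof -
    have s: "set is = {..<n}" "distinct is" "length is = n"
      using "is" perms_bij(1) by (auto dest: permutations_of_setD)
    then obtain k where k: "k < n" "is ! k = i" using i by (metis in_set_conv_nth lessThan_iff)
    have "map ((!) (vs[i := u])) is = (map ((!) vs) is)[k := u]" for u
    proof (rule nth_equalityI)
      fix l assume l: "l < length (map ((!) (vs[i := u])) is)"
      then have l: "l < n" using s by simp
      show "map ((!) (vs[i := u])) is ! l = (map ((!) vs) is)[k := u] ! l"
      proof (cases "l = k")
        case True
        then show ?thesis using that(3) s k i by simp
      next
        case False
        then have "is ! l \<noteq> i" using s k l nth_eq_iff_index_eq[of "is" l k] by simp
        then show ?thesis using that(3) s l False by simp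
      qed
    qed simp
    then show ?thesis using k by blast
  qed
  have pv: "pval n (box_poly n b x y ps)" for ps
    unfolding pval_def box_poly_def signed_summand_def
    by (intro ballI polys_sum polys_sg box_summand_polys[OF _ ab _ x'(1) y'(1)])
      (auto simp: U perms_bij)
  have mu: "multi n (box_poly n b x y ps)" for ps
    unfolding multi_def box_poly_def pact.scale_sum_right sum.distrib[symmetric] signed_summand_def pact_sg sg_add[symmetric]
  proof (intro ballI allI impI eqv_sum eqv_sg)
    fix vs :: "'v list" and i c u w "is"
    assume a: "vs \<in> args n" "i < n" "is \<in> unshuffles b n"
    then have vs: "length vs = n" by (simp add: args_def)
    obtain k where k: "k < n" "\<And>u. map ((!) (vs[i := u])) is = (map ((!) vs) is)[k := u]"
      using upd[OF a(2) U(1)[OF a(3)] vs] by blast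
    show "eqv n (box_summand b x y is (map ((!) (vs[i := scale c u + w])) is))
        (lconst c \<odot> box_summand b x y is (map ((!) (vs[i := u])) is) + box_summand b x y is (map ((!) (vs[i := w])) is))"
      unfolding k(2)
      by (rule multi_lin[OF box_summand_multi[OF U(1)[OF a(3)] ab U(2)[OF a(3)] x'(2,3) y'(2)]])
        (use k(1) perms_bij(1)[OF U(1)[OF a(3)]] in auto)
  qed
  then show "multi n (box_poly n b x y ps)" .
  have ss: "sesq n (box_poly n b x y ps)" for ps
    unfolding sesq_def box_poly_def pact.scale_sum_right sum_negf[symmetric] signed_summand_def pact_sg sg_minus[symmetric]
  proof (intro ballI allI impI eqv_sum eqv_sg)
    fix vs :: "'v list" and i "is"
    assume a: "vs \<in> args n" "i < n" "is \<in> unshuffles b n"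
    then have vs: "length vs = n" by (simp add: args_def)
    have len: "length is = n" using perms_bij(1)[OF U(1)[OF a(3)]] .
    obtain k where k: "k < n" "is ! k = i" "\<And>u. map ((!) (vs[i := u])) is = (map ((!) vs) is)[k := u]"
      using upd[OF a(2) U(1)[OF a(3)] vs] by blast
    show "eqv n (box_summand b x y is (map ((!) (vs[i := D (vs ! i)])) is))
        (- (lvar i \<odot> box_summand b x y is (map ((!) vs) is)))"
      unfolding k(3)
      using box_summand_sesq[OF U(1)[OF a(3)] ab U(2)[OF a(3)] x'(2,3) y'(3), of "map ((!) vs) is" k] k len by simp
  qed
  have sy: "eqv n (box_poly n b x y ps vs)
      (sg (epar ps \<tau>) (lsubst (\<lambda>j. lvar (\<tau> ! j)) (box_poly n b x y (map ((!) ps) \<tau>) (map ((!) vs) \<tau>))))"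
    if vs: "length vs = n" "homog ps vs" and \<tau>: "\<tau> \<in> perms n" for vs ps \<tau>
  proof -
    let ?A = "{S. S \<subseteq> {..<n} \<and> card S = b}"
    have S: "unsh n S \<in> perms n" "b \<le> n" "take b (unsh n S) = sorted_list_of_set S" "finite S"
      if "S \<in> ?A" for S
      using that unsh_perm[of S n] card_mono[of "{..<n}" S] finite_subset[of S "{..<n}"] by auto
    have "sg (epar ps \<tau>) (lsubst (\<lambda>j. lvar (\<tau> ! j)) (box_poly n b x y (map ((!) ps) \<tau>) (map ((!) vs) \<tau>)))
        = (\<Sum>S\<in>?A. signed_summand b x y ps vs (map ((!) \<tau>) (unsh n S)))"
      unfolding box_poly_sum lsubst_sum sg_sum
      by (intro sum.cong refl signed_summand_relabel[OF S(1) ab S(2) \<tau> x'(1) y'(1) vs(1)])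
    \<comment> \<open>The image of an unshuffle under \<open>\<tau>\<close> is in general no
      unshuffle, but it has the same inner set as the unshuffle of the image of \<open>S\<close>, so
      the two summands are congruent.\<close>
    also have "eqv n \<dots> (\<Sum>S\<in>?A. signed_summand b x y ps vs (unsh n ((!) \<tau> ` S)))"
    proof (rule eqv_sum)
      fix S assume "S \<in> ?A"
      then have T: "(!) \<tau> ` S \<in> ?A" using bij_betwE[OF perms_image[OF \<tau>]] by blast
      have "set (take b (map ((!) \<tau>) (unsh n S))) = (!) \<tau> ` S"
        using S[OF \<open>S \<in> ?A\<close>] by (simp add: take_map)
      moreover have "set (take b (unsh n ((!) \<tau> ` S))) = (!) \<tau> ` S"
        using S[OF T] by simp
      ultimately show "eqv n (signed_summand b x y ps vs (map ((!) \<tau>) (unsh n S))) (signed_summand b x y ps vs (unsh n ((!) \<tau> ` S)))"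
        using S[OF \<open>S \<in> ?A\<close>] S[OF T] \<tau>
        by (intro signed_summand_block[OF _ _ _ ab _ x y vs] perms_compose) auto
    qed
    also have "(\<Sum>S\<in>?A. signed_summand b x y ps vs (unsh n ((!) \<tau> ` S))) = box_poly n b x y ps vs"
      unfolding box_poly_sum by (rule sum.reindex_bij_betw[OF perms_image[OF \<tau>]])
    finally show ?thesis by (rule eqv_sym)
  qed
  show "cochain n (multi_ext n (box_poly n b x y))"
    unfolding cochain_def
    by (intro conjI pval_multi_ext multi_multi_ext sesq_multi_ext sym_multi_ext pv mu ss sy)
qed

end

section \<open>Homogeneous components\<close>

lemma bit_neq_add_1: "(p :: bit) \<noteq> p + 1"
  by (cases p) auto

lemma sum_list_perm:
  assumes "\<tau> \<in> perms (length ps)" shows "sum_list (map ((!) ps) \<tau>) = sum_list (ps :: bit list)"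
proof -
  have "mset \<tau> = mset [0..<length ps]"
    using assms by (subst set_eq_iff_mset_eq_distinct[symmetric])
      (auto simp: atLeast0LessThan dest: permutations_of_setD)
  then have "mset (map ((!) ps) \<tau>) = mset (map ((!) ps) [0..<length ps])" by (simp only: mset_map)
  then show ?thesis by (metis map_nth sum_mset_sum_list)
qed

context diff_supermodule
begin

definition proj_poly :: "bit \<Rightarrow> 'v lpoly \<Rightarrow> 'v lpoly" where "proj_poly q = Poly_Mapping.map (proj q)"

lemma lookup_proj_poly: "lk (proj_poly q P) m = proj q (lk P m)"
  by (simp add: proj_poly_def lookup_map)

lemma proj_poly_add: "proj_poly q (P + Q) = proj_poly q P + proj_poly q Q"
  by (rule poly_mapping_eqI) (simp add: lookup_proj_poly lookup_add proj_add)

lemma proj_poly_0 [simp]: "proj_poly q 0 = 0"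
  by (rule poly_mapping_eqI) (simp add: lookup_proj_poly)

lemma proj_poly_lconst [simp]: "proj_poly q (lconst v) = lconst (proj q v)"
  by (rule poly_mapping_eqI) (simp add: lookup_proj_poly lookup_lconst)

lemma proj_poly_lvar: "proj_poly q (lvar i \<odot> P) = lvar i \<odot> proj_poly q P"
proof (induction P rule: lpoly_single_induct)
  case (single m)
  have s: "proj_poly q (Poly_Mapping.single k v) = Poly_Mapping.single k (proj q v)" for k v
    by (rule poly_mapping_eqI) (simp add: lookup_proj_poly lookup_single when_def)
  show ?case by (simp only: lvar_pact_single s)
qed (simp_all add: proj_poly_add pact.scale_right_distrib)

lemma proj_poly_lconst_pact: "proj_poly q (lconst c \<odot> P) = lconst c \<odot> proj_poly q P"
  by (rule poly_mapping_eqI) (simp add: lookup_proj_poly lookup_lconst_pact proj_scale)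

lemma proj_poly_D_poly: "proj_poly q (D_poly P) = D_poly (proj_poly q P)"
  by (rule poly_mapping_eqI) (simp add: lookup_proj_poly lookup_D_poly proj_D)

lemma proj_poly_lvar_sum: "proj_poly q ((\<Sum>i\<in>A. lvar i) \<odot> P) = (\<Sum>i\<in>A. lvar i) \<odot> proj_poly q P"
  by (induction A rule: infinite_finite_induct) (auto simp: pact.scale_left_distrib proj_poly_add proj_poly_lvar)

lemma proj_poly_minus: "proj_poly q (- P) = - proj_poly q P"
  using proj_poly_add[of q P "- P"] by (simp add: eq_neg_iff_add_eq_0 add.commute)

lemma proj_poly_sg: "proj_poly q (sg p P) = sg p (proj_poly q P)"
  by (simp add: sg_def proj_poly_minus)

lemma proj_poly_diff: "proj_poly q (P - Q) = proj_poly q P - proj_poly q Q"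
  using proj_poly_add[of q "P - Q" Q] by simp

lemma proj_poly_lsubst_lvar: "proj_poly q (lsubst (\<lambda>j. lvar (s j)) P) = lsubst (\<lambda>j. lvar (s j)) (proj_poly q P)"
  by (induction P rule: lpoly_induct_all) (simp_all add: proj_poly_add lsubst_add proj_poly_lvar lsubst_lvar)

lemma polys_proj_poly: "P \<in> polys n \<Longrightarrow> proj_poly q P \<in> polys n"
  unfolding proj_poly_def by (rule polys_map) auto

text \<open>The derivation is even, so parity projections commute with the total derivative.\<close>

lemma eqv_proj_poly: "eqv n P Q \<Longrightarrow> eqv n (proj_poly q P) (proj_poly q Q)"
  unfolding eqv_def by (auto simp: total_D_def proj_poly_add proj_poly_lvar_sum proj_poly_D_poly simp flip: proj_poly_diff)

lemma proj_poly_sum: "proj_poly q P + proj_poly (q + 1) P = P"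
  by (rule poly_mapping_eqI) (simp add: lookup_proj_poly lookup_add proj_sum)

definition homog_poly :: "bit \<Rightarrow> 'v lpoly \<Rightarrow> bool" where "homog_poly q P \<longleftrightarrow> (\<forall>m. lk P m \<in> G q)"

lemma homog_poly_proj_poly [simp]: "homog_poly q (proj_poly q P)"
  by (simp add: homog_poly_def lookup_proj_poly)

lemma homog_poly_iff: "homog_poly q P \<longleftrightarrow> proj_poly q P = P"
proof
  assume "homog_poly q P" then show "proj_poly q P = P"
    by (intro poly_mapping_eqI) (simp add: lookup_proj_poly homog_poly_def proj_id)
next
  assume "proj_poly q P = P" then show "homog_poly q P" by (metis homog_poly_proj_poly)
qed

lemma proj_poly_other: "homog_poly p P \<Longrightarrow> q \<noteq> p \<Longrightarrow> proj_poly q P = 0"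
  by (rule poly_mapping_eqI) (auto simp: lookup_proj_poly homog_poly_def intro: proj_other)

text \<open>A representative of a homogeneous class need not be homogeneous itself.\<close>

definition has_parity :: "nat \<Rightarrow> bit \<Rightarrow> ('v list \<Rightarrow> 'v lpoly) \<Rightarrow> bool"
  where "has_parity n q x \<longleftrightarrow> (\<forall>vs\<in>args n. \<forall>ps. homog ps vs \<longrightarrow>
    eqv n (x vs) (proj_poly (q + sum_list ps) (x vs)))"

lemma quot_part_iff:
  assumes "P \<in> polys n" shows "cls n P \<in> quot_part n q \<longleftrightarrow> eqv n P (proj_poly q P)"
proof
  assume "cls n P \<in> quot_part n q"
  then obtain Q where Q: "Q \<in> polys n" "homog_poly q Q" "cls n P = cls n Q"
    by (auto simp: quot_part_def homog_poly_def)
  then have "eqv n P Q" using assms by (simp add: cls_eq_iff)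
  moreover have "eqv n Q (proj_poly q P)" using eqv_proj_poly[OF eqv_sym[OF calculation], of q] Q(2) by (simp add: homog_poly_iff)
  ultimately show "eqv n P (proj_poly q P)" by (rule eqv_trans)
next
  assume "eqv n P (proj_poly q P)"
  then have "cls n P = cls n (proj_poly q P)" using assms by (simp add: cls_eq_iff polys_proj_poly)
  moreover have "proj_poly q P \<in> {P \<in> polys n. \<forall>m. lk P m \<in> G q}"
    using assms homog_poly_proj_poly[of q P] by (simp add: polys_proj_poly homog_poly_def)
  ultimately show "cls n P \<in> quot_part n q" by (auto simp: quot_part_def)
qed

lemma mk_W_part_iff: "cochain n x \<Longrightarrow> mk n x \<in> W_part n q \<longleftrightarrow> has_parity n q x"
  by (auto simp: W_part_def has_parity_def mk_W) (auto simp: mk_def quot_part_iff cochain_def pval_def)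

lemma W_part_E:
  assumes "X \<in> W_part n q" shows "cochain n (rp X)" "has_parity n q (rp X)" "mk n (rp X) = X"
  using assms mk_W_part_iff[of n "rp X" q] W_E by (auto simp: W_part_def)

definition component :: "nat \<Rightarrow> bit \<Rightarrow> ('v list \<Rightarrow> 'v lpoly) \<Rightarrow> 'v list \<Rightarrow> 'v lpoly"
  where "component n q x = multi_ext n (\<lambda>ps vs. proj_poly (q + sum_list ps) (x vs))"

lemma multi_proj_poly: "multi n x \<Longrightarrow> multi n (\<lambda>vs. proj_poly q (x vs))"
  unfolding multi_def by (simp flip: proj_poly_add proj_poly_lconst_pact) (blast intro: eqv_proj_poly)

lemma cochain_component:
  assumes "cochain n x" shows "cochain n (component n q x)"
  unfolding cochain_def component_def
proof (intro conjI pval_multi_ext multi_multi_ext sesq_multi_ext sym_multi_ext multi_proj_poly cochainD[OF assms])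
  show "pval n (\<lambda>vs. proj_poly q (x vs))" for q
    using cochainD(1)[OF assms] by (simp add: pval_def polys_proj_poly)
  show "sesq n (\<lambda>vs. proj_poly q (x vs))" for q
    using cochainD(3)[OF assms] unfolding sesq_def by (simp flip: proj_poly_minus proj_poly_lvar) (blast intro: eqv_proj_poly)
  fix ps vs \<tau> assume a: "length vs = n" "homog ps vs" "\<tau> \<in> perms n"
  have "sum_list (map ((!) ps) \<tau>) = sum_list ps"
    using a homog_length[OF a(2)] by (intro sum_list_perm) simp
  then show "eqv n (proj_poly (q + sum_list ps) (x vs)) (sg (epar ps \<tau>) (lsubst (\<lambda>j. lvar (\<tau> ! j))
      (proj_poly (q + sum_list (map ((!) ps) \<tau>)) (x (map ((!) vs) \<tau>)))))"
    using sym_onD[OF cochainD(4)[OF assms] a] by (simp flip: proj_poly_lsubst_lvar proj_poly_sg add: eqv_proj_poly)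
qed

lemma component_homog:
  "cochain n x \<Longrightarrow> length vs = n \<Longrightarrow> homog ps vs \<Longrightarrow> eqv n (component n q x vs) (proj_poly (q + sum_list ps) (x vs))"
  unfolding component_def by (rule multi_ext_homog) (auto intro: multi_proj_poly cochainD)

lemma has_parity_component:
  assumes "cochain n x" shows "has_parity n q (component n q x)"
  unfolding has_parity_def
proof (intro ballI allI impI)
  fix vs ps assume "vs \<in> args n" "homog ps vs"
  then have e: "eqv n (component n q x vs) (proj_poly (q + sum_list ps) (x vs))"
    by (intro component_homog assms) (auto simp: args_def)
  have "proj_poly r (proj_poly r P) = proj_poly r P" for r P by (metis homog_poly_iff homog_poly_proj_poly)
  then have "eqv n (proj_poly (q + sum_list ps) (x vs)) (proj_poly (q + sum_list ps) (component n q x vs))"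
    using eqv_proj_poly[OF eqv_sym[OF e], of "q + sum_list ps"] by simp
  with e show "eqv n (component n q x vs) (proj_poly (q + sum_list ps) (component n q x vs))" by (rule eqv_trans)
qed

lemma multi_plus:
  assumes "multi n x" "multi n y" shows "multi n (\<lambda>vs. x vs + y vs)"
  unfolding multi_def
proof (intro ballI allI impI)
  fix vs :: "'v list" and i c u w assume "vs \<in> args n" "i < n"
  then show "eqv n (x (vs[i := scale c u + w]) + y (vs[i := scale c u + w]))
     (lconst c \<odot> (x (vs[i := u]) + y (vs[i := u])) + (x (vs[i := w]) + y (vs[i := w])))"
    using eqv_add[OF multi_lin[OF assms(1), of vs i c u w] multi_lin[OF assms(2), of vs i c u w]]
    by (simp add: args_def pact.scale_right_distrib algebra_simps)
qed

lemma component_sum: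
  assumes x: "cochain n x" and "length vs = n"
  shows "eqv n (x vs) (component n q x vs + component n (q + 1) x vs)"
proof (rule multi_homog_ext[OF cochainD(2)[OF x] _ _ assms(2)])
  show "multi n (\<lambda>vs. component n q x vs + component n (q + 1) x vs)"
    by (intro multi_plus cochainD cochain_component x)
  fix ps vs assume a: "length vs = n" "homog ps vs"
  have "proj_poly (q + sum_list ps) (x vs) + proj_poly (q + 1 + sum_list ps) (x vs) = x vs"
    using proj_poly_sum[of "q + sum_list ps" "x vs"] by (simp add: add.commute add.left_commute)
  then show "eqv n (x vs) (component n q x vs + component n (q + 1) x vs)"
    using eqv_add[OF component_homog[OF x a, of q] component_homog[OF x a, of "q + 1"]] by (simp add: eqv_sym)
qed

lemma wadd_mk: "pval n x \<Longrightarrow> pval n y \<Longrightarrow> wadd n (mk n x) (mk n y) = mk n (\<lambda>vs. x vs + y vs)"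
  by (auto simp: wadd_def mk_def fun_eq_iff restrict_def qadd_cls pval_def)

lemma pval_plus: "pval n x \<Longrightarrow> pval n y \<Longrightarrow> pval n (\<lambda>vs. x vs + y vs)"
  by (simp add: pval_def polys_add)

text \<open>\<open>wproj\<close> is a definite description, so uniqueness is needed. On homogeneous
  arguments the projection to the parity expected of \<open>Y\<close> fixes its value and kills that
  of \<open>Z\<close>; multilinearity carries the agreement over to all arguments.\<close>

lemma wproj_eq:
  assumes "X \<in> W n" shows "wproj n q X = mk n (component n q (rp X))"
  unfolding wproj_def
proof (rule the_equality)
  note x = W_E[OF assms]
  note p = cochainD(1)[OF cochain_component[OF x(2)]]
  have "X = wadd n (mk n (component n q (rp X))) (mk n (component n (q + 1) (rp X)))"
    unfolding wadd_mk[OF p p]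
    using x(1) component_sum[OF x(2)]
    by (subst x(1)[symmetric], subst mk_eq_iff) (auto intro: pval_plus p cochainD x simp: args_def)
  then show "mk n (component n q (rp X)) \<in> W_part n q \<and> (\<exists>Z\<in>W_part n (q + 1). X = wadd n (mk n (component n q (rp X))) Z)"
    using mk_W_part_iff cochain_component[OF x(2)] has_parity_component[OF x(2)] by blast
  fix Y assume "Y \<in> W_part n q \<and> (\<exists>Z\<in>W_part n (q + 1). X = wadd n Y Z)"
  then obtain Z where Y: "Y \<in> W_part n q" and Z: "Z \<in> W_part n (q + 1)" and X: "X = wadd n Y Z" by blast
  note y = W_part_E[OF Y] and z = W_part_E[OF Z]
  have "X = mk n (\<lambda>vs. rp Y vs + rp Z vs)"
    using wadd_mk[OF cochainD(1)[OF y(1)] cochainD(1)[OF z(1)]] y(3) z(3) X by simp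
  then have e: "eqv n (rp X vs) (rp Y vs + rp Z vs)" if "length vs = n" for vs
    using rp_mk[OF pval_plus[OF cochainD(1)[OF y(1)] cochainD(1)[OF z(1)]]] that by (simp add: args_def)
  have "mk n (rp Y) = mk n (component n q (rp X))"
    unfolding mk_eq_iff[OF cochainD(1)[OF y(1)] p]
  proof (intro ballI, rule multi_homog_ext[OF cochainD(2)[OF y(1)] cochainD(2)[OF cochain_component[OF x(2)]]])
    fix ps vs assume a: "length vs = n" "homog ps vs"
    let ?r = "q + sum_list ps"
    have r: "q + 1 + sum_list ps = ?r + 1" by (simp add: ac_simps)
    have h: "eqv n (rp Y vs) (proj_poly ?r (rp Y vs))" "eqv n (rp Z vs) (proj_poly (?r + 1) (rp Z vs))"
      using y(2) z(2) a unfolding has_parity_def args_def by (blast, metis (mono_tags, lifting) mem_Collect_eq r)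
    have "proj_poly ?r (proj_poly (?r + 1) P) = 0" for P by (rule proj_poly_other[OF homog_poly_proj_poly bit_neq_add_1])
    then have "eqv n (proj_poly ?r (rp Z vs)) 0" using eqv_proj_poly[OF h(2), of ?r] by simp
    then have "eqv n (proj_poly ?r (rp Y vs) + proj_poly ?r (rp Z vs)) (rp Y vs + 0)"
      by (intro eqv_add eqv_sym[OF h(1)])
    then have "eqv n (proj_poly ?r (rp X vs)) (rp Y vs)"
      using eqv_proj_poly[OF e[OF a(1)], of ?r] unfolding proj_poly_add by (simp add: eqv_trans)
    then show "eqv n (rp Y vs) (component n q (rp X) vs)"
      using component_homog[OF x(2) a, of q] by (meson eqv_sym eqv_trans)
  qed (auto simp: args_def)
  then show "Y = mk n (component n q (rp X))" using y(3) by simp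
qed

section \<open>Eliminating a variable\<close>

text \<open>\<open>elim n i P\<close> substitutes \<open>\<lambda>\<^sub>i = - \<Sum>\<^sub>j\<^sub>\<noteq>\<^sub>i \<lambda>\<^sub>j - \<partial>\<close>, which is a normal form for classes when \<open>i < n\<close>.\<close>

definition osum :: "nat \<Rightarrow> nat \<Rightarrow> 'f lpoly" where "osum n i = (\<Sum>j\<in>{..<n} - {i}. lvar j)"

definition elim_op :: "nat \<Rightarrow> nat \<Rightarrow> 'v lpoly \<Rightarrow> 'v lpoly" where "elim_op n i Q = - (osum n i \<odot> Q) - D_poly Q"

definition elim :: "nat \<Rightarrow> nat \<Rightarrow> 'v lpoly \<Rightarrow> 'v lpoly"
  where "elim n i = ksum (\<lambda>m v. Poly_Mapping.single (Poly_Mapping.update i 0 m) 1 \<odot>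
    (elim_op n i ^^ lk m i) (lconst v))"

lemma elim_op_add: "elim_op n i (P + Q) = elim_op n i P + elim_op n i Q"
  by (simp add: elim_op_def pact.scale_right_distrib D_poly_add)

lemma elim_op_pact: "elim_op n i (f \<odot> P) = f \<odot> elim_op n i P"
  by (simp add: elim_op_def D_poly_pact pact.scale_right_diff_distrib pact.scale_left_commute)

lemma elim_op_pow_add: "(elim_op n i ^^ k) (P + Q) = (elim_op n i ^^ k) P + (elim_op n i ^^ k) Q"
  by (induction k) (simp_all add: elim_op_add)

lemma elim_add: "elim n i (P + Q) = elim n i P + elim n i Q"
  unfolding elim_def by (rule ksum_add) (simp add: lconst_add elim_op_pow_add pact.scale_right_distrib)

lemma update_0_add: "Poly_Mapping.update i 0 (Poly_Mapping.single j 1 + m)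
    = (if j = i then Poly_Mapping.update i 0 m else Poly_Mapping.single j 1 + Poly_Mapping.update i 0 (m :: nat \<Rightarrow>\<^sub>0 nat))"
  by (rule poly_mapping_eqI) (auto simp: lookup_update lookup_add lookup_single when_def)

lemma elim_lconst [simp]: "elim n i (lconst v) = lconst v"
proof -
  have "Poly_Mapping.update i 0 (0 :: nat \<Rightarrow>\<^sub>0 nat) = 0"
    by (rule poly_mapping_eqI) (simp add: lookup_update)
  then show ?thesis
    unfolding elim_def lconst_def[of v]
    by (subst ksum_single) (simp_all add: pact_one, simp add: lconst_def)
qed

lemma elim_lvar: "j \<noteq> i \<Longrightarrow> elim n i (lvar j \<odot> P) = lvar j \<odot> elim n i P"
  unfolding elim_def ksum_lvar_pact update_0_add
  by (simp add: ksum_def pact.scale_sum_right lookup_add lookup_single pact_mult lvar_def mult_single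
      del: One_nat_def)

lemma elim_op_sum: "elim_op n i (sum f A) = (\<Sum>x\<in>A. elim_op n i (f x))"
  by (induction A rule: infinite_finite_induct) (auto simp: elim_op_add, simp_all add: elim_op_def)

lemma elim_lvar_same: "elim n i (lvar i \<odot> P) = elim_op n i (elim n i P)"
  unfolding elim_def ksum_lvar_pact update_0_add
  by (simp add: ksum_def elim_op_sum lookup_add elim_op_pact)

lemma elim_0 [simp]: "elim n i 0 = 0"
  by (simp add: elim_def)

lemma elim_minus: "elim n i (- P) = - elim n i P"
  using elim_add[of n i P "- P"] by (simp add: eq_neg_iff_add_eq_0 add.commute)

lemma elim_diff: "elim n i (P - Q) = elim n i P - elim n i Q"
  using elim_add[of n i "P - Q" Q] by simp

lemma elim_sg: "elim n i (sg p P) = sg p (elim n i P)"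
  by (simp add: sg_def elim_minus)

lemma elim_sum: "elim n i (sum f A) = (\<Sum>x\<in>A. elim n i (f x))"
  by (induction A rule: infinite_finite_induct) (auto simp: elim_add)

lemma elim_op_D_poly: "elim_op n i (D_poly P) = D_poly (elim_op n i P)"
  using D_poly_add[of "- (osum n i \<odot> P)" "- D_poly P"] by (simp add: elim_op_def D_poly_pact D_poly_minus)

lemma elim_D_poly: "elim n i (D_poly P) = D_poly (elim n i P)"
proof (induction P rule: lpoly_induct_all)
  case (lvar j P)
  then show ?case
    by (cases "j = i") (simp_all add: D_poly_pact elim_lvar elim_lvar_same elim_op_D_poly)
qed (simp_all add: D_poly_add elim_add)

lemma elim_lconst_pact: "elim n i (lconst c \<odot> P) = lconst c \<odot> elim n i P"
proof (induction P rule: lpoly_induct_all)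
  case (lvar j P)
  have "elim n i (lvar j \<odot> lconst c \<odot> P) = lconst c \<odot> elim n i (lvar j \<odot> P)"
  proof (cases "j = i")
    case True
    then show ?thesis by (simp only: elim_lvar_same lvar elim_op_pact)
  next
    case False
    show ?thesis by (simp only: elim_lvar[OF False] lvar) (rule pact.scale_left_commute)
  qed
  then show ?case by (simp only: pact.scale_left_commute[of "lconst c" "lvar j"])
qed (simp_all add: pact.scale_right_distrib elim_add)

lemma elim_osum: "(\<And>l. l \<in> A \<Longrightarrow> s l \<noteq> i) \<Longrightarrow>
    elim n i ((\<Sum>l\<in>A. lvar (s l)) \<odot> P) = (\<Sum>l\<in>A. lvar (s l)) \<odot> elim n i P"
  by (simp add: pact.scale_sum_left elim_sum elim_lvar)

lemma lsum_osum: "i < n \<Longrightarrow> lsum n = osum n i + lvar i"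
  by (simp add: osum_def sum.remove[of "{..<n}" i] add.commute)

text \<open>In normal form, multiplication by \<lambda>_i has become \<open>elim_op\<close>, the
  negative of the other terms of the total derivative.\<close>

lemma elim_total_D:
  assumes "i < n" shows "elim n i (total_D n R) = 0"
proof -
  have "elim n i (osum n i \<odot> R) = osum n i \<odot> elim n i R"
    unfolding osum_def by (rule elim_osum) auto
  then show ?thesis
    by (simp add: total_D_def lsum_osum[OF assms] pact.scale_left_distrib elim_add elim_D_poly elim_lvar_same elim_op_def)
qed

lemma eqv_elim:
  assumes "i < n" shows "eqv n P (elim n i P)"
proof (induction P rule: lpoly_induct_all)
  case (add P Q) then show ?case by (simp add: elim_add eqv_add)
next
  case (lvar j P)
  show ?case
  proof (cases "j = i")
    case True
    have "eqv n (lvar i \<odot> P) (lvar i \<odot> elim n i P)" by (rule eqv_pact[OF lvar])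
    also have "eqv n \<dots> (elim_op n i (elim n i P))"
      by (simp add: eqv_def elim_op_def lsum_osum[OF assms] total_D_def pact.scale_left_distrib
          algebra_simps image_iff) (metis add.assoc add.commute)
    finally show ?thesis using True by (simp add: elim_lvar_same)
  next
    case False
    then show ?thesis using eqv_pact[OF lvar] by (simp add: elim_lvar)
  qed
qed simp

lemma elim_eqv: "i < n \<Longrightarrow> eqv n P Q \<Longrightarrow> elim n i P = elim n i Q"
  by (auto simp: eqv_def elim_total_D simp flip: elim_diff) (metis eq_iff_diff_eq_0 elim_diff elim_total_D)

lemma eqv_iff_elim: "i < n \<Longrightarrow> eqv n P Q \<longleftrightarrow> elim n i P = elim n i Q"
  using elim_eqv eqv_elim by (metis eqv_sym eqv_trans)

text \<open>\<open>polys n\<close> can only bound the indices of variables, whereas a normal form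
  may miss one variable in the middle.\<close>

definition polyv :: "nat set \<Rightarrow> 'v lpoly set"
  where "polyv A = {P. \<forall>m\<in>Poly_Mapping.keys P. Poly_Mapping.keys m \<subseteq> A}"

lemma polys_polyv: "polys n = polyv {..<n}"
  by (simp add: polyv_def polys_def)

lemma polyv_add: "P \<in> polyv A \<Longrightarrow> Q \<in> polyv A \<Longrightarrow> P + Q \<in> polyv A"
  using Poly_Mapping.keys_add[of P Q] by (fastforce simp: polyv_def)

lemma polyv_minus: "P \<in> polyv A \<Longrightarrow> - P \<in> polyv A"
  by (simp add: polyv_def in_keys_iff)

lemma polyv_lvar:
  assumes "P \<in> polyv A" "i \<in> A" shows "lvar i \<odot> P \<in> polyv A"
  unfolding polyv_def
proof (intro CollectI ballI)
  fix m assume "m \<in> Poly_Mapping.keys (lvar i \<odot> P)"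
  then obtain m' where m: "m = Poly_Mapping.single i 1 + m'" "m' \<in> Poly_Mapping.keys P"
    unfolding keys_lvar_pact by blast
  have "Poly_Mapping.keys m \<subseteq> Poly_Mapping.keys (Poly_Mapping.single i (1 :: nat)) \<union> Poly_Mapping.keys m'"
    unfolding m(1) by (rule Poly_Mapping.keys_add)
  then show "Poly_Mapping.keys m \<subseteq> A" using m(2) assms by (auto simp: polyv_def)
qed

lemma polyv_sum: "P \<in> polyv A \<Longrightarrow> S \<subseteq> A \<Longrightarrow> (\<Sum>i\<in>S. lvar i) \<odot> P \<in> polyv A"
  by (induction S rule: infinite_finite_induct)
    (auto simp: pact.scale_left_distrib intro: polyv_add polyv_lvar, auto simp: polyv_def)

lemma polyv_D_poly: "P \<in> polyv A \<Longrightarrow> D_poly P \<in> polyv A"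
  by (auto simp: polyv_def in_keys_iff lookup_D_poly)

lemma polyv_lconst: "lconst v \<in> polyv A"
  by (auto simp: polyv_def lconst_def)

lemma elim_polyv: "P \<in> polys n \<Longrightarrow> elim n i P \<in> polyv ({..<n} - {i})"
proof (induction P rule: lpoly_induct)
  case (lvar j P)
  have "elim_op n i (elim n i P) \<in> polyv ({..<n} - {i})"
    using polyv_add[OF polyv_minus[OF polyv_sum[OF lvar.IH order_refl]] polyv_minus[OF polyv_D_poly[OF lvar.IH]]]
    by (simp add: elim_op_def osum_def)
  then show ?case using lvar by (cases "j = i") (auto simp: elim_lvar elim_lvar_same intro: polyv_lvar)
qed (auto simp: polyv_lconst elim_add intro: polyv_add)

lemma elim_last_polys: "P \<in> polys (Suc k) \<Longrightarrow> elim (Suc k) k P \<in> polys k"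
  using elim_polyv[of P "Suc k" k] by (simp add: polys_polyv lessThan_Suc insert_Diff_if)

lemma evl_cong_polyv:
  assumes "P \<in> polyv A" "\<And>j. j \<in> A \<Longrightarrow> \<rho> j = \<rho>' j"
  shows "evl \<rho> g P = evl \<rho>' g P"
  unfolding evl_def
proof (rule ksum_cong)
  fix m assume m: "m \<in> Poly_Mapping.keys P"
  have "(\<Prod>j\<in>Poly_Mapping.keys m. \<rho> j ^ lk m j) = (\<Prod>j\<in>Poly_Mapping.keys m. \<rho>' j ^ lk m j)"
  proof (rule prod.cong)
    fix j assume "j \<in> Poly_Mapping.keys m"
    then have "j \<in> A" using m assms(1) by (auto simp: polyv_def)
    then show "\<rho> j ^ lk m j = \<rho>' j ^ lk m j" by (simp add: assms(2))
  qed simp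
  then show "(\<Prod>j\<in>Poly_Mapping.keys m. \<rho> j ^ lk m j) \<odot> g (lk P m)
      = (\<Prod>j\<in>Poly_Mapping.keys m. \<rho>' j ^ lk m j) \<odot> g (lk P m)" by simp
qed

lemma lsubst_elim_cong:
  "P \<in> polys n \<Longrightarrow> (\<And>j. j < n \<Longrightarrow> j \<noteq> i \<Longrightarrow> \<phi> j = \<psi> j) \<Longrightarrow>
    lsubst \<phi> (elim n i P) = lsubst \<psi> (elim n i P)"
  unfolding lsubst_evl by (rule evl_cong_polyv[OF elim_polyv]) auto

text \<open>Here \<lambda>_i enters only through \<open>\<phi> i0\<close>, which is \<lambda>_i plus
  \<open>f\<close>. As the images of all variables have a prescribed sum, those of the others sum up
  to \<open>osum n i - f\<close>. So eliminating \<lambda>_i after the substitution, or variable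
  \<open>i0\<close> before it, turns \<open>\<phi> i0\<close> into the same operator:
  \<open>f - osum n i\<close> minus the derivation.\<close>

lemma elim_lsubst:
  assumes P: "P \<in> polys a" and i: "i0 < a" "i < n" and sum: "(\<Sum>j<a. \<phi> j) = lsum n"
    and other: "\<And>j Q. j < a \<Longrightarrow> j \<noteq> i0 \<Longrightarrow> elim n i (\<phi> j \<odot> Q) = \<phi> j \<odot> elim n i Q"
    and pivot: "\<phi> i0 = lvar i + f" "\<And>Q. elim n i (f \<odot> Q) = f \<odot> elim n i Q"
  shows "elim n i (lsubst \<phi> P) = lsubst \<phi> (elim a i0 P)"
proof -
  have "(\<Sum>j\<in>{..<a} - {i0}. \<phi> j) + \<phi> i0 = osum n i + lvar i"
    using sum lsum_osum[OF i(2)] i(1) by (simp add: sum.remove[of "{..<a}" i0] add.commute)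
  then have o: "(\<Sum>j\<in>{..<a} - {i0}. \<phi> j) = osum n i - f"
    by (simp add: pivot(1) algebra_simps)
  have l: "lsubst \<phi> (osum a i0 \<odot> Q) = (osum n i - f) \<odot> lsubst \<phi> Q" for Q
    using lsubst_pact_sum[of \<phi> "\<lambda>l. l" "{..<a} - {i0}" Q] o by (simp add: osum_def)
  have m: "lsubst \<phi> (- Q) = - lsubst \<phi> Q" for Q using lsubst_diff[of \<phi> 0 Q] by simp
  show ?thesis using P
  proof (induction P rule: lpoly_induct)
    case (lvar j P)
    show ?case
    proof (cases "j = i0")
      case True
      have "elim n i (\<phi> i0 \<odot> lsubst \<phi> P) = elim_op n i (elim n i (lsubst \<phi> P)) + f \<odot> elim n i (lsubst \<phi> P)"
        by (simp add: pivot pact.scale_left_distrib elim_add elim_lvar_same)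
      also have "\<dots> = lsubst \<phi> (elim_op a i0 (elim a i0 P))"
        by (simp add: lvar.IH elim_op_def lsubst_diff m l lsubst_D_poly pact.scale_left_diff_distrib algebra_simps)
      finally show ?thesis using True by (simp add: lsubst_lvar elim_lvar_same)
    next
      case False
      then show ?thesis using lvar by (simp add: lsubst_lvar elim_lvar other)
    qed
  qed (simp_all add: lsubst_add elim_add)
qed

lemma elim_evl:
  assumes "P \<in> polys b" "\<And>j. j < b \<Longrightarrow> s j \<noteq> i"
  shows "elim n i (evl (\<lambda>j. lvar (s j)) g P) = evl (\<lambda>j. lvar (s j)) (\<lambda>v. elim n i (g v)) P"
proof -
  have pow: "elim n i (lvar l ^ m \<odot> Q) = lvar l ^ m \<odot> elim n i Q" if "l \<noteq> i" for l m Q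
    by (induction m) (auto simp: pact_one elim_lvar that simp flip: pact_mult)
  have prod: "elim n i ((\<Prod>j\<in>A. lvar (s j) ^ k j) \<odot> Q) = (\<Prod>j\<in>A. lvar (s j) ^ k j) \<odot> elim n i Q"
    if "\<And>j. j \<in> A \<Longrightarrow> s j \<noteq> i" for A k Q
    using that
    by (induction A rule: infinite_finite_induct) (auto simp: pact_one pow simp flip: pact_mult)
  show ?thesis unfolding evl_def ksum_def elim_sum
    by (intro sum.cong refl prod) (use assms in \<open>auto simp: polys_def\<close>)
qed

lemma proj_poly_elim: "proj_poly q (elim n i P) = elim n i (proj_poly q P)"
proof (induction P rule: lpoly_induct_all)
  case (lvar j P)
  have "proj_poly q (elim_op n i Q) = elim_op n i (proj_poly q Q)" for Q
    by (simp add: elim_op_def proj_poly_diff proj_poly_minus osum_def proj_poly_lvar_sum proj_poly_D_poly)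
  then show ?case using lvar by (cases "j = i") (simp_all add: elim_lvar elim_lvar_same proj_poly_lvar)
qed (simp_all add: proj_poly_add elim_add)

end

context diff_supermodule
begin

lemma to_end_perm: "i < n \<Longrightarrow> to_end n i \<in> perms n"
  by (auto simp: permutations_of_set_def)

lemma to_end_nth:
  assumes "i < Suc k"
  shows "to_end (Suc k) i ! k = i" "j < k \<Longrightarrow> to_end (Suc k) i ! j = (if j < i then j else Suc j)"
  using assms by (auto simp: nth_append)

lemma map_to_end:
  assumes "length vs = n" "i < n"
  shows "map ((!) vs) (to_end n i) = take i vs @ drop (Suc i) vs @ [vs ! i]"
  using assms by (simp add: take_map[symmetric] map_nth take_upt flip: drop_map)
    (metis (no_types) assms drop_map drop_upt map_nth take_map take_upt add.left_neutral less_imp_le)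

text \<open>The cycle renames the last variable to \<lambda>_i, so after symmetry has been applied
  the elimination of \<lambda>_i becomes that of the last variable.\<close>

lemma elim_to_end:
  assumes x: "cochain (Suc k) x" and i: "i < Suc k" and vs: "length vs = Suc k" "homog qs vs"
  shows "elim (Suc k) i (x vs) = sg (qs ! i * (\<Sum>j\<in>{Suc i..<Suc k}. qs ! j))
    (lsubst (\<lambda>j. lvar (to_end (Suc k) i ! j)) (elim (Suc k) k (x (take i vs @ drop (Suc i) vs @ [vs ! i]))))"
proof -
  let ?\<tau> = "to_end (Suc k) i" and ?vs = "take i vs @ drop (Suc i) vs @ [vs ! i]"
  have "eqv (Suc k) (x vs) (sg (epar qs ?\<tau>) (lsubst (\<lambda>j. lvar (?\<tau> ! j)) (x ?vs)))"
    using sym_onD[OF cochainD(4)[OF x] vs to_end_perm[OF i]] by (simp only: map_to_end[OF vs(1) i])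
  then have "elim (Suc k) i (x vs) = sg (epar qs ?\<tau>) (elim (Suc k) i (lsubst (\<lambda>j. lvar (?\<tau> ! j)) (x ?vs)))"
    by (simp add: elim_eqv[OF i] elim_sg)
  also have "elim (Suc k) i (lsubst (\<lambda>j. lvar (?\<tau> ! j)) (x ?vs))
      = lsubst (\<lambda>j. lvar (?\<tau> ! j)) (elim (Suc k) k (x ?vs))"
  proof (rule elim_lsubst[where f = 0])
    show "x ?vs \<in> polys (Suc k)" using cochainD(1)[OF x] vs(1) i by (intro pvalD) auto
    show "(\<Sum>j<Suc k. lvar (?\<tau> ! j)) = lsum (Suc k)" by (rule lsum_perm[OF to_end_perm[OF i]])
    show "lvar (?\<tau> ! k) = lvar i + 0" using to_end_nth(1)[OF i] by simp
    fix j Q assume "j < Suc k" "j \<noteq> k"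
    then have "?\<tau> ! j \<noteq> i" using to_end_nth(2)[OF i, of j] by simp
    then show "elim (Suc k) i (lvar (?\<tau> ! j) \<odot> Q) = lvar (?\<tau> ! j) \<odot> elim (Suc k) i Q"
      by (rule elim_lvar)
  qed (use i in auto)
  finally show ?thesis by (simp only: epar_to_end)
qed

lemma elim_id:
  assumes "P \<in> polyv A" "i \<notin> A" shows "elim n i P = P"
proof -
  have "elim n i P = (\<Sum>m\<in>Poly_Mapping.keys P. Poly_Mapping.single m (lk P m))"
    unfolding elim_def ksum_def
  proof (rule sum.cong)
    fix m assume "m \<in> Poly_Mapping.keys P"
    then have "i \<notin> Poly_Mapping.keys m" using assms by (auto simp: polyv_def)
    then have "lk m i = 0" by (simp add: in_keys_iff)
    moreover from this have "Poly_Mapping.update i 0 m = m"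
      by (intro poly_mapping_eqI) (auto simp: lookup_update)
    ultimately show "Poly_Mapping.single (Poly_Mapping.update i 0 m) 1 \<odot> (elim_op n i ^^ lk m i) (lconst (lk P m))
        = Poly_Mapping.single m (lk P m)"
      by (simp add: lconst_def pact_single)
  qed simp
  then show ?thesis by (simp add: single_sum)
qed

end

section \<open>The Leibniz rule\<close>

context comm_diff_superalgebra
begin

lemma pact_mult_left: "(f \<odot> P) * (Q :: 'v lpoly) = f \<odot> (P * Q)"
proof (induction P rule: lpoly_single_induct)
  case (single m)
  show ?case
  proof (induction Q rule: lpoly_single_induct)
    case (single k)
    show ?case
      by (induction f rule: lpoly_single_induct)
        (simp_all add: pact.scale_left_distrib distrib_right pact_single mult_single add.assoc scale_mult_left)
  qed (simp_all add: distrib_left pact.scale_right_distrib)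
qed (simp_all add: distrib_right pact.scale_right_distrib)

lemma pact_mult_right: "P * (f \<odot> Q :: 'v lpoly) = f \<odot> (P * Q)"
proof (induction P rule: lpoly_single_induct)
  case (single m)
  show ?case
  proof (induction Q rule: lpoly_single_induct)
    case (single k)
    show ?case
      by (induction f rule: lpoly_single_induct)
        (simp_all add: pact.scale_left_distrib distrib_left pact_single mult_single add.left_commute scale_mult_right)
  qed (simp_all add: distrib_left pact.scale_right_distrib)
qed (simp_all add: distrib_right pact.scale_right_distrib)

lemma D_poly_mult: "D_poly (P * Q) = D_poly P * Q + P * D_poly Q"
proof (induction P rule: lpoly_induct_all)
  case (const v)
  show ?case
  proof (induction Q rule: lpoly_induct_all)
    case (const w) show ?case by (simp add: D_mult lconst_add flip: lconst_mult)
  qed (simp_all add: distrib_left D_poly_add D_poly_pact pact_mult_right pact.scale_right_distrib algebra_simps)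
qed (simp_all add: distrib_right D_poly_add D_poly_pact pact_mult_left pact.scale_right_distrib algebra_simps)

lemma lookup_mult_lconst: "lk (P * lconst c) m = lk P m * (c :: 'v)"
proof (induction P rule: lpoly_single_induct)
  case (single k) show ?case by (simp add: lconst_def mult_single lookup_single when_def)
qed (simp_all add: distrib_right lookup_add)

lemma lsubst_mult_lconst: "lsubst \<phi> (P * lconst c) = lsubst \<phi> P * lconst c"
  by (induction P rule: lpoly_induct_all)
    (simp_all add: distrib_right lsubst_add pact_mult_left lsubst_lvar flip: lconst_mult)

lemma sg_mult_left: "sg p P * (Q :: 'v lpoly) = sg p (P * Q)" and
  sg_mult_right: "P * sg p Q = sg p (P * Q)"
  by (simp_all add: sg_def)

lemma polyv_mult_lconst: "P \<in> polyv A \<Longrightarrow> P * lconst c \<in> polyv A"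
  unfolding polyv_def by (force simp: in_keys_iff lookup_mult_lconst)

text \<open>The induction over \<open>P\<close> replaces the constant on the right by its image
  under \<lambda>_i + \<partial>, which is a polynomial; hence a polynomial is allowed there from
  the start.\<close>

definition arrow_poly :: "nat \<Rightarrow> 'v lpoly \<Rightarrow> 'v lpoly \<Rightarrow> 'v lpoly"
  where "arrow_poly i P Q = ksum (\<lambda>m v. Poly_Mapping.single (Poly_Mapping.update i 0 m) 1 \<odot>
    (lconst v * (lam_D i ^^ lk m i) Q)) P"

lemma arrow_arrow_poly: "arrow i P c = arrow_poly i P (lconst c)"
  unfolding arrow_def arrow_poly_def ksum_def mult_map_scale_conv_mult lconst_def ..

lemma arrow_poly_add: "arrow_poly i (P + P') Q = arrow_poly i P Q + arrow_poly i P' Q"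
  unfolding arrow_poly_def by (rule ksum_add) (simp add: lconst_add distrib_right pact.scale_right_distrib)

lemma arrow_poly_lconst: "arrow_poly i (lconst v) Q = lconst v * Q"
proof -
  have "Poly_Mapping.update i 0 (0 :: nat \<Rightarrow>\<^sub>0 nat) = 0"
    by (rule poly_mapping_eqI) (simp add: lookup_update)
  then show ?thesis unfolding arrow_poly_def lconst_def[of v]
    by (subst ksum_single) (simp_all add: pact_one, simp add: lconst_def)
qed

lemma arrow_poly_lvar: "j \<noteq> i \<Longrightarrow> arrow_poly i (lvar j \<odot> P) Q = lvar j \<odot> arrow_poly i P Q"
  unfolding arrow_poly_def ksum_lvar_pact update_0_add
  by (simp add: ksum_def pact.scale_sum_right lookup_add lookup_single pact_mult lvar_def mult_single
      del: One_nat_def)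

lemma arrow_poly_lvar_same: "arrow_poly i (lvar i \<odot> P) Q = arrow_poly i P (lam_D i Q)"
  unfolding arrow_poly_def ksum_lvar_pact update_0_add
  by (simp add: ksum_def lookup_add funpow_swap1)

lemma polys_arrow_poly: "P \<in> polys n \<Longrightarrow> i < n \<Longrightarrow> Q \<in> polys n \<Longrightarrow> arrow_poly i P Q \<in> polys n"
proof (induction P arbitrary: Q rule: lpoly_induct)
  case (const v)
  have "lconst v * Q \<in> polys n"
    using const(2) unfolding lconst_def mult_map_scale_conv_mult[symmetric] by (intro polys_map) auto
  then show ?case by (simp add: arrow_poly_lconst)
next
  case (add P P') then show ?case by (simp add: arrow_poly_add polys_add)
next
  case (lvar j P)
  have "lam_D i Q \<in> polys n"
    using lvar.prems polys_add[OF polys_pact[OF polys_lvar] polys_D_poly] by (simp add: lam_D_def D_poly_def)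
  with lvar show ?case
    by (cases "j = i") (simp_all add: arrow_poly_lvar arrow_poly_lvar_same polys_pact polys_lvar)
qed

text \<open>In the step for \<lambda>_i the derivation acts on \<open>Q\<close> through the arrow
  and, with the opposite sign, on the whole product through the elimination. By the product rule
  only its action on the normal form of \<open>P\<close> is left, and this is \<open>elim_op\<close>
  there.\<close>

lemma elim_arrow_poly: "i < n \<Longrightarrow> elim n i (arrow_poly i P Q) = elim n i (elim n i P * Q)"
proof (induction P arbitrary: Q rule: lpoly_induct_all)
  case (const v) show ?case by (simp add: arrow_poly_lconst)
next
  case (add P P') then show ?case by (simp add: arrow_poly_add elim_add distrib_right)
next
  case (lvar j P)
  show ?case
  proof (cases "j = i")
    case True
    let ?E = "elim n i P"
    have o: "elim n i (osum n i \<odot> R) = osum n i \<odot> elim n i R" for R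
      unfolding osum_def by (rule elim_osum) auto
    have "elim n i (arrow_poly i (lvar i \<odot> P) Q) = elim n i (?E * (lvar i \<odot> Q + D_poly Q))"
      by (simp add: arrow_poly_lvar_same lvar lam_D_def D_poly_def)
    also have "\<dots> = elim_op n i (elim n i (?E * Q)) + elim n i (?E * D_poly Q)"
      by (simp add: distrib_left elim_add pact_mult_right elim_lvar_same)
    also have "\<dots> = elim n i (elim_op n i ?E * Q)"
      by (simp add: elim_op_def left_diff_distrib pact_mult_left elim_diff elim_minus elim_add o D_poly_mult
          flip: elim_D_poly)
    finally show ?thesis using True by (simp add: elim_lvar_same)
  next
    case False
    then show ?thesis using lvar by (simp add: arrow_poly_lvar elim_lvar pact_mult_left)
  qed
qed

text \<open>On classes the arrow substitution is right multiplication of the normal form obtained by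
  eliminating \<open>\<lambda>\<^sub>i\<close>, because \<open>\<lambda>\<^sub>i + \<partial>\<^sub>c = - \<Sum>\<^sub>j\<^sub>\<noteq>\<^sub>i \<lambda>\<^sub>j - \<partial>\<^sub>P\<close> there.\<close>

lemma elim_arrow: "P \<in> polys n \<Longrightarrow> i < n \<Longrightarrow> elim n i (arrow i P c) = elim n i P * lconst c"
  unfolding arrow_arrow_poly elim_arrow_poly by (rule elim_id[OF polyv_mult_lconst[OF elim_polyv]]) auto

lemma polys_arrow: "P \<in> polys n \<Longrightarrow> i < n \<Longrightarrow> arrow i P c \<in> polys n"
  unfolding arrow_arrow_poly by (rule polys_arrow_poly) auto

lemma qarrow_cls:
  assumes "P \<in> polys n" "i < n" shows "qarrow n i (cls n P) c = cls n (arrow i P c)"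
proof -
  have "eqv n (arrow i (rep (cls n P)) c) (arrow i P c)"
    unfolding eqv_iff_elim[OF assms(2)] using assms rep_cls[OF assms(1)]
    by (simp add: elim_arrow elim_eqv)
  then show ?thesis unfolding qarrow_def
    using assms rep_cls[OF assms(1)] by (simp add: cls_eq_iff polys_arrow)
qed

text \<open>Counted with the parities of \<open>\<Pi>\<V>\<close>, the exponent \<open>s\<^bsub>i+1,k\<^esub> + k - i\<close> is the plain sum of the parities
  of the later arguments.\<close>

definition leibniz_poly :: "nat \<Rightarrow> ('v list \<Rightarrow> 'v lpoly) \<Rightarrow> bool"
  where "leibniz_poly n x \<longleftrightarrow> (\<forall>vs\<in>args n. \<forall>qs i b c pb pc. Pi.homog qs vs \<and> i < n \<and> b \<in> G pb \<and> c \<in> G pc \<longrightarrow>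
    (let t = (\<Sum>j\<in>{Suc i..<n}. qs ! j) in
      elim n i (x (vs[i := b * c])) = sg (pc * t) (elim n i (x (vs[i := b])) * lconst c)
        + sg (pb * (pc + t)) (elim n i (x (vs[i := c])) * lconst b)))"

lemma homog_rev: "homog ps vs \<longleftrightarrow> Pi.homog (map (\<lambda>p. p + 1) ps) vs"
proof -
  have "p + 1 + 1 = p" for p :: bit by (simp add: add.assoc)
  then show ?thesis
    by (simp add: homog_def Pi.homog_def rev_parity_def list_all2_map1)
qed

lemma leibniz_mk_iff:
  assumes x: "pval n x" shows "leibniz n (mk n x) \<longleftrightarrow> leibniz_poly n x"
proof -
  have p: "x vs \<in> polys n" if "vs \<in> args n" for vs using x that by (simp add: pval_def)
  have eq: "mk n x (vs[i := b * c]) = qadd n (qscale n (psign s) (qarrow n i (mk n x (vs[i := b])) c))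
        (qscale n (psign s') (qarrow n i (mk n x (vs[i := c])) b)) \<longleftrightarrow>
      elim n i (x (vs[i := b * c])) = sg s (elim n i (x (vs[i := b])) * lconst c)
        + sg s' (elim n i (x (vs[i := c])) * lconst b)"
    if "vs \<in> args n" "i < n" for vs i b c s s'
    using that p
    by (simp add: mk_def qarrow_cls polys_arrow qscale_cls polys_pact qadd_cls polys_add psign_pact
        polys_sg cls_eq_iff eqv_iff_elim elim_add elim_sg elim_arrow)
  have t: "(\<Sum>j\<in>{i + 1..<n}. ps ! j) + of_nat (n - 1 - i) = (\<Sum>j\<in>{Suc i..<n}. map (\<lambda>p. p + 1) ps ! j)"
    if "length ps = n" "i < n" for ps :: "bit list" and i
  proof -
    have "(\<Sum>j\<in>{Suc i..<n}. map (\<lambda>p. p + 1) ps ! j) = (\<Sum>j\<in>{Suc i..<n}. ps ! j + 1)"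
      using that by (intro sum.cong) auto
    then show ?thesis by (simp add: sum.distrib)
  qed
  have len: "length ps = n" if "homog ps vs" "vs \<in> args n" for ps vs
    using homog_length[OF that(1)] that(2) by (simp add: args_def)
  show ?thesis
  proof
    assume L: "leibniz n (mk n x)"
    show "leibniz_poly n x" unfolding leibniz_poly_def Let_def
    proof (intro ballI allI impI, elim conjE)
      fix vs qs i b c pb pc
      assume a: "vs \<in> args n" "Pi.homog qs vs" "i < n" "b \<in> G pb" "c \<in> G pc"
      let ?ps = "map (\<lambda>p. p + 1) qs"
      have qs: "map (\<lambda>p. p + 1) ?ps = qs" by (simp add: comp_def add.assoc)
      have h: "homog ?ps vs" unfolding homog_rev qs by (rule a(2))
      show "elim n i (x (vs[i := b * c])) = sg (pc * (\<Sum>j\<in>{Suc i..<n}. qs ! j)) (elim n i (x (vs[i := b])) * lconst c)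
        + sg (pb * (pc + (\<Sum>j\<in>{Suc i..<n}. qs ! j))) (elim n i (x (vs[i := c])) * lconst b)"
        using L a h t[OF len[OF h a(1)] a(3)] unfolding leibniz_def Let_def eq[OF a(1,3), symmetric] qs by metis
    qed
  next
    assume L: "leibniz_poly n x"
    show "leibniz n (mk n x)" unfolding leibniz_def Let_def
    proof (intro ballI allI impI, elim conjE)
      fix vs ps i b c pb pc
      assume a: "vs \<in> args n" "homog ps vs" "i < n" "b \<in> G pb" "c \<in> G pc"
      show "mk n x (vs[i := b * c]) = qadd n
         (qscale n (psign (pc * ((\<Sum>j\<in>{i + 1..<n}. ps ! j) + of_nat (n - 1 - i)))) (qarrow n i (mk n x (vs[i := b])) c))
         (qscale n (psign (pb * (pc + ((\<Sum>j\<in>{i + 1..<n}. ps ! j) + of_nat (n - 1 - i))))) (qarrow n i (mk n x (vs[i := c])) b))"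
        using L a unfolding leibniz_poly_def Let_def eq[OF a(1,3)] t[OF len[OF a(2,1)] a(3)] homog_rev by blast
    qed
  qed
qed

lemma leibniz_polyD:
  "leibniz_poly n x \<Longrightarrow> length vs = n \<Longrightarrow> Pi.homog qs vs \<Longrightarrow> i < n \<Longrightarrow> b \<in> G pb \<Longrightarrow> c \<in> G pc \<Longrightarrow>
    elim n i (x (vs[i := b * c])) = sg (pc * (\<Sum>j\<in>{Suc i..<n}. qs ! j)) (elim n i (x (vs[i := b])) * lconst c)
      + sg (pb * (pc + (\<Sum>j\<in>{Suc i..<n}. qs ! j))) (elim n i (x (vs[i := c])) * lconst b)"
  unfolding leibniz_poly_def Let_def by (simp add: args_def)

lemma Was_mk: "pval n x \<Longrightarrow> mk n x \<in> Was n \<longleftrightarrow> Pi.cochain n x \<and> leibniz_poly n x"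
  by (simp add: Was_def Pi.mk_in_W_iff leibniz_mk_iff)

lemma Was_E: "X \<in> Was n \<Longrightarrow> Pi.cochain n (rp X)" "X \<in> Was n \<Longrightarrow> leibniz_poly n (rp X)" "X \<in> Was n \<Longrightarrow> mk n (rp X) = X"
  using Pi.W_E[of X n] leibniz_mk_iff[of n "rp X"] Pi.cochainD(1)[of n "rp X"] by (auto simp: Was_def)

lemma Was_W: "X \<in> Was n \<Longrightarrow> X \<in> Pi.W n"
  by (simp add: Was_def)

definition leibniz_poly_last :: "nat \<Rightarrow> ('v list \<Rightarrow> 'v lpoly) \<Rightarrow> bool"
  where "leibniz_poly_last k x \<longleftrightarrow> (\<forall>vs qs b c pb pc. length vs = k \<and> Pi.homog qs vs \<and> b \<in> G pb \<and> c \<in> G pc \<longrightarrow>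
    elim (Suc k) k (x (vs @ [b * c])) = elim (Suc k) k (x (vs @ [b])) * lconst c
      + sg (pb * pc) (elim (Suc k) k (x (vs @ [c])) * lconst b))"

lemma leibniz_poly_lastD:
  "leibniz_poly_last k x \<Longrightarrow> length vs = k \<Longrightarrow> Pi.homog qs vs \<Longrightarrow> b \<in> G pb \<Longrightarrow> c \<in> G pc \<Longrightarrow>
    elim (Suc k) k (x (vs @ [b * c])) = elim (Suc k) k (x (vs @ [b])) * lconst c
      + sg (pb * pc) (elim (Suc k) k (x (vs @ [c])) * lconst b)"
  unfolding leibniz_poly_last_def by blast

text \<open>Moving the \<open>i\<close>-th argument to the end costs a sign and a renaming of
  variables, and the renaming commutes with multiplication by constants.\<close>

lemma leibniz_poly_last_imp:
  assumes x: "Pi.cochain (Suc k) x" and L: "leibniz_poly_last k x"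
  shows "leibniz_poly (Suc k) x"
  unfolding leibniz_poly_def Let_def
proof (intro ballI allI impI, elim conjE)
  fix vs qs i b c pb pc
  assume "vs \<in> args (Suc k)" and h: "Pi.homog qs vs" and i: "i < Suc k" and b: "b \<in> G pb" and c: "c \<in> G pc"
  then have vs: "length vs = Suc k" by (simp add: args_def)
  define t where "t = (\<Sum>j\<in>{Suc i..<Suc k}. qs ! j)"
  define L where "L = lsubst (\<lambda>j. lvar (to_end (Suc k) i ! j))"
  let ?w = "take i vs @ drop (Suc i) vs" and ?qw = "take i qs @ drop (Suc i) qs"
  have e: "elim (Suc k) i (x (vs[i := u])) = sg ((pu + 1) * t) (L (elim (Suc k) k (x (?w @ [u]))))"
    if "u \<in> G pu" for u pu
  proof -
    have "Pi.homog (qs[i := pu + 1]) (vs[i := u])"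
      using h that by (simp add: Pi.homog_def list_all2_update_cong rev_parity_def add.assoc)
    note e = Pi.elim_to_end[OF x i _ this, folded L_def]
    have "(\<Sum>j\<in>{Suc i..<Suc k}. qs[i := pu + 1] ! j) = t"
      unfolding t_def by (rule sum.cong) auto
    then show ?thesis
      using e vs i Pi.homog_length[OF h] by (simp add: take_update_cancel drop_update_cancel del: sum.op_ivl_Suc upt_Suc)
  qed
  have hw: "Pi.homog ?qw ?w" using h unfolding Pi.homog_def
    by (intro list_all2_appendI list_all2_takeI list_all2_dropI)
  have "length ?w = k" using vs i by simp
  then have l: "elim (Suc k) k (x (?w @ [b * c])) = elim (Suc k) k (x (?w @ [b])) * lconst c
      + sg (pb * pc) (elim (Suc k) k (x (?w @ [c])) * lconst b)"
    by (rule leibniz_poly_lastD[OF assms(2) _ hw b c])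
  \<comment> \<open>An element of parity \<open>p\<close> in V counts as \<open>p + 1\<close> when
    it is moved past the later arguments, be it \<open>b * c\<close>, \<open>b\<close> or
    \<open>c\<close>. The two identities turn these signs into those of the Leibniz rule.\<close>
  have s1: "(pb + pc + 1) * t = pc * t + (pb + 1) * t" by (simp add: algebra_simps)
  have s2: "pc * t + (pb + 1) * t + pb * pc = pb * (pc + t) + (pc + 1) * t" by (simp add: algebra_simps)
  have "elim (Suc k) i (x (vs[i := b * c])) = sg (pc * t) (elim (Suc k) i (x (vs[i := b])) * lconst c)
      + sg (pb * (pc + t)) (elim (Suc k) i (x (vs[i := c])) * lconst b)"
    unfolding e[OF mult_G[OF b c]] e[OF b] e[OF c] l
    by (simp add: lsubst_add[of "\<lambda>j. lvar (to_end (Suc k) i ! j)", folded L_def]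
      lsubst_sg[of "\<lambda>j. lvar (to_end (Suc k) i ! j)", folded L_def]
      lsubst_mult_lconst[of "\<lambda>j. lvar (to_end (Suc k) i ! j)", folded L_def] sg_add sg_mult_left s1 s2)
  then show "elim (Suc k) i (x (vs[i := b * c]))
      = sg (pc * (\<Sum>j\<in>{Suc i..<Suc k}. qs ! j)) (elim (Suc k) i (x (vs[i := b])) * lconst c)
      + sg (pb * (pc + (\<Sum>j\<in>{Suc i..<Suc k}. qs ! j))) (elim (Suc k) i (x (vs[i := c])) * lconst b)"
    unfolding t_def .
qed

end

section \<open>The Leibniz rule for the bracket\<close>

lemma sg_diff: "sg p (x - y) = sg p x - sg p y"
  by (simp add: sg_def)

lemma perms_distinct: "\<tau> \<in> perms n \<Longrightarrow> distinct \<tau>" and perms_set: "\<tau> \<in> perms n \<Longrightarrow> set \<tau> = {..<n}"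
  by (auto dest: permutations_of_setD)

lemma (in diff_supermodule) has_parityD:
  "has_parity n q x \<Longrightarrow> length vs = n \<Longrightarrow> homog ps vs \<Longrightarrow> eqv n (x vs) (proj_poly (q + sum_list ps) (x vs))"
  by (simp add: has_parity_def args_def)

context comm_diff_superalgebra
begin

lemma homog_poly_supercomm:
  assumes "homog_poly p P" "homog_poly q Q" shows "P * Q = sg (p * q) (Q * P)"
proof -
  let ?s = "Poly_Mapping.single"
  have "P * Q = (\<Sum>m\<in>Poly_Mapping.keys P. ?s m (lk P m)) * (\<Sum>l\<in>Poly_Mapping.keys Q. ?s l (lk Q l))"
    by (simp add: single_sum)
  also have "\<dots> = (\<Sum>m\<in>Poly_Mapping.keys P. \<Sum>l\<in>Poly_Mapping.keys Q. ?s (m + l) (lk P m * lk Q l))"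
    by (simp add: sum_product mult_single)
  also have "\<dots> = (\<Sum>m\<in>Poly_Mapping.keys P. \<Sum>l\<in>Poly_Mapping.keys Q. sg (p * q) (?s (l + m) (lk Q l * lk P m)))"
  proof (intro sum.cong refl)
    fix m l
    have "lk P m * lk Q l = sg (p * q) (lk Q l * lk P m)"
      using supercomm[of "lk P m" p "lk Q l" q] assms by (simp add: homog_poly_def psign_scale)
    then show "?s (m + l) (lk P m * lk Q l) = sg (p * q) (?s (l + m) (lk Q l * lk P m))"
      by (simp add: sg_def single_uminus add.commute)
  qed
  also have "\<dots> = sg (p * q) (\<Sum>l\<in>Poly_Mapping.keys Q. \<Sum>m\<in>Poly_Mapping.keys P. ?s (l + m) (lk Q l * lk P m))"
    by (simp add: sg_sum) (rule sum.swap)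
  also have "(\<Sum>l\<in>Poly_Mapping.keys Q. \<Sum>m\<in>Poly_Mapping.keys P. ?s (l + m) (lk Q l * lk P m)) =
      (\<Sum>m\<in>Poly_Mapping.keys Q. ?s m (lk Q m)) * (\<Sum>l\<in>Poly_Mapping.keys P. ?s l (lk P l))"
    by (simp add: sum_product mult_single)
  finally show ?thesis by (simp add: single_sum)
qed

lemma evl_mult_right: "evl \<rho> (\<lambda>v. g v * Q) P = evl \<rho> g P * Q"
  by (simp add: evl_def ksum_def sum_distrib_right pact_mult_left)

lemma evl_mult_left: "evl \<rho> (\<lambda>v. Q * g v) P = Q * evl \<rho> g P"
  by (simp add: evl_def ksum_def sum_distrib_left pact_mult_right)

lemma evl_comp_mult_lconst:
  assumes "\<And>u v. g (u + v) = g u + g v"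
  shows "evl \<rho> g (P * lconst c) = evl \<rho> (\<lambda>v. g (v * c)) P"
proof (induction P rule: lpoly_induct_all)
  case (const v)
  have "g 0 = 0" using assms[of 0 0] by simp
  then show ?case by (simp add: evl_lconst flip: lconst_mult)
next
  case (add P Q)
  then show ?case by (simp add: distrib_right evl_add assms)
next
  case (lvar i P)
  then show ?case by (simp add: pact_mult_left evl_lvar)
qed

lemma Pi_homog_poly_rev: "Pi.homog_poly (p + 1) P \<longleftrightarrow> homog_poly p P"
  by (simp add: Pi.homog_poly_def homog_poly_def rev_parity_def add.assoc)

lemma elim_multi_add:
  assumes "multi n x" "i < n" "length vs = n" "j < n"
  shows "elim n i (x (vs[j := u + v])) = elim n i (x (vs[j := u])) + elim n i (x (vs[j := v]))"
  using elim_eqv[OF assms(2) multi_add[OF assms(1,3,4), of u v]] by (simp add: elim_add)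

text \<open>At the last position the signs do not involve the other arguments, so one of them need not be
  homogeneous.\<close>

lemma leibniz_poly_last_any_head:
  assumes x: "Pi.cochain (Suc (Suc m)) x" "leibniz_poly (Suc (Suc m)) x"
    and w: "length w = m" "Pi.homog qs w" and c: "c \<in> G pc" and d: "d \<in> G pd"
  shows "elim (Suc (Suc m)) (Suc m) (x (v # w @ [c * d])) =
    elim (Suc (Suc m)) (Suc m) (x (v # w @ [c])) * lconst d
      + sg (pc * pd) (elim (Suc (Suc m)) (Suc m) (x (v # w @ [d])) * lconst c)"
proof -
  let ?e = "\<lambda>v u. elim (Suc (Suc m)) (Suc m) (x (v # w @ [u]))"
  have h: "?e v (c * d) = ?e v c * lconst d + sg (pc * pd) (?e v d * lconst c)" if "v \<in> rev_parity G p" for v p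
  proof -
    have "Pi.homog (p # qs @ [0]) (v # w @ [0])"
      using w(2) that by (simp add: Pi.homog_def list_all2_appendI)
    from leibniz_polyD[OF x(2) _ this _ c d, of "Suc m"] w show ?thesis
      by (simp add: list_update_append mult.commute)
  qed
  have s: "?e v u = ?e (Pi.proj 0 v) u + ?e (Pi.proj 1 v) u" for u
    using elim_multi_add[OF Pi.cochainD(2)[OF x(1)], of "Suc m" "0 # w @ [u]" 0 "Pi.proj 0 v" "Pi.proj 1 v"]
      Pi.proj_sum[of 0 v] w(1) by simp
  show ?thesis unfolding s[of "c * d"] s[of c] s[of d] h[OF Pi.proj_G]
    by (simp add: distrib_right sg_add)
qed

lemma leibniz_poly_imp_last:
  assumes "leibniz_poly (Suc k) x" shows "leibniz_poly_last k x"
  unfolding leibniz_poly_last_def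
proof (intro allI impI, elim conjE)
  fix vs qs b c pb pc
  assume vs: "length vs = k" and h: "Pi.homog qs vs" and b: "b \<in> G pb" and c: "c \<in> G pc"
  have "Pi.homog (qs @ [0]) (vs @ [0])" using h by (simp add: Pi.homog_def list_all2_appendI)
  from leibniz_polyD[OF assms _ this _ b c, of k] vs
  show "elim (Suc k) k (x (vs @ [b * c])) = elim (Suc k) k (x (vs @ [b])) * lconst c
      + sg (pb * pc) (elim (Suc k) k (x (vs @ [c])) * lconst b)"
    by (simp add: list_update_append mult.commute)
qed

text \<open>The index \<open>k\<close> sits in the last slot of the outer map, and neither the inner
  variables nor the other slots involve \<lambda>_k. Its elimination is thus that of the last
  variable of \<open>x\<close>, and the Leibniz rule of \<open>x\<close> applies to each coefficient
  of the inner value separately.\<close>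

lemma elim_box_summand_outer:
  assumes i: "I @ J @ [k] \<in> perms (Suc k)" "length I = b" "Suc (Suc (length J)) = a"
    and x: "Pi.cochain a x" "leibniz_poly a x" and y: "pval b y"
    and u: "length u = b" and w: "length w = length J" "Pi.homog qs w" and c: "c \<in> G pc" and d: "d \<in> G pd"
  defines "H \<equiv> \<lambda>v. elim (Suc k) k (box_summand b x y (I @ J @ [k]) (u @ w @ [v]))"
  shows "H (c * d) = H c * lconst d + sg (pc * pd) (H d * lconst c)"
proof -
  let ?is = "I @ J @ [k]" and ?m = "length J"
  have "length ?is = Suc k" using perms_bij(1)[OF i(1)] .
  then have ab: "a + b = Suc (Suc k)" "b \<le> Suc k" "k = b + ?m" using i by auto
  have "distinct ?is" using i(1) by (rule perms_distinct)
  then have nk: "k \<notin> set I" "k \<notin> set J" by auto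
  let ?g = "\<lambda>v z. lsubst (phi b ?is) (elim a (Suc ?m) (x (z # w @ [v])))"
  have H: "H v = evl (\<lambda>j. lvar (?is ! j)) (?g v) (y u)" for v
  proof -
    have "H v = evl (\<lambda>j. lvar (?is ! j)) (\<lambda>z. elim (Suc k) k (outer_val b x ?is (w @ [v]) z)) (y u)"
    proof -
      have "?is ! j \<noteq> k" if "j < b" for j
        using that nk i(2) by (auto simp: nth_append in_set_conv_nth)
      then show ?thesis unfolding H_def box_summand_def using u
        by (subst elim_evl[OF pvalD[OF y]]) auto
    qed
    also have "(\<lambda>z. elim (Suc k) k (outer_val b x ?is (w @ [v]) z)) = ?g v"
    proof
      fix z
      show "elim (Suc k) k (outer_val b x ?is (w @ [v]) z) = ?g v z"
        unfolding outer_val_def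
      proof (rule elim_lsubst[where f = 0])
        show "x (z # w @ [v]) \<in> polys a" using Pi.cochainD(1)[OF x(1)] w i by (intro pvalD) auto
        show "(\<Sum>j<a. phi b ?is j) = lsum (Suc k)" by (rule phi_sum[OF i(1) ab(1,2)])
        show "phi b ?is (Suc ?m) = lvar k + 0" using i(2) by (simp add: phi_Suc nth_append)
        fix j Q assume j: "j < a" "j \<noteq> Suc ?m"
        show "elim (Suc k) k (phi b ?is j \<odot> Q) = phi b ?is j \<odot> elim (Suc k) k Q"
        proof (cases j)
          case 0
          have "?is ! l \<noteq> k" if "l < b" for l
            using that nk i(2) by (auto simp: nth_append in_set_conv_nth)
          then show ?thesis unfolding 0 phi_0 by (intro elim_osum) auto
        next
          case (Suc j')
          then have "?is ! (b + j') \<noteq> k"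
            using j i nk by (auto simp: nth_append in_set_conv_nth)
          then show ?thesis unfolding Suc phi_Suc by (rule elim_lvar)
        qed
      qed (use i in auto)
    qed
    finally show ?thesis .
  qed
  have "?g (c * d) = (\<lambda>z. ?g c z * lconst d + sg (pc * pd) (?g d z * lconst c))"
    using leibniz_poly_last_any_head[of ?m x w qs, OF _ _ w c d] x i(3)
    by (auto simp: lsubst_add lsubst_sg lsubst_mult_lconst)
  then show ?thesis unfolding H by (simp only: Pi.evl_fun_add Pi.evl_fun_sg evl_mult_right)
qed

text \<open>The value at \<open>0\<close> is arbitrary: \<open>psi\<close> is applied only after \<open>\<lambda>\<^sub>0\<close> has been eliminated.\<close>

definition psi :: "nat list \<Rightarrow> nat \<Rightarrow> 'f lpoly"
  where "psi J j = (if j = 0 then 0 else lvar (J ! (j - 1)))"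

text \<open>The factor of a defect that comes from the outer map. With its first variable eliminated
  it depends on the variables of \<open>J\<close> alone and no longer on those of the inner
  map.\<close>

definition outer_hat :: "nat \<Rightarrow> ('v list \<Rightarrow> 'v lpoly) \<Rightarrow> nat list \<Rightarrow> 'v list \<Rightarrow> 'v \<Rightarrow> 'v lpoly"
  where "outer_hat a x J w v = lsubst (psi J) (elim a 0 (x (v # w)))"

text \<open>The factor of a defect that comes from the inner map, in the variables of
  \<open>I\<close> alone. Its distinguished argument is the last one, whereas that of
  \<open>outer_hat\<close> is the first.\<close>

definition inner_hat :: "nat \<Rightarrow> ('v list \<Rightarrow> 'v lpoly) \<Rightarrow> nat list \<Rightarrow> 'v list \<Rightarrow> 'v \<Rightarrow> 'v lpoly"
  where "inner_hat b y I w u = lsubst (\<lambda>j. lvar (I ! j)) (elim b (b - 1) (y (w @ [u])))"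

text \<open>Additive on the nose, unlike \<open>outer_val\<close>, because congruent values have
  equal normal forms.\<close>

lemma outer_hat_add:
  assumes "multi (Suc a) x" "length w = a"
  shows "outer_hat (Suc a) x J w (u + v) = outer_hat (Suc a) x J w u + outer_hat (Suc a) x J w v"
  unfolding outer_hat_def lsubst_add[symmetric]
  using elim_multi_add[OF assms(1), of 0 "0 # w" 0 u v] assms(2) by simp

text \<open>The inner value is first replaced by its normal form, from which the variable that would
  become \<lambda>_k has disappeared. Then \<lambda>_k is present only in slot 0 of the outer
  map.\<close>

lemma elim_box_summand_inner:
  assumes i: "I @ k # J \<in> perms (Suc k)" "Suc (length I) = b" "Suc (length J) = a"
    and x: "Pi.cochain a x" and y: "Pi.cochain b y"
    and u: "Suc (length u) = b" and w: "Suc (length w) = a"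
  shows "elim (Suc k) k (box_summand b x y (I @ k # J) (u @ v # w))
    = evl (\<lambda>j. lvar (I ! j)) (outer_hat a x J w) (elim b (b - 1) (y (u @ [v])))"
proof -
  let ?is = "I @ k # J" and ?Y = "elim b (b - 1) (y (u @ [v]))" and ?e = "evl (\<lambda>j. lvar ((I @ k # J) ! j))"
  have "length ?is = Suc k" using perms_bij(1)[OF i(1)] .
  then have ab: "a + b = Suc (Suc k)" "b \<le> Suc k" using i by auto
  have "distinct ?is" using i(1) by (rule perms_distinct)
  then have nk: "k \<notin> set I" "k \<notin> set J" by auto
  have w': "length w + 1 = a" using w by simp
  note x' = Pi.cochainD[OF x] and y' = Pi.cochainD[OF y]
  note g = Pi.outer_val_add[OF i(1) ab x'(2) w'] Pi.outer_val_D[OF i(1) ab x'(3) w']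
  have py: "y (u @ [v]) \<in> polys b" using u y'(1) by (intro pvalD) auto
  have b: "b = Suc (b - 1)" using i by simp
  have Y: "?Y \<in> polys (b - 1)" using py b elim_last_polys by metis
  have "eqv b (y (u @ [v])) ?Y" using b by (intro eqv_elim) simp
  then have "eqv (Suc k) (?e (outer_val b x ?is w) (y (u @ [v]))) (?e (outer_val b x ?is w) ?Y)"
    by (rule Pi.additive_mod_evl_resp[OF g])
  then have "elim (Suc k) k (box_summand b x y ?is (u @ v # w)) = elim (Suc k) k (?e (outer_val b x ?is w) ?Y)"
    using u by (intro elim_eqv) (auto simp: box_summand_def)
  also have "\<dots> = ?e (\<lambda>z. elim (Suc k) k (outer_val b x ?is w z)) ?Y"
    by (rule elim_evl[OF Y]) (use nk i(2) in \<open>auto simp: nth_append in_set_conv_nth\<close>)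
  also have "(\<lambda>z. elim (Suc k) k (outer_val b x ?is w z)) = outer_hat a x J w"
  proof
    fix z
    have px: "x (z # w) \<in> polys a" using w x'(1) by (intro pvalD) auto
    have "elim (Suc k) k (outer_val b x ?is w z) = lsubst (phi b ?is) (elim a 0 (x (z # w)))"
      unfolding outer_val_def
    proof (rule elim_lsubst[OF px])
      show "(\<Sum>j<a. phi b ?is j) = lsum (Suc k)" by (rule phi_sum[OF i(1) ab])
      \<comment> \<open>The pivot for \<open>elim_lsubst\<close>: slot 0 receives \<lambda>_k plus
        the other inner variables, so eliminating \<lambda>_k amounts to eliminating the first
        variable of \<open>x\<close>.\<close>
      show "phi b ?is 0 = lvar k + (\<Sum>l<b - 1. lvar (I ! l))"
        using i(2) b by (subst b) (auto simp: phi_0 nth_append add.commute intro!: sum.cong)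
      show "elim (Suc k) k ((\<Sum>l<b - 1. lvar (I ! l)) \<odot> Q) = (\<Sum>l<b - 1. lvar (I ! l)) \<odot> elim (Suc k) k Q" for Q
        by (rule elim_osum) (use nk i(2) in \<open>auto simp: in_set_conv_nth\<close>)
      fix j Q assume j: "j < a" "j \<noteq> 0"
      then obtain j' where j': "j = Suc j'" by (cases j) auto
      then have "?is ! (b + j') \<noteq> k"
        using j i nk by (auto simp: nth_append in_set_conv_nth)
      then show "elim (Suc k) k (phi b ?is j \<odot> Q) = phi b ?is j \<odot> elim (Suc k) k Q"
        unfolding j' phi_Suc by (rule elim_lvar)
    qed (use w in auto)
    also have "\<dots> = outer_hat a x J w z"
      unfolding outer_hat_def
    proof (rule lsubst_elim_cong[OF px])
      fix j assume j: "j < a" "j \<noteq> 0"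
      then obtain j' where j': "j = Suc j'" by (cases j) auto
      show "phi b ?is j = psi J j"
        unfolding j' phi_Suc psi_def using i(2) by (simp add: nth_append)
    qed
    finally show "elim (Suc k) k (outer_val b x ?is w z) = outer_hat a x J w z" .
  qed
  also have "?e (outer_hat a x J w) ?Y = evl (\<lambda>j. lvar (I ! j)) (outer_hat a x J w) ?Y"
    by (rule evl_cong[OF Y]) (use i(2) in \<open>auto simp: nth_append\<close>)
  finally show ?thesis .
qed

lemma outer_hat_mult:
  assumes x: "leibniz_poly (Suc a) x" and w: "length w = a" "Pi.homog qs w" and c: "c \<in> G pc" and d: "d \<in> G pd"
  shows "outer_hat (Suc a) x J w (c * d) = sg (pd * sum_list qs) (outer_hat (Suc a) x J w c * lconst d)
    + sg (pc * (pd + sum_list qs)) (outer_hat (Suc a) x J w d * lconst c)"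
proof -
  have h: "Pi.homog (0 # qs) (0 # w)" using w(2) by (simp add: Pi.homog_def)
  have "length qs = a" using Pi.homog_length[OF w(2)] w(1) by simp
  then have t: "(\<Sum>j\<in>{Suc 0..<Suc a}. (0 # qs) ! j) = sum_list qs"
    by (simp only: sum.shift_bounds_Suc_ivl) (simp add: sum_list_sum_nth)
  show ?thesis
    using leibniz_polyD[OF x _ h _ c d, of 0, unfolded t] w(1)
    by (simp add: outer_hat_def lsubst_add lsubst_sg lsubst_mult_lconst)
qed

text \<open>Up to the sign for moving the first argument past the others, both kinds of factor are
  built from a map in the same way. This makes the defects comparable when \<open>x\<close> and
  \<open>y\<close> exchange their roles.\<close>

lemma outer_hat_inner_hat:
  assumes x: "Pi.cochain (Suc a) x" and w: "length w = a" "Pi.homog qs w" and c: "c \<in> G pc" and J: "length J = a"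
  shows "outer_hat (Suc a) x J w c = sg ((pc + 1) * sum_list qs) (inner_hat (Suc a) x J w c)"
proof -
  have h: "Pi.homog ((pc + 1) # qs) (c # w)" using w(2) c
    by (simp add: Pi.homog_def rev_parity_def add.assoc)
  have "length qs = a" using Pi.homog_length[OF w(2)] w(1) by simp
  then have t: "(\<Sum>j\<in>{Suc 0..<Suc a}. ((pc + 1) # qs) ! j) = sum_list qs"
    by (simp only: sum.shift_bounds_Suc_ivl) (simp add: sum_list_sum_nth)
  have P: "elim (Suc a) a (x (w @ [c])) \<in> polys a"
    using w Pi.cochainD(1)[OF x] by (intro elim_last_polys pvalD) auto
  have "elim (Suc a) 0 (x (c # w)) = sg ((pc + 1) * sum_list qs)
      (lsubst (\<lambda>j. lvar (to_end (Suc a) 0 ! j)) (elim (Suc a) a (x (w @ [c]))))"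
    using Pi.elim_to_end[OF x zero_less_Suc _ h, unfolded t] w(1) by (simp del: upt_Suc)
  then have "outer_hat (Suc a) x J w c = sg ((pc + 1) * sum_list qs)
      (lsubst (\<lambda>j. psi J (to_end (Suc a) 0 ! j)) (elim (Suc a) a (x (w @ [c]))))"
    by (simp add: outer_hat_def lsubst_sg Pi.lsubst_lsubst_lvar del: upt_Suc)
  also have "lsubst (\<lambda>j. psi J (to_end (Suc a) 0 ! j)) (elim (Suc a) a (x (w @ [c])))
      = inner_hat (Suc a) x J w c"
    unfolding inner_hat_def diff_Suc_1
    by (rule lsubst_cong[OF P]) (use to_end_nth(2)[of 0 a] in \<open>auto simp: psi_def simp del: upt_Suc\<close>)
  finally show ?thesis .
qed

lemma homog_poly_lsubst_lvar: "homog_poly p P \<Longrightarrow> homog_poly p (lsubst (\<lambda>j. lvar (s j)) P)"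
  by (simp add: homog_poly_iff proj_poly_lsubst_lvar)

text \<open>Appending \<open>c\<close> contributes \<open>pc + 1\<close> in \<Pi>V; reading the
  parity of the value in V instead removes the extra 1.\<close>

lemma homog_poly_elim_last:
  assumes y: "Pi.has_parity (Suc b) q y" and w: "length w = b" "Pi.homog qs w" and c: "c \<in> G pc"
  shows "homog_poly (q + sum_list qs + pc) (elim (Suc b) b (y (w @ [c])))"
proof -
  have h: "Pi.homog (qs @ [pc + 1]) (w @ [c])" using w(2) c
    by (simp add: Pi.homog_def rev_parity_def add.assoc list_all2_appendI)
  then have "eqv (Suc b) (y (w @ [c])) (Pi.proj_poly (q + sum_list (qs @ [pc + 1])) (y (w @ [c])))"
    using w(1) by (intro Pi.has_parityD[OF y]) auto
  then have "elim (Suc b) b (y (w @ [c])) = Pi.proj_poly (q + sum_list (qs @ [pc + 1])) (elim (Suc b) b (y (w @ [c])))"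
    unfolding Pi.proj_poly_elim by (rule elim_eqv[OF lessI])
  then have "Pi.homog_poly (q + sum_list (qs @ [pc + 1])) (elim (Suc b) b (y (w @ [c])))"
    by (metis Pi.homog_poly_proj_poly)
  then have "Pi.homog_poly (q + sum_list qs + pc + 1) (elim (Suc b) b (y (w @ [c])))"
    by (simp add: add.assoc)
  then show ?thesis by (simp only: Pi_homog_poly_rev)
qed

text \<open>In the summands in which the last argument \<open>c d\<close> is fed to the inner map \<open>y\<close>, the Leibniz
  rules of both maps leave cross terms with one factor in \<open>x\<close> and the other in \<open>y\<close>.\<close>

definition crossterm where
  "crossterm x y q vs qs I J c pc d pd = sg (epar qs (I @ J) + (pc + pd + 1) * lpar qs J
      + (q + lpar qs I + pc) * (pd + lpar qs J))
    (outer_hat (Suc (length J)) x J (map ((!) vs) J) d * inner_hat (Suc (length I)) y I (map ((!) vs) I) c)"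

text \<open>The Leibniz rule of \<open>x\<close> in its first slot is applied to each coefficient of
  \<open>P\<close> times \<open>d\<close>. In its second term the coefficient is a plain factor, so
  the evaluation along \<open>x\<close> degenerates to a substitution into \<open>P\<close>.\<close>

lemma evl_outer_hat_mult:
  assumes x: "multi (Suc a) x" "leibniz_poly (Suc a) x" and w: "length w = a" "Pi.homog qs w"
    and P: "homog_poly p P" and d: "d \<in> G pd"
  shows "evl \<rho> (outer_hat (Suc a) x J w) (P * lconst d) = sg (pd * sum_list qs) (evl \<rho> (outer_hat (Suc a) x J w) P * lconst d)
    + sg (p * (pd + sum_list qs)) (outer_hat (Suc a) x J w d * lsubst \<rho> P)"
proof -
  let ?g = "outer_hat (Suc a) x J w" and ?s = "sum_list qs"
  obtain n where n: "P \<in> polys n" using polys_UN by blast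
  have "evl \<rho> ?g (P * lconst d) = evl \<rho> (\<lambda>v. ?g (v * d)) P"
    by (rule evl_comp_mult_lconst) (rule outer_hat_add[OF x(1) w(1)])
  also have "\<dots> = evl \<rho> (\<lambda>v. sg (pd * ?s) (?g v * lconst d) + sg (p * (pd + ?s)) (?g d * lconst v)) P"
    by (rule evl_cong[OF n refl]) (use P in \<open>auto intro!: outer_hat_mult[OF x(2) w _ d] simp: homog_poly_def\<close>)
  finally show ?thesis
    by (simp only: Pi.evl_fun_add Pi.evl_fun_sg evl_mult_right evl_mult_left lsubst_evl)
qed

text \<open>The Leibniz rule of \<open>y\<close> splits its normal form into two products, and on
  each of them the rule of \<open>x\<close> gives one term of the expected shape and one
  defect.\<close>

lemma elim_signed_summand_inner:
  assumes i: "I @ k # J \<in> perms (Suc k)" "Suc (length I) = b" "Suc (length J) = a"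
    and x: "Pi.cochain a x" "leibniz_poly a x" and y: "Pi.cochain b y" "leibniz_poly b y" "Pi.has_parity b q y"
    and vs: "length vs = k" "Pi.homog qs vs" and c: "c \<in> G pc" and d: "d \<in> G pd"
  defines "B \<equiv> \<lambda>u pu. elim (Suc k) k (signed_summand b x y (qs @ [pu + 1]) (vs @ [u]) (I @ k # J))"
  shows "B (c * d) (pc + pd) = B c pc * lconst d + sg (pc * pd) (B d pd * lconst c)
    + (crossterm x y q vs qs I J c pc d pd + sg (pc * pd) (crossterm x y q vs qs I J d pd c pc))"
proof -
  let ?u = "map ((!) vs) I" and ?w = "map ((!) vs) J"
  define s e where "s = lpar qs J" and "e = epar qs (I @ J)"
  have lqs: "length qs = k" using Pi.homog_length[OF vs(2)] vs(1) by simp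
  have "set (I @ k # J) = {..<Suc k}" "distinct (I @ k # J)"
    using i(1) by (rule perms_set, rule perms_distinct)
  then have IJ: "set I \<subseteq> {..<k}" "set J \<subseteq> {..<k}"
    by (auto simp: set_eq_iff less_Suc_eq)
  have hI: "Pi.homog (map ((!) qs) I) ?u" and hJ: "Pi.homog (map ((!) qs) J) ?w"
    using IJ vs by (auto intro: Pi.homog_map)
  define Y where "Y = (\<lambda>u. elim b (b - 1) (y (?u @ [u])))"
  define E where "E = (\<lambda>u. evl (\<lambda>j. lvar (I ! j)) (outer_hat a x J ?w) (Y u))"
  have B: "B u pu = sg (e + (pu + 1) * s) (E u)" for u pu
  proof -
    have m: "map ((!) (vs @ [u])) (I @ k # J) = ?u @ u # ?w"
      using IJ vs(1) by (auto simp: nth_append)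
    have e: "epar (qs @ [pu + 1]) (I @ k # J) = e + (pu + 1) * s"
      using epar_middle[of I J qs "pu + 1"] IJ lqs by (simp add: e_def s_def)
    have l: "Suc (length ?u) = b" "Suc (length ?w) = a" using i by auto
    show ?thesis
      by (simp only: B_def signed_summand_def m e elim_sg elim_box_summand_inner[OF i x(1) y(1) l] E_def Y_def)
  qed
  have a: "a = Suc (length J)" and b: "b = Suc (length I)" using i by auto
  have Ycd: "Y (c * d) = Y c * lconst d + sg (pc * pd) (Y d * lconst c)"
    unfolding Y_def b diff_Suc_1
    by (rule leibniz_poly_lastD[OF leibniz_poly_imp_last[OF y(2)[unfolded b]] _ hI c d]) simp
  have hY: "homog_poly (q + lpar qs I + pu) (Y u)" if "u \<in> G pu" for u pu
    unfolding Y_def b diff_Suc_1 using homog_poly_elim_last[OF y(3)[unfolded b] _ hI that] by simp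
  have g: "outer_hat a x J ?w (u + v) = outer_hat a x J ?w u + outer_hat a x J ?w v" for u v
    unfolding a by (rule outer_hat_add) (use Pi.cochainD(2)[OF x(1)] a in auto)
  have Emult: "evl (\<lambda>j. lvar (I ! j)) (outer_hat a x J ?w) (Y u * lconst v) = sg (pv * s) (E u * lconst v)
      + sg ((q + lpar qs I + pu) * (pv + s)) (outer_hat a x J ?w v * inner_hat b y I ?u u)"
    if "u \<in> G pu" "v \<in> G pv" for u v pu pv
    using evl_outer_hat_mult[of "length J" x ?w "map ((!) qs) J", OF _ _ _ hJ hY[OF that(1)] that(2)]
      Pi.cochainD(2)[OF x(1)] x(2) a by (simp add: E_def s_def inner_hat_def Y_def)
  have Esg: "evl \<rho> (outer_hat a x J ?w) (sg p P) = sg p (evl \<rho> (outer_hat a x J ?w) P)" for \<rho> p P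
  proof -
    have "evl \<rho> (outer_hat a x J ?w) P + evl \<rho> (outer_hat a x J ?w) (- P) = 0"
      using evl_add[OF g, of \<rho> P "- P"] by simp
    then show ?thesis by (simp add: sg_def add_eq_0_iff)
  qed
  have "E (c * d) = sg (pd * s) (E c * lconst d)
      + sg ((q + lpar qs I + pc) * (pd + s)) (outer_hat a x J ?w d * inner_hat b y I ?u c)
      + sg (pc * pd) (sg (pc * s) (E d * lconst c)
      + sg ((q + lpar qs I + pd) * (pc + s)) (outer_hat a x J ?w c * inner_hat b y I ?u d))"
  proof -
    have "E (c * d) = evl (\<lambda>j. lvar (I ! j)) (outer_hat a x J ?w) (Y c * lconst d)
        + sg (pc * pd) (evl (\<lambda>j. lvar (I ! j)) (outer_hat a x J ?w) (Y d * lconst c))"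
      by (simp only: E_def Ycd evl_add[OF g] Esg)
    then show ?thesis by (simp only: Emult[OF c d] Emult[OF d c])
  qed
  \<comment> \<open>An inserted argument of parity \<open>pu + 1\<close> in \<Pi>V, moved past
    \<open>J\<close>, contributes \<open>(pu + 1) * s\<close> to the Koszul exponent. The identities
    compare this sign for the product with those for \<open>c\<close> and \<open>d\<close>.\<close>
  moreover have "e + (pc + pd + 1) * s + pd * s = e + (pc + 1) * s"
    "e + (pc + pd + 1) * s + (pc * pd + pc * s) = pc * pd + (e + (pd + 1) * s)"
    "pd + pc = pc + pd"
    by (simp_all add: algebra_simps)
  ultimately show ?thesis
    unfolding B crossterm_def s_def[symmetric] e_def[symmetric] a[symmetric] b[symmetric]
    by (simp add: sg_add sg_mult_left add.assoc add.commute[of pd pc]) (simp add: ac_simps)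
qed

text \<open>First-slot factors are rewritten as last-slot ones, and the resulting homogeneous normal
  forms supercommute. Exchanging the blocks adds the product of their parities to the Koszul
  exponent; what remains is an identity in the two-element field.\<close>

lemma crossterm_swap:
  assumes IJ: "set I \<subseteq> {..<k}" "set J \<subseteq> {..<k}" "set I \<inter> set J = {}"
    and x: "Pi.cochain (Suc (length J)) x" "Pi.has_parity (Suc (length J)) r x"
    and y: "Pi.cochain (Suc (length I)) y" "Pi.has_parity (Suc (length I)) q y"
    and vs: "length vs = k" "Pi.homog qs vs" and c: "c \<in> G pc" and d: "d \<in> G pd"
  shows "crossterm x y q vs qs I J c pc d pd = sg (r * q + pc * pd) (crossterm y x r vs qs J I d pd c pc)"
proof -
  let ?u = "map ((!) vs) I" and ?w = "map ((!) vs) J"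
  have hI: "Pi.homog (map ((!) qs) I) ?u" and hJ: "Pi.homog (map ((!) qs) J) ?w"
    using IJ vs by (auto intro: Pi.homog_map)
  define s t e where "s = lpar qs I" and "t = lpar qs J" and "e = epar qs (I @ J)"
  let ?X = "inner_hat (Suc (length J)) x J ?w d" and ?Y = "inner_hat (Suc (length I)) y I ?u c"
  have outer_hat: "outer_hat (Suc (length J)) x J ?w d = sg ((pd + 1) * t) ?X"
    unfolding t_def by (rule outer_hat_inner_hat[OF x(1) _ hJ d]) auto
  have gy: "outer_hat (Suc (length I)) y I ?u c = sg ((pc + 1) * s) ?Y"
    unfolding s_def by (rule outer_hat_inner_hat[OF y(1) _ hI c]) auto
  have hX: "homog_poly (r + t + pd) ?X" unfolding inner_hat_def t_def diff_Suc_1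
    by (rule homog_poly_lsubst_lvar[OF homog_poly_elim_last[OF x(2) _ hJ d]]) simp
  have hY: "homog_poly (q + s + pc) ?Y" unfolding inner_hat_def s_def diff_Suc_1
    by (rule homog_poly_lsubst_lvar[OF homog_poly_elim_last[OF y(2) _ hI c]]) simp
  have "epar qs (J @ I) = e + s * t"
    unfolding e_def s_def t_def by (rule epar_block_swap[OF IJ(3)])
  then show ?thesis
    unfolding crossterm_def s_def[symmetric] t_def[symmetric] e_def[symmetric] outer_hat gy
    by (simp add: sg_mult_left homog_poly_supercomm[OF hX hY])
      (rule arg_cong[of _ _ "\<lambda>p. sg p (?Y * ?X)"], simp add: algebra_simps)
qed

lemma sorted_list_of_set_snoc:
  assumes "A \<subseteq> {..<k :: nat}" shows "sorted_list_of_set (insert k A) = sorted_list_of_set A @ [k]"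
proof -
  have A: "finite A" using assms finite_subset by blast
  have "sorted_list_of_set (set (sorted_list_of_set A @ [k])) = sorted_list_of_set A @ [k]"
    using A assms by (intro sorted_list_of_set.idem_if_sorted_distinct) (auto simp: sorted_append)
  then show ?thesis using A by simp
qed

abbreviation co :: "nat \<Rightarrow> nat set \<Rightarrow> nat list" where "co k S \<equiv> sorted_list_of_set ({..<k} - S)"

text \<open>Unshuffles are sorted by whether the last index goes to the outer or to the inner map;
  being the largest, it ends the block it belongs to.\<close>

lemma box_poly_split:
  "box_poly (Suc k) b x y ps vs =
    (\<Sum>S\<in>{S. S \<subseteq> {..<k} \<and> card S = b}. signed_summand b x y ps vs (sorted_list_of_set S @ co k S @ [k])) +
    (\<Sum>S\<in>{S. S \<subseteq> {..<k} \<and> Suc (card S) = b}. signed_summand b x y ps vs (sorted_list_of_set S @ k # co k S))"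
proof -
  let ?A = "{S. S \<subseteq> {..<k} \<and> card S = b}" and ?B = "{S. S \<subseteq> {..<k} \<and> Suc (card S) = b}"
  have fin: "finite {S. S \<subseteq> {..<k} \<and> Q S}" for Q
    by (rule finite_subset[of _ "Pow {..<k}"]) auto
  have k: "k \<notin> S" "finite S" if "S \<subseteq> {..<k}" for S using that finite_subset[OF that] by auto
  have un: "{S. S \<subseteq> {..<Suc k} \<and> card S = b} = ?A \<union> insert k ` ?B"
  proof (intro set_eqI iffI)
    fix S assume S: "S \<in> {S. S \<subseteq> {..<Suc k} \<and> card S = b}"
    show "S \<in> ?A \<union> insert k ` ?B"
    proof (cases "k \<in> S")
      case True
      have f: "finite S" using S finite_subset by blast
      have "S = insert k (S - {k})" "S - {k} \<subseteq> {..<k}" "Suc (card (S - {k})) = b"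
        using True S card_Suc_Diff1[OF f True] by (auto simp: less_Suc_eq)
      then show ?thesis by blast
    next
      case False
      then have "S \<subseteq> {..<k}" using S by (auto simp: less_Suc_eq)
      then show ?thesis using S by blast
    qed
  next
    fix S assume "S \<in> ?A \<union> insert k ` ?B"
    then show "S \<in> {S. S \<subseteq> {..<Suc k} \<and> card S = b}"
    proof
      assume "S \<in> insert k ` ?B"
      then obtain T where T: "T \<subseteq> {..<k}" "Suc (card T) = b" "S = insert k T" by auto
      then show ?thesis using k[OF T(1)] by auto
    qed auto
  qed
  have dis: "?A \<inter> insert k ` ?B = {}" by auto
  have inj: "inj_on (insert k) ?B"
    by (rule inj_onI) (metis (no_types, lifting) insert_ident k(1) mem_Collect_eq)
  have uA: "unsh (Suc k) S = sorted_list_of_set S @ co k S @ [k]" if "S \<subseteq> {..<k}" for S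
  proof -
    have "{..<Suc k} - S = insert k ({..<k} - S)" using k[OF that] by auto
    then show ?thesis by (simp only: unsh_def sorted_list_of_set_snoc[OF Diff_subset] append.assoc)
  qed
  have uB: "unsh (Suc k) (insert k S) = sorted_list_of_set S @ k # co k S" if "S \<subseteq> {..<k}" for S
  proof -
    have "{..<Suc k} - insert k S = {..<k} - S" by auto
    then show ?thesis unfolding unsh_def using sorted_list_of_set_snoc[OF that] by simp
  qed
  show ?thesis
    unfolding Pi.box_poly_sum un
    by (subst sum.union_disjoint) (auto simp: fin dis sum.reindex[OF inj] uA uB intro!: sum.cong arg_cong2[of _ _ _ _ "(+)"])
qed

lemma split_perms:
  assumes "S \<subseteq> {..<k}"
  shows "sorted_list_of_set S @ co k S @ [k] \<in> perms (Suc k)"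
    "sorted_list_of_set S @ k # co k S \<in> perms (Suc k)"
    "length (sorted_list_of_set S) = card S" "length (co k S) = k - card S"
    "set (sorted_list_of_set S) \<subseteq> {..<k}" "set (co k S) \<subseteq> {..<k}"
    "set (sorted_list_of_set S) \<inter> set (co k S) = {}"
  using assms finite_subset[OF assms] by (auto simp: permutations_of_set_def less_Suc_eq card_Diff_subset)

text \<open>The Koszul signs depend on the parity of the last argument, which \<open>F\<close>
  therefore receives separately. The sum over \<open>S\<close> is the total defect of one box
  product.\<close>

lemma elim_box_poly_leibniz:
  assumes ab: "a + b = Suc (Suc k)"
    and x: "Pi.cochain a x" "leibniz_poly a x" and y: "Pi.cochain b y" "leibniz_poly b y" "Pi.has_parity b q y"
    and vs: "length vs = k" "Pi.homog qs vs" and c: "c \<in> G pc" and d: "d \<in> G pd"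
  defines "F \<equiv> \<lambda>u pu. elim (Suc k) k (box_poly (Suc k) b x y (qs @ [pu + 1]) (vs @ [u]))"
  shows "F (c * d) (pc + pd) = F c pc * lconst d + sg (pc * pd) (F d pd * lconst c) +
    (\<Sum>S\<in>{S. S \<subseteq> {..<k} \<and> Suc (card S) = b}.
      crossterm x y q vs qs (sorted_list_of_set S) (co k S) c pc d pd +
      sg (pc * pd) (crossterm x y q vs qs (sorted_list_of_set S) (co k S) d pd c pc))"
proof -
  let ?A = "{S. S \<subseteq> {..<k} \<and> card S = b}" and ?B = "{S. S \<subseteq> {..<k} \<and> Suc (card S) = b}"
  let ?bt = "\<lambda>u pu is. elim (Suc k) k (signed_summand b x y (qs @ [pu + 1]) (vs @ [u]) is)"
  let ?C = "\<lambda>S. crossterm x y q vs qs (sorted_list_of_set S) (co k S) c pc d pd +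
      sg (pc * pd) (crossterm x y q vs qs (sorted_list_of_set S) (co k S) d pd c pc)"
  define fA fB where "fA = (\<lambda>u pu. \<Sum>S\<in>?A. ?bt u pu (sorted_list_of_set S @ co k S @ [k]))"
    and "fB = (\<lambda>u pu. \<Sum>S\<in>?B. ?bt u pu (sorted_list_of_set S @ k # co k S))"
  have F: "F u pu = fA u pu + fB u pu" for u pu
    by (simp add: F_def box_poly_split elim_add elim_sum fA_def fB_def)
  have lqs: "length qs = k" using Pi.homog_length[OF vs(2)] vs(1) by simp
  have cardle: "card S \<le> k" if "S \<subseteq> {..<k}" for S using card_mono[OF _ that] by simp
  have A: "?bt (c * d) (pc + pd) (sorted_list_of_set S @ co k S @ [k]) =
      ?bt c pc (sorted_list_of_set S @ co k S @ [k]) * lconst d +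
      sg (pc * pd) (?bt d pd (sorted_list_of_set S @ co k S @ [k]) * lconst c)" if "S \<in> ?A" for S
  proof -
    let ?I = "sorted_list_of_set S" and ?J = "co k S"
    have S: "S \<subseteq> {..<k}" "card S = b" using that by auto
    note p = split_perms[OF S(1)]
    have m: "map ((!) (vs @ [u])) (?I @ ?J @ [k]) = map ((!) vs) ?I @ map ((!) vs) ?J @ [u]" for u
      using p(5,6) vs(1) by (auto simp: nth_append)
    have e: "epar (qs @ [pu + 1]) (?I @ ?J @ [k]) = epar qs (?I @ ?J)" for pu
      using epar_last[of ?I ?J qs] p(5,6) lqs by simp
    have "Suc (Suc (length ?J)) = a" using p(4) S(2) ab cardle[OF S(1)] by simp
    moreover have "Pi.homog (map ((!) qs) ?J) (map ((!) vs) ?J)"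
      using p(6) vs by (auto intro: Pi.homog_map)
    ultimately have "elim (Suc k) k (box_summand b x y (?I @ ?J @ [k]) (map ((!) vs) ?I @ map ((!) vs) ?J @ [c * d])) =
      elim (Suc k) k (box_summand b x y (?I @ ?J @ [k]) (map ((!) vs) ?I @ map ((!) vs) ?J @ [c])) * lconst d +
      sg (pc * pd) (elim (Suc k) k (box_summand b x y (?I @ ?J @ [k]) (map ((!) vs) ?I @ map ((!) vs) ?J @ [d])) * lconst c)"
      using p(3) S(2) Pi.cochainD(1)[OF y(1)] by (intro elim_box_summand_outer[OF p(1) _ _ x _ _ _ _ c d]) auto
    then show ?thesis
      by (simp only: signed_summand_def m e elim_sg sg_mult_left sg_add sg_sg) (simp add: add.commute)
  qed
  have B: "?bt (c * d) (pc + pd) (sorted_list_of_set S @ k # co k S) =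
      ?bt c pc (sorted_list_of_set S @ k # co k S) * lconst d +
      sg (pc * pd) (?bt d pd (sorted_list_of_set S @ k # co k S) * lconst c) + ?C S" if "S \<in> ?B" for S
  proof -
    have S: "S \<subseteq> {..<k}" "Suc (card S) = b" using that by auto
    note p = split_perms[OF S(1)]
    show ?thesis
      using p S ab cardle[OF S(1)] by (intro elim_signed_summand_inner[OF p(2) _ _ x y vs c d]) auto
  qed
  have "fA (c * d) (pc + pd) = fA c pc * lconst d + sg (pc * pd) (fA d pd * lconst c)"
    unfolding fA_def sum_distrib_right sg_sum sum.distrib[symmetric] by (rule sum.cong[OF refl A])
  moreover have "fB (c * d) (pc + pd) = fB c pc * lconst d + sg (pc * pd) (fB d pd * lconst c) + (\<Sum>S\<in>?B. ?C S)"
    unfolding fB_def sum_distrib_right sg_sum sum.distrib[symmetric] by (rule sum.cong[OF refl B])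
  ultimately show ?thesis unfolding F
    by (simp add: sg_add distrib_right algebra_simps)
qed

end

section \<open>The bracket as a cochain\<close>

context diff_supermodule
begin

text \<open>The product of the parities of the two maps enters as the parameter \<open>s\<close>;
  the exponent \<open>s + 1\<close> includes the minus sign of the bracket.\<close>

definition bracket_poly :: "nat \<Rightarrow> nat \<Rightarrow> nat \<Rightarrow> bit \<Rightarrow> ('v list \<Rightarrow> 'v lpoly) \<Rightarrow> ('v list \<Rightarrow> 'v lpoly) \<Rightarrow> 'v list \<Rightarrow> 'v lpoly"
  where "bracket_poly n a b s x y vs = multi_ext n (box_poly n b x y) vs + sg (s + 1) (multi_ext n (box_poly n a y x) vs)"

lemma sesq_plus:
  assumes "sesq n x" "sesq n y" shows "sesq n (\<lambda>vs. x vs + y vs)"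
  unfolding sesq_def
proof (intro ballI allI impI)
  fix vs :: "'v list" and i assume "vs \<in> args n" "i < n"
  then show "eqv n (x (vs[i := D (vs ! i)]) + y (vs[i := D (vs ! i)])) (- (lvar i \<odot> (x vs + y vs)))"
    using eqv_add[OF sesqD[OF assms(1), of vs i "vs ! i"] sesqD[OF assms(2), of vs i "vs ! i"]]
    by (simp add: args_def pact.scale_right_distrib)
qed

lemma sym_plus: "sym_on n x \<Longrightarrow> sym_on n y \<Longrightarrow> sym_on n (\<lambda>vs. x vs + y vs)"
  unfolding sym_on_def lsubst_add sg_add by (intro ballI allI impI eqv_add) blast+

lemma cochain_plus: "cochain n x \<Longrightarrow> cochain n y \<Longrightarrow> cochain n (\<lambda>vs. x vs + y vs)"
  by (simp add: cochain_def pval_plus multi_plus sesq_plus sym_plus)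

lemma cochain_smult:
  assumes "cochain n x" shows "cochain n (\<lambda>vs. lconst c \<odot> x vs)"
  unfolding cochain_def
proof (intro conjI)
  note x = cochainD[OF assms]
  show "pval n (\<lambda>vs. lconst c \<odot> x vs)" using x(1) by (simp add: pval_def polys_pact)
  show "multi n (\<lambda>vs. lconst c \<odot> x vs)" unfolding multi_def
  proof (intro ballI allI impI)
    fix vs :: "'v list" and i e u w assume "vs \<in> args n" "i < n"
    then show "eqv n (lconst c \<odot> x (vs[i := scale e u + w]))
        (lconst e \<odot> lconst c \<odot> x (vs[i := u]) + lconst c \<odot> x (vs[i := w]))"
      using eqv_pact[OF multi_lin[OF x(2), of vs i e u w], of "lconst c"]
      by (simp add: args_def pact.scale_right_distrib pact.scale_left_commute)
  qed
  show "sesq n (\<lambda>vs. lconst c \<odot> x vs)" unfolding sesq_def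
  proof (intro ballI allI impI)
    fix vs :: "'v list" and i assume "vs \<in> args n" "i < n"
    then show "eqv n (lconst c \<odot> x (vs[i := D (vs ! i)])) (- (lvar i \<odot> lconst c \<odot> x vs))"
      using eqv_pact[OF sesqD[OF x(3), of vs i "vs ! i"], of "lconst c"]
      by (simp add: args_def pact.scale_left_commute)
  qed
  show "sym_on n (\<lambda>vs. lconst c \<odot> x vs)"
    using x(4) unfolding sym_on_def lsubst_smult pact_sg[symmetric] by (blast intro: eqv_pact)
qed

lemma cochain_sg: "cochain n x \<Longrightarrow> cochain n (\<lambda>vs. sg p (x vs))"
  unfolding psign_pact[symmetric] by (rule cochain_smult)

lemma cochain_zero: "cochain n (\<lambda>vs. 0)"
  by (simp add: cochain_def pval_def multi_def sesq_def sym_on_def)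

lemma cochain_sum: "(\<And>i. i \<in> I \<Longrightarrow> cochain n (f i)) \<Longrightarrow> cochain n (\<lambda>vs. \<Sum>i\<in>I. f i vs)"
  by (induction I rule: infinite_finite_induct) (auto intro: cochain_zero cochain_plus)

lemma cochain_bracket_poly:
  assumes "a + b = Suc n" "cochain a x" "cochain b y" shows "cochain n (bracket_poly n a b s x y)"
  unfolding bracket_poly_def
  by (intro cochain_plus cochain_sg cochain_box[OF assms] cochain_box[OF _ assms(3,2)])
    (use assms in simp)

lemma bracket_poly_homog:
  assumes "a + b = Suc n" "cochain a x" "cochain b y" "length vs = n" "homog ps vs"
  shows "eqv n (bracket_poly n a b s x y vs) (box_poly n b x y ps vs + sg (s + 1) (box_poly n a y x ps vs))"
  unfolding bracket_poly_def
  by (intro eqv_add eqv_sg multi_ext_homog cochain_box(2)[of a b] cochain_box(2)[of b a])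
    (use assms in auto)

end

context comm_diff_superalgebra
begin

text \<open>Complementation matches the inner index sets of one box product with those of the other.
  \<open>crossterm_swap\<close> also exchanges \<open>c\<close> and \<open>d\<close>, which only
  permutes the two defects belonging to a set, so the total defects agree up to the sign that the
  bracket compensates.\<close>

lemma leibniz_poly_last_bracket_poly:
  assumes ab: "a + b = Suc (Suc k)"
    and x: "Pi.cochain a x" "leibniz_poly a x" "Pi.has_parity a r x" and y: "Pi.cochain b y" "leibniz_poly b y" "Pi.has_parity b q y"
  shows "leibniz_poly_last k (Pi.bracket_poly (Suc k) a b (r * q) x y)"
  unfolding leibniz_poly_last_def
proof (intro allI impI, elim conjE)
  fix vs qs c d pc pd
  assume vs: "length vs = k" "Pi.homog qs vs" and c: "c \<in> G pc" and d: "d \<in> G pd"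
  have ba: "b + a = Suc (Suc k)" using ab by simp
  define F H where "F = (\<lambda>u pu. elim (Suc k) k (box_poly (Suc k) b x y (qs @ [pu + 1]) (vs @ [u])))"
    and "H = (\<lambda>u pu. elim (Suc k) k (box_poly (Suc k) a y x (qs @ [pu + 1]) (vs @ [u])))"
  have Z: "elim (Suc k) k (Pi.bracket_poly (Suc k) a b (r * q) x y (vs @ [u])) = F u pu + sg (r * q + 1) (H u pu)"
    if "u \<in> G pu" for u pu
  proof -
    have "Pi.homog (qs @ [pu + 1]) (vs @ [u])" using vs that
      by (simp add: Pi.homog_def list_all2_appendI rev_parity_def add.assoc)
    from elim_eqv[OF lessI Pi.bracket_poly_homog[OF ab x(1) y(1) _ this]] vs(1) show ?thesis
      by (simp add: elim_add elim_sg F_def H_def)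
  qed
  let ?S = "\<lambda>b. {S. S \<subseteq> {..<k} \<and> Suc (card S) = b}"
  let ?X = "\<lambda>S. crossterm x y q vs qs (sorted_list_of_set S) (co k S)"
    and ?Y = "\<lambda>S. crossterm y x r vs qs (sorted_list_of_set S) (co k S)"
  have F: "F (c * d) (pc + pd) = F c pc * lconst d + sg (pc * pd) (F d pd * lconst c)
      + (\<Sum>S\<in>?S b. ?X S c pc d pd + sg (pc * pd) (?X S d pd c pc))"
    unfolding F_def by (rule elim_box_poly_leibniz[OF ab x(1,2) y vs c d])
  have H: "H (c * d) (pc + pd) = H c pc * lconst d + sg (pc * pd) (H d pd * lconst c)
      + (\<Sum>S\<in>?S a. ?Y S c pc d pd + sg (pc * pd) (?Y S d pd c pc))"
    unfolding H_def by (rule elim_box_poly_leibniz[OF ba y(1,2) x vs c d])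
  have XY: "?X S c pc d pd = sg (r * q + pc * pd) (?Y ({..<k} - S) d pd c pc)"
    if S: "S \<in> ?S b" and c: "c \<in> G pc" and d: "d \<in> G pd" for S c pc d pd
  proof -
    have S: "S \<subseteq> {..<k}" "Suc (card S) = b" using S by auto
    note p = split_perms[OF S(1)]
    have "card S \<le> k" using card_mono[OF _ S(1)] by simp
    then have l: "Suc (length (sorted_list_of_set S)) = b" "Suc (length (co k S)) = a"
      using p(3,4) S(2) ab by auto
    have "{..<k} - ({..<k} - S) = S" using S(1) by blast
    then show ?thesis
      using crossterm_swap[OF p(5-7), unfolded l, OF x(1,3) y(1,3) vs c d] by simp
  qed
  \<comment> \<open>The sizes \<open>b - 1\<close> and \<open>a - 1\<close> add up to
    \<open>k\<close>.\<close>
  have bij: "bij_betw (\<lambda>S. {..<k} - S) (?S b) (?S a)"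
  proof (rule bij_betwI[where g = "\<lambda>S. {..<k} - S"])
    have "{..<k} - S \<in> ?S a'" if "S \<in> ?S b'" "a' + b' = Suc (Suc k)" for S a' b'
      using that card_mono[of "{..<k}" S] finite_subset[of S "{..<k}"] by (auto simp: card_Diff_subset)
    then show "(\<lambda>S. {..<k} - S) \<in> ?S b \<rightarrow> ?S a" "(\<lambda>S. {..<k} - S) \<in> ?S a \<rightarrow> ?S b"
      using ab ba by blast+
  qed auto
  have "(\<Sum>S\<in>?S b. ?X S c pc d pd + sg (pc * pd) (?X S d pd c pc))
      = (\<Sum>S\<in>?S b. sg (r * q) (?Y ({..<k} - S) c pc d pd + sg (pc * pd) (?Y ({..<k} - S) d pd c pc)))"
  proof (rule sum.cong[OF refl])
    fix S assume S: "S \<in> ?S b"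
    show "?X S c pc d pd + sg (pc * pd) (?X S d pd c pc)
        = sg (r * q) (?Y ({..<k} - S) c pc d pd + sg (pc * pd) (?Y ({..<k} - S) d pd c pc))"
      unfolding XY[OF S c d] XY[OF S d c] by (simp add: sg_add ac_simps)
  qed
  also have "\<dots> = sg (r * q) (\<Sum>S\<in>?S a. ?Y S c pc d pd + sg (pc * pd) (?Y S d pd c pc))"
    unfolding sg_sum[symmetric] by (subst sum.reindex_bij_betw[OF bij]) simp
  finally have X: "(\<Sum>S\<in>?S b. ?X S c pc d pd + sg (pc * pd) (?X S d pd c pc)) = \<dots>" .
  show "elim (Suc k) k (Pi.bracket_poly (Suc k) a b (r * q) x y (vs @ [c * d]))
      = elim (Suc k) k (Pi.bracket_poly (Suc k) a b (r * q) x y (vs @ [c])) * lconst d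
      + sg (pc * pd) (elim (Suc k) k (Pi.bracket_poly (Suc k) a b (r * q) x y (vs @ [d])) * lconst c)"
    unfolding Z[OF mult_G[OF c d]] Z[OF c] Z[OF d] F H X sg_add_1
    by (simp add: sg_add distrib_right sg_mult_left sg_diff left_diff_distrib algebra_simps)
qed

lemma leibniz_poly_bracket_poly:
  assumes "a + b = Suc n"
    and "Pi.cochain a x" "leibniz_poly a x" "Pi.has_parity a r x" and "Pi.cochain b y" "leibniz_poly b y" "Pi.has_parity b q y"
  shows "leibniz_poly n (Pi.bracket_poly n a b (r * q) x y)"
proof (cases n)
  case 0
  then show ?thesis by (simp add: leibniz_poly_def)
next
  case (Suc k)
  then show ?thesis
    using leibniz_poly_last_imp[OF Pi.cochain_bracket_poly leibniz_poly_last_bracket_poly] assms by blast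
qed

end

section \<open>The subalgebra\<close>

context diff_supermodule
begin

text \<open>The chosen representative of the zero class may be a nonzero polynomial, so vanishing
  can only be asked up to congruence.\<close>

definition null :: "nat \<Rightarrow> ('v list \<Rightarrow> 'v lpoly) \<Rightarrow> bool"
  where "null n x \<longleftrightarrow> (\<forall>vs\<in>args n. eqv n (x vs) 0)"

lemma nullD: "null n x \<Longrightarrow> length vs = n \<Longrightarrow> eqv n (x vs) 0"
  by (simp add: null_def args_def)

lemma wzero_mk: "wzero n = mk n (\<lambda>vs. 0)"
  by (simp add: wzero_def mk_def)

lemma mk_null_iff: "pval n x \<Longrightarrow> mk n x = wzero n \<longleftrightarrow> null n x"
  unfolding wzero_mk by (subst mk_eq_iff) (auto simp: pval_def null_def)

lemma null_rp: "null n (rp (wzero n))"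
  using rp_mk[of n "\<lambda>vs. 0"] by (simp add: wzero_mk null_def pval_def)

lemma box_summand_null_outer:
  assumes i: "is \<in> perms n" "a + b = Suc n" "b \<le> n" and x: "null a x" and ws: "length ws = n"
  shows "eqv n (box_summand b x y is ws) 0"
proof -
  have "eqv n (outer_val b x is (drop b ws) v) (lsubst (phi b is) 0)" for v
    unfolding outer_val_def
    by (intro eqv_lsubst[OF _ phi_sum[OF i]] nullD[OF x]) (use i ws in simp)
  then have "eqv n (outer_val b x is (drop b ws) v) 0" for v by simp
  then have "eqv n (box_summand b x y is ws) (evl (\<lambda>j. lvar (is ! j)) (\<lambda>v. 0) (y (take b ws)))"
    unfolding box_summand_def by (rule evl_eqv_cong)
  then show ?thesis by (simp add: evl_def ksum_def)
qed

lemma box_summand_null_inner: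
  assumes i: "is \<in> perms n" "a + b = Suc n" "b \<le> n" and x: "cochain a x" and y: "null b y" and ws: "length ws = n"
  shows "eqv n (box_summand b x y is ws) 0"
proof -
  have w: "length (drop b ws) + 1 = a" using i ws by simp
  have "eqv n (box_summand b x y is ws) (evl (\<lambda>j. lvar (is ! j)) (outer_val b x is (drop b ws)) 0)"
    unfolding box_summand_def
    by (rule additive_mod_evl_resp[OF outer_val_add[OF i cochainD(2)[OF x] w] outer_val_D[OF i cochainD(3)[OF x] w]])
      (rule nullD[OF y], use ws i in simp)
  then show ?thesis by simp
qed

lemma null_multi_ext_box_poly:
  assumes ab: "a + b = Suc n" and x: "cochain a x" and "null a x \<or> null b y"
  shows "null n (multi_ext n (box_poly n b x y))"
  unfolding null_def
proof
  fix vs :: "'v list" assume "vs \<in> args n"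
  have "eqv n (multi_ext n (box_poly n b x y) vs) (\<Sum>ps\<in>{ps :: bit list. length ps = n}. \<Sum>is\<in>unshuffles b n. 0)"
    unfolding multi_ext_def box_poly_def signed_summand_def
  proof (intro eqv_sum)
    fix ps :: "bit list" and "is" assume "is \<in> unshuffles b n"
    then have i: "is \<in> perms n" "b \<le> n" by (auto simp: unshuffles_def)
    have "eqv n (box_summand b x y is ws) 0" if "length ws = n" for ws
      using assms(3) box_summand_null_outer[OF i(1) ab i(2) _ that] box_summand_null_inner[OF i(1) ab i(2) x _ that] by blast
    from eqv_sg[OF this, of "map ((!) (map2 proj ps vs)) is" "epar ps is"]
    show "eqv n (sg (epar ps is) (box_summand b x y is (map ((!) (map2 proj ps vs)) is))) 0"
      using perms_bij(1)[OF i(1)] by simp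
  qed
  then show "eqv n (multi_ext n (box_poly n b x y) vs) 0" by simp
qed

lemma null_bracket_poly:
  assumes "a + b = Suc n" "cochain a x" "cochain b y" "null a x \<or> null b y"
  shows "null n (bracket_poly n a b s x y)"
proof -
  have "null n (multi_ext n (box_poly n b x y))" "null n (multi_ext n (box_poly n a y x))"
    using assms null_multi_ext_box_poly[of a b n x y] null_multi_ext_box_poly[of b a n y x] by (auto simp: add.commute)
  then have "eqv n (multi_ext n (box_poly n b x y) vs + sg (s + 1) (multi_ext n (box_poly n a y x) vs)) (0 + sg (s + 1) 0)"
    if "vs \<in> args n" for vs using that unfolding null_def by (intro eqv_add eqv_sg) auto
  then show ?thesis by (simp add: null_def bracket_poly_def)
qed

lemma null_component:
  assumes "null n x" shows "null n (component n q x)"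
  unfolding null_def component_def multi_ext_def
proof
  fix vs :: "'v list" assume vs: "vs \<in> args n"
  have "eqv n (\<Sum>ps\<in>{ps. length ps = n}. proj_poly (q + sum_list ps) (x (map2 proj ps vs))) (\<Sum>ps\<in>{ps :: bit list. length ps = n}. 0)"
  proof (intro eqv_sum)
    fix ps :: "bit list" assume "ps \<in> {ps. length ps = n}"
    then show "eqv n (proj_poly (q + sum_list ps) (x (map2 proj ps vs))) 0"
      using eqv_proj_poly[OF nullD[OF assms, of "map2 proj ps vs"], of "q + sum_list ps"] vs by (simp add: args_def)
  qed
  then show "eqv n (\<Sum>ps\<in>{ps. length ps = n}. proj_poly (q + sum_list ps) (x (map2 proj ps vs))) 0" by simp
qed

lemma wzero_W: "wzero n \<in> W n"
  unfolding wzero_mk by (rule mk_W[OF cochain_zero])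

lemma wproj_wzero: "wproj n q (wzero n) = wzero n"
  unfolding wproj_eq[OF wzero_W]
  using mk_null_iff[OF cochainD(1)[OF cochain_component]] null_component[OF null_rp] W_E(2)[OF wzero_W] by blast

lemma wproj_part:
  assumes "X \<in> W n" shows "wproj n q X \<in> W_part n q" "X = wadd n (wproj n q X) (wproj n (q + 1) X)"
proof -
  note x = W_E[OF assms]
  note p = cochainD(1)[OF cochain_component[OF x(2)]]
  show "wproj n q X \<in> W_part n q"
    unfolding wproj_eq[OF assms] using mk_W_part_iff cochain_component[OF x(2)] has_parity_component[OF x(2)] by blast
  show "X = wadd n (wproj n q X) (wproj n (q + 1) X)"
    unfolding wproj_eq[OF assms] wadd_mk[OF p p]
    using x(1) component_sum[OF x(2)]
    by (subst x(1)[symmetric], subst mk_eq_iff) (auto intro: pval_plus p cochainD x simp: args_def)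
qed

lemma wadd_W: "X \<in> W n \<Longrightarrow> Y \<in> W n \<Longrightarrow> wadd n X Y = mk n (\<lambda>vs. rp X vs + rp Y vs)"
  using wadd_mk[OF cochainD(1)[OF W_E(2)] cochainD(1)[OF W_E(2)], of X n Y] W_E(1) by metis

lemma wscale_mk: "pval n x \<Longrightarrow> wscale n c (mk n x) = mk n (\<lambda>vs. lconst c \<odot> x vs)"
  by (auto simp: wscale_def mk_def fun_eq_iff restrict_def qscale_cls pval_def)

lemma wscale_W: "X \<in> W n \<Longrightarrow> wscale n c X = mk n (\<lambda>vs. lconst c \<odot> rp X vs)"
  using wscale_mk[OF cochainD(1)[OF W_E(2)], of X n] W_E(1) by metis

lemma wbracket_mk:
  assumes ab: "a + b = Suc n" and X: "X \<in> W a" and Y: "Y \<in> W b"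
  shows "wbracket a b X Y = mk n (\<lambda>vs. \<Sum>(p, q)\<in>{0, 1} \<times> {0, 1}.
    bracket_poly n a b (p * q) (rp (wproj a p X)) (rp (wproj b q Y)) vs)"
proof -
  let ?x = "\<lambda>p. rp (wproj a p X)" and ?y = "\<lambda>q. rp (wproj b q Y)"
  have x: "cochain a (?x p)" for p using W_part_E(1)[OF wproj_part(1)[OF X]] .
  have y: "cochain b (?y q)" for q using W_part_E(1)[OF wproj_part(1)[OF Y]] .
  have ba: "b + a = Suc n" using ab by simp
  have n: "a + b - 1 = n" using ab by simp
  have psg: "lconst (- psign s) \<odot> P = sg (s + 1) P" for s P
    using psign_pact[of "s + 1"] by (simp add: psign_add) (simp add: psign_def)
  have t: "qadd n (box a b (wproj a p X) (wproj b q Y) vs) (qscale n (- psign (p * q)) (box b a (wproj b q Y) (wproj a p X) vs))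
      = cls n (bracket_poly n a b (p * q) (?x p) (?y q) vs)" if "vs \<in> args n" for vs p q
  proof -
    have "multi_ext n (box_poly n b (?x p) (?y q)) vs \<in> polys n" "multi_ext n (box_poly n a (?y q) (?x p)) vs \<in> polys n"
      using cochainD(1)[OF cochain_box(1)[OF ab x y]] cochainD(1)[OF cochain_box(1)[OF ba y x]] that
      by (auto simp: pval_def)
    then show ?thesis using that unfolding box_mk[OF ab] box_mk[OF ba]
      by (simp add: mk_def qscale_cls qadd_cls polys_pact psg polys_sg bracket_poly_def)
  qed
  then show ?thesis unfolding wbracket_def Let_def n mk_def
  proof (intro restrict_ext)
    fix vs :: "'v list" assume vs: "vs \<in> args n"
    have pb: "bracket_poly n a b s (?x p) (?y q) vs \<in> polys n" for s p q
      using cochainD(1)[OF cochain_bracket_poly[OF ab x y]] vs by (auto simp: pval_def)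
    have "qsum n (\<lambda>(p, q). cls n (bracket_poly n a b (p * q) (?x p) (?y q) vs)) ({0, 1} \<times> {0, 1})
        = cls n (\<Sum>(p, q)\<in>{0, 1} \<times> {0, 1}. bracket_poly n a b (p * q) (?x p) (?y q) vs)"
      unfolding case_prod_unfold by (rule qsum_cls) (rule pb)
    then show "qsum n (\<lambda>(p, q). qadd n (box a b (wproj a p X) (wproj b q Y) vs)
        (qscale n (- psign (p * q)) (box b a (wproj b q Y) (wproj a p X) vs))) ({0, 1} \<times> {0, 1})
        = cls n (\<Sum>(p, q)\<in>{0, 1} \<times> {0, 1}. bracket_poly n a b (p * q) (?x p) (?y q) vs)"
      using t[OF vs] by (simp only:)
  qed
qed

lemma qsum_mk: "(\<lambda>vs\<in>args n. qsum n (\<lambda>i. Z i vs) I) = mk n (\<lambda>vs. \<Sum>i\<in>I. rp (Z i) vs)"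
  by (simp add: mk_def qsum_def)

lemma null_sum: "(\<And>i. i \<in> I \<Longrightarrow> null n (f i)) \<Longrightarrow> null n (\<lambda>vs. \<Sum>i\<in>I. f i vs)"
  unfolding null_def using eqv_sum[of I n "\<lambda>i. f i _" "\<lambda>i. 0"] by simp

text \<open>This serves the finite support of a bracket in the direct sum. The parity components of
  a zero map vanish up to congruence, and a box product with such a factor does too.\<close>

lemma wbracket_wzero:
  assumes ab: "a + b = Suc n" and X: "X \<in> W a" and Y: "Y \<in> W b" and z: "X = wzero a \<or> Y = wzero b"
  shows "wbracket a b X Y = wzero n"
proof -
  let ?x = "\<lambda>p. rp (wproj a p X)" and ?y = "\<lambda>q. rp (wproj b q Y)"
  have x: "cochain a (?x p)" for p using W_part_E(1)[OF wproj_part(1)[OF X]] .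
  have y: "cochain b (?y q)" for q using W_part_E(1)[OF wproj_part(1)[OF Y]] .
  have "null a (?x p) \<or> null b (?y q)" for p q
    using z wproj_wzero null_rp by metis
  then have "null n (bracket_poly n a b s (?x p) (?y q))" for s p q by (rule null_bracket_poly[OF ab x y])
  then have "null n (\<lambda>vs. \<Sum>z\<in>{0, 1} \<times> {0, 1}. case z of (p, q) \<Rightarrow> bracket_poly n a b (p * q) (?x p) (?y q) vs)"
    by (intro null_sum) auto
  moreover have "pval n (\<lambda>vs. \<Sum>z\<in>{0, 1} \<times> {0, 1}. case z of (p, q) \<Rightarrow> bracket_poly n a b (p * q) (?x p) (?y q) vs)"
    by (intro cochainD(1)[OF cochain_sum]) (auto intro: cochain_bracket_poly[OF ab x y])
  ultimately show ?thesis unfolding wbracket_mk[OF ab X Y] by (simp add: mk_null_iff)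
qed

end

context comm_diff_superalgebra
begin

lemma leibniz_poly_plus:
  assumes "leibniz_poly n x" "leibniz_poly n y" shows "leibniz_poly n (\<lambda>vs. x vs + y vs)"
  unfolding leibniz_poly_def Let_def
proof (intro ballI allI impI, elim conjE)
  fix vs qs i b c pb pc
  assume "vs \<in> args n" and a: "Pi.homog qs vs" "i < n" "b \<in> G pb" "c \<in> G pc"
  then have vs: "length vs = n" by (simp add: args_def)
  let ?t = "\<Sum>j\<in>{Suc i..<n}. qs ! j"
  show "elim n i (x (vs[i := b * c]) + y (vs[i := b * c])) =
      sg (pc * ?t) (elim n i (x (vs[i := b]) + y (vs[i := b])) * lconst c)
      + sg (pb * (pc + ?t)) (elim n i (x (vs[i := c]) + y (vs[i := c])) * lconst b)"
    unfolding elim_add leibniz_polyD[OF assms(1) vs a] leibniz_polyD[OF assms(2) vs a] distrib_right sg_add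
    by (simp only: ac_simps)
qed

lemma leibniz_poly_smult: "leibniz_poly n x \<Longrightarrow> leibniz_poly n (\<lambda>vs. lconst a \<odot> x vs)"
  unfolding leibniz_poly_def Let_def elim_lconst_pact pact_mult_left pact_sg[symmetric] pact.scale_right_distrib[symmetric]
  by metis

lemma leibniz_poly_zero: "leibniz_poly n (\<lambda>vs. 0)"
  by (simp add: leibniz_poly_def)

lemma leibniz_poly_sum: "(\<And>i. i \<in> I \<Longrightarrow> leibniz_poly n (f i)) \<Longrightarrow> leibniz_poly n (\<lambda>vs. \<Sum>i\<in>I. f i vs)"
  by (induction I rule: infinite_finite_induct) (auto intro: leibniz_poly_zero leibniz_poly_plus)

lemma Was_mkI: "Pi.cochain n x \<Longrightarrow> leibniz_poly n x \<Longrightarrow> mk n x \<in> Was n"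
  using Was_mk Pi.cochainD(1) by blast

lemma proj_poly_mult_lconst:
  assumes "c \<in> G pc" shows "Pi.proj_poly (r + pc) (P * lconst c) = Pi.proj_poly r P * lconst c"
proof -
  have "Pi.proj (r + pc) (v * c) = Pi.proj r v * c" for v
  proof (rule Pi.proj_eqI)
    have m: "u * c \<in> rev_parity G (s + pc)" if "u \<in> rev_parity G s" for u s
      using mult_G[of u "s + 1" c pc] that assms by (simp add: rev_parity_def ac_simps)
    show "Pi.proj r v * c \<in> rev_parity G (r + pc)" by (rule m) (rule Pi.proj_G)
    show "v * c - Pi.proj r v * c \<in> rev_parity G (r + pc + 1)"
      using m[OF Pi.proj_compl, of v r] by (simp add: left_diff_distrib ac_simps)
  qed
  then show ?thesis
    by (intro poly_mapping_eqI) (simp add: Pi.lookup_proj_poly lookup_mult_lconst)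
qed

lemma sum_list_update_bit:
  "i < length qs \<Longrightarrow> sum_list (qs[i := p]) = sum_list (qs[i := 0]) + (p :: bit)"
  by (induction qs arbitrary: i) (auto simp: ac_simps split: nat.split)

text \<open>The subspace must be graded: a subsuperalgebra is required to contain the homogeneous
  parts of its elements, and the bracket is computed from them. The Leibniz rule survives because
  right multiplication by a homogeneous element only shifts parities.\<close>

lemma leibniz_poly_component:
  assumes x: "Pi.cochain n x" "leibniz_poly n x" shows "leibniz_poly n (Pi.component n q x)"
  unfolding leibniz_poly_def Let_def
proof (intro ballI allI impI, elim conjE)
  fix vs qs i b c pb pc
  assume "vs \<in> args n" and h: "Pi.homog qs vs" and i: "i < n" and b: "b \<in> G pb" and c: "c \<in> G pc"
  then have vs: "length vs = n" by (simp add: args_def)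
  let ?t = "\<Sum>j\<in>{Suc i..<n}. qs ! j"
  \<comment> \<open>The parity of the value when an even element of V stands at position
    \<open>i\<close>; an element of parity \<open>pu\<close> gives \<open>T + pu\<close>.\<close>
  define T where "T = q + sum_list (qs[i := 0]) + 1"
  have lqs: "length qs = n" using Pi.homog_length[OF h] vs by simp
  have e: "elim n i (Pi.component n q x (vs[i := u])) = Pi.proj_poly (T + pu) (elim n i (x (vs[i := u])))"
    if "u \<in> G pu" for u pu
  proof -
    have "Pi.homog (qs[i := pu + 1]) (vs[i := u])"
      using h that by (simp add: Pi.homog_def list_all2_update_cong rev_parity_def add.assoc)
    from elim_eqv[OF i Pi.component_homog[OF x(1) _ this, of q]] vs
    have "elim n i (Pi.component n q x (vs[i := u])) = Pi.proj_poly (q + sum_list (qs[i := pu + 1])) (elim n i (x (vs[i := u])))"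
      by (simp add: Pi.proj_poly_elim)
    moreover have "q + sum_list (qs[i := pu + 1]) = T + pu"
      using sum_list_update_bit[of i qs "pu + 1"] i lqs by (simp add: T_def ac_simps)
    ultimately show ?thesis by simp
  qed
  have s: "T + (pb + pc) = T + pb + pc" "T + (pb + pc) = T + pc + pb" by (simp_all add: ac_simps)
  have "Pi.proj_poly (T + (pb + pc)) (P * lconst c) = Pi.proj_poly (T + pb) P * lconst c" for P
    unfolding s(1) by (rule proj_poly_mult_lconst[OF c])
  moreover have "Pi.proj_poly (T + (pb + pc)) (P * lconst b) = Pi.proj_poly (T + pc) P * lconst b" for P
    unfolding s(2) by (rule proj_poly_mult_lconst[OF b])
  ultimately show "elim n i (Pi.component n q x (vs[i := b * c])) = sg (pc * ?t) (elim n i (Pi.component n q x (vs[i := b])) * lconst c)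
      + sg (pb * (pc + ?t)) (elim n i (Pi.component n q x (vs[i := c])) * lconst b)"
    unfolding e[OF mult_G[OF b c]] e[OF b] e[OF c] leibniz_polyD[OF x(2) vs h i b c]
    by (simp add: Pi.proj_poly_add Pi.proj_poly_sg)
qed

lemma wproj_Was: "X \<in> Was n \<Longrightarrow> Pi.wproj n q X \<in> Was n"
  unfolding Pi.wproj_eq[OF Was_W] by (intro Was_mkI Pi.cochain_component leibniz_poly_component Was_E)

lemma wadd_Was: "X \<in> Was n \<Longrightarrow> Y \<in> Was n \<Longrightarrow> wadd n X Y \<in> Was n"
  by (simp add: Pi.wadd_W[OF Was_W Was_W] Was_mkI Pi.cochain_plus leibniz_poly_plus Was_E)

lemma wscale_Was: "X \<in> Was n \<Longrightarrow> wscale n c X \<in> Was n"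
  by (simp add: Pi.wscale_W[OF Was_W] Was_mkI Pi.cochain_smult leibniz_poly_smult Was_E)

lemma wzero_Was: "wzero n \<in> Was n"
  unfolding wzero_mk by (intro Was_mkI Pi.cochain_zero leibniz_poly_zero)

lemma wbracket_Was:
  assumes ab: "a + b = Suc n" and X: "X \<in> Was a" and Y: "Y \<in> Was b"
  shows "Pi.wbracket a b X Y \<in> Was n"
  unfolding Pi.wbracket_mk[OF ab Was_W[OF X] Was_W[OF Y]]
proof (intro Was_mkI Pi.cochain_sum leibniz_poly_sum)
  fix z :: "bit \<times> bit"
  obtain p q where z: "z = (p, q)" by force
  note x = Was_E[OF wproj_Was[OF X]] Pi.W_part_E(2)[OF Pi.wproj_part(1)[OF Was_W[OF X]]]
  note y = Was_E[OF wproj_Was[OF Y]] Pi.W_part_E(2)[OF Pi.wproj_part(1)[OF Was_W[OF Y]]]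
  show "Pi.cochain n (\<lambda>vs. case z of (p, q) \<Rightarrow> Pi.bracket_poly n a b (p * q) (rp (Pi.wproj a p X)) (rp (Pi.wproj b q Y)) vs)"
    unfolding z split by (rule Pi.cochain_bracket_poly[OF ab x(1) y(1)])
  show "leibniz_poly n (\<lambda>vs. case z of (p, q) \<Rightarrow> Pi.bracket_poly n a b (p * q) (rp (Pi.wproj a p X)) (rp (Pi.wproj b q Y)) vs)"
    unfolding z split by (rule leibniz_poly_bracket_poly[OF ab x(1,2,4) y(1,2,4)])
qed

lemma qsum_Was:
  "(\<And>i. i \<in> I \<Longrightarrow> Z i \<in> Was n) \<Longrightarrow> (\<lambda>vs\<in>args n. qsum n (\<lambda>i. Z i vs) I) \<in> Was n"
  unfolding qsum_mk by (intro Was_mkI Pi.cochain_sum leibniz_poly_sum Was_E)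

lemma wadd_wzero: "wadd n (wzero n) (wzero n) = wzero n"
  by (auto simp: wzero_mk wadd_mk pval_def)

lemma wscale_wzero: "wscale n c (wzero n) = wzero n"
  by (auto simp: wscale_def wzero_def qscale_cls fun_eq_iff)

lemma subsuperalgebra_Was: "lie_subsuperalgebra (dsum Was) Pi.W_lie"
  unfolding lie_subsuperalgebra_def Pi.W_lie_def superspace_str.simps lie_str.simps
proof (intro conjI ballI allI)
  show "dsum Was \<subseteq> Pi.dsum Pi.W"
    by (auto simp: dsum_def Was_W)
  show "wzero \<in> dsum Was"
    by (simp add: dsum_def wzero_Was)
  fix X assume X: "X \<in> dsum Was"
  then have XW: "X n \<in> Was n" and Xf: "finite {n. X n \<noteq> wzero n}" for n by (auto simp: dsum_def)
  show "(\<lambda>n. wscale n c (X n)) \<in> dsum Was" for c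
  proof -
    have "{n. wscale n c (X n) \<noteq> wzero n} \<subseteq> {n. X n \<noteq> wzero n}" using wscale_wzero by auto
    from finite_subset[OF this Xf] show ?thesis by (simp add: dsum_def wscale_Was XW)
  qed
  have p: "(\<lambda>n. Pi.wproj n q (X n)) \<in> dsum Was \<inter> Pi.dsum (\<lambda>n. Pi.W_part n q)" for q
  proof -
    have "{n. Pi.wproj n q (X n) \<noteq> wzero n} \<subseteq> {n. X n \<noteq> wzero n}" using Pi.wproj_wzero by auto
    from finite_subset[OF this Xf] show ?thesis
      by (simp add: dsum_def wproj_Was XW Pi.wproj_part(1)[OF Was_W[OF XW]])
  qed
  show "\<exists>x0\<in>dsum Was \<inter> Pi.dsum (\<lambda>n. Pi.W_part n 0). \<exists>x1\<in>dsum Was \<inter> Pi.dsum (\<lambda>n. Pi.W_part n 1).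
      X = (\<lambda>n. wadd n (x0 n) (x1 n))"
    using Pi.wproj_part(2)[OF Was_W[OF XW], of _ 0] by (intro bexI[OF _ p]) auto
  fix Y assume Y: "Y \<in> dsum Was"
  then have YW: "Y n \<in> Was n" and Yf: "finite {n. Y n \<noteq> wzero n}" for n by (auto simp: dsum_def)
  have "{n. wadd n (X n) (Y n) \<noteq> wzero n} \<subseteq> {n. X n \<noteq> wzero n} \<union> {n. Y n \<noteq> wzero n}"
    using wadd_wzero by auto
  from finite_subset[OF this] show "(\<lambda>n. wadd n (X n) (Y n)) \<in> dsum Was"
    using Xf Yf by (auto simp: dsum_def wadd_Was XW YW)
  let ?B = "\<lambda>n. \<lambda>vs\<in>args n. qsum n (\<lambda>a. Pi.wbracket a (n + 1 - a) (X a) (Y (n + 1 - a)) vs) {..n + 1}"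
  have B: "?B n \<in> Was n" for n
    by (rule qsum_Was) (rule wbracket_Was, use XW YW in auto)
  obtain N where N: "\<And>n. n \<ge> N \<Longrightarrow> X n = wzero n" "\<And>n. n \<ge> N \<Longrightarrow> Y n = wzero n"
  proof -
    obtain k l where "\<forall>n\<in>{n. X n \<noteq> wzero n}. n < k" "\<forall>n\<in>{n. Y n \<noteq> wzero n}. n < l"
      using Xf Yf unfolding finite_nat_set_iff_bounded by blast
    then have "X n = wzero n \<and> Y n = wzero n" if "k + l \<le> n" for n
      using that by (metis (mono_tags) add_leD1 add_leD2 mem_Collect_eq not_less)
    then show thesis by (intro that) auto
  qed
  \<comment> \<open>For such \<open>n\<close> one of the indices \<open>a\<close> and
    \<open>n + 1 - a\<close> is at least \<open>N\<close>, so every summand has a zero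
    factor.\<close>
  have "?B n = wzero n" if "n \<ge> 2 * N" for n
  proof -
    have z: "Pi.wbracket a (n + 1 - a) (X a) (Y (n + 1 - a)) = wzero n" if "a \<in> {..n + 1}" for a
    proof (rule Pi.wbracket_wzero)
      show "X a = wzero a \<or> Y (n + 1 - a) = wzero (n + 1 - a)"
        using N \<open>n \<ge> 2 * N\<close> that by (cases "a \<ge> N") auto
    qed (use that XW YW Was_W in auto)
    have "?B n = (\<lambda>vs\<in>args n. qsum n (\<lambda>a. wzero n vs) {..n + 1})"
      unfolding qsum_def
      by (intro restrict_ext arg_cong[of _ _ "cls n"] sum.cong refl) (simp only: z)
    also have "\<dots> = wzero n"
      unfolding qsum_mk
    proof (subst mk_null_iff)
      show "pval n (\<lambda>vs. \<Sum>a\<in>{..n + 1}. rp (wzero n) vs)"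
        by (intro Pi.cochainD(1)[OF Pi.cochain_sum] Pi.W_E(2) Pi.wzero_W)
      show "null n (\<lambda>vs. \<Sum>a\<in>{..n + 1}. rp (wzero n) vs)"
        by (intro null_sum null_rp)
    qed
    finally show ?thesis .
  qed
  then have "{n. ?B n \<noteq> wzero n} \<subseteq> {..<2 * N}" by (auto simp: not_less[symmetric])
  from finite_subset[OF this] show "?B \<in> dsum Was"
    unfolding dsum_def using B by simp
qed

end

section \<open>Degrees \<open>-1\<close> and \<open>0\<close>\<close>

lemma args_0 [simp]: "vs \<in> args 0 \<longleftrightarrow> vs = []"
  by (simp add: args_def)

lemma args_1_iff: "vs \<in> args 1 \<longleftrightarrow> (\<exists>v. vs = [v])"
  by (auto simp: args_def length_Suc_conv)

section \<open>Degree -1: maps without arguments\<close>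

context diff_supermodule
begin

text \<open>Without variables the total derivative is the derivation itself, so classes of constants
  correspond to cosets of its image.\<close>

lemma eqv_0_lconst: "eqv 0 (lconst u) (lconst v) \<longleftrightarrow> (\<exists>w. u = v + D w)"
proof
  assume "eqv 0 (lconst u) (lconst v)"
  then obtain R where R: "lconst u - lconst v = D_poly R" by (auto simp: eqv_def total_D_def)
  have "u - v = D (lk R 0)"
    using arg_cong[OF R, of "\<lambda>P. lk P 0"] by (simp add: lookup_minus lookup_lconst lookup_D_poly)
  then show "\<exists>w. u = v + D w" by (metis add.commute diff_add_cancel)
next
  assume "\<exists>w. u = v + D w"
  then obtain w where w: "u = v + D w" by blast
  have "lconst u - lconst v = total_D 0 (lconst w)" by (simp add: w total_D_def lconst_add)
  then show "eqv 0 (lconst u) (lconst v)" by (simp add: eqv_def)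
qed

lemma dcoset_eq_iff: "dcoset u = dcoset v \<longleftrightarrow> (\<exists>w. u = v + D w)"
proof
  assume e: "dcoset u = dcoset v"
  have "u + D 0 \<in> dcoset u" unfolding dcoset_def by blast
  then show "\<exists>w. u = v + D w" unfolding e by (auto simp: dcoset_def)
next
  assume "\<exists>w. u = v + D w"
  then obtain w where w: "u = v + D w" by blast
  have "u + D z = v + D (w + z)" "v + D z = u + D (z - w)" for z
    by (simp_all add: w D_add D_diff)
  then have "dcoset u \<subseteq> dcoset v" "dcoset v \<subseteq> dcoset u" unfolding dcoset_def by blast+
  then show "dcoset u = dcoset v" by (rule equalityI)
qed

lemma rep_dcoset: "\<exists>w. rep (dcoset v) = v + D w"
proof -
  have "v + D 0 \<in> dcoset v" unfolding dcoset_def by blast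
  then have "rep (dcoset v) \<in> dcoset v" unfolding rep_def by (rule someI)
  then show ?thesis by (auto simp: dcoset_def)
qed

lemma polys_0_iff: "(P :: 'v lpoly) \<in> polys 0 \<longleftrightarrow> (\<exists>v. P = lconst v)"
proof
  assume "P \<in> polys 0"
  then show "\<exists>v. P = lconst v"
    by (induction P rule: lpoly_induct) (auto simp flip: lconst_add)
qed auto

definition const_cochain :: "'v \<Rightarrow> 'v list \<Rightarrow> 'v lpoly set" where "const_cochain v = mk 0 (\<lambda>vs. lconst v)"

lemma cochain_const_cochain: "cochain 0 (\<lambda>vs. lconst v)"
  by (auto simp: cochain_def pval_def multi_def sesq_def sym_on_def permutations_of_set_empty)

lemma W_0_const_cochain: "X \<in> W 0 \<Longrightarrow> \<exists>v. X = const_cochain v"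
proof -
  assume "X \<in> W 0"
  note x = W_E[OF this]
  have "rp X [] \<in> polys 0" using cochainD(1)[OF x(2)] by (simp add: pval_def)
  then obtain v where "rp X [] = lconst v" by (auto simp: polys_0_iff)
  then have "mk 0 (rp X) = const_cochain v" by (auto simp: const_cochain_def mk_def restrict_def fun_eq_iff)
  then show "\<exists>v. X = const_cochain v" using x(1) by auto
qed

lemma const_cochain_eq_iff: "const_cochain u = const_cochain v \<longleftrightarrow> dcoset u = dcoset v"
  unfolding const_cochain_def dcoset_eq_iff by (subst mk_eq_iff) (auto simp: pval_def eqv_0_lconst)

lemma ident_const_cochain: "W_minus1_ident (const_cochain v) = dcoset v"
proof -
  have "const_cochain v [] = {lconst u | u. \<exists>w. u = v + D w}"
    by (auto simp: const_cochain_def mk_def cls_eq polys_0_iff eqv_0_lconst)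
  then have "W_minus1_ident (const_cochain v) = (\<lambda>P. lk P 0) ` {lconst u | u. \<exists>w. u = v + D w}"
    by (simp add: W_minus1_ident_def)
  also have "\<dots> = dcoset v"
    by (auto simp: dcoset_def image_iff lookup_lconst) (metis lookup_lconst)
  finally show ?thesis .
qed

lemma const_cochain_part: "v \<in> G q \<Longrightarrow> const_cochain v \<in> W_part 0 q"
  unfolding const_cochain_def by (subst mk_W_part_iff[OF cochain_const_cochain]) (auto simp: has_parity_def homog_def proj_id)

lemma const_cochain_part_proj:
  assumes "const_cochain v \<in> W_part 0 q" shows "dcoset v = dcoset (proj q v)"
proof -
  have "has_parity 0 q (\<lambda>vs. lconst v)" using assms mk_W_part_iff[OF cochain_const_cochain] by (simp add: const_cochain_def)
  then have "eqv 0 (lconst v) (proj_poly q (lconst v))" unfolding has_parity_def by (auto simp: homog_def)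
  then show ?thesis by (simp add: eqv_0_lconst dcoset_eq_iff)
qed

end

context comm_diff_superalgebra
begin

lemma const_cochain_Was: "const_cochain v \<in> Was 0"
  unfolding const_cochain_def by (rule Was_mkI[OF Pi.cochain_const_cochain]) (simp add: leibniz_poly_def)

lemma W_minus1_iso: "superspace_iso W_minus1_ident Was_minus1 Pi.V_mod_D"
  unfolding superspace_iso_def Was_minus1_def Pi.V_mod_D_def superspace_str.simps
proof (intro conjI ballI allI)
  have Was_0: "\<exists>v. X = const_cochain v" if "X \<in> Was 0" for X using Pi.W_0_const_cochain[OF Was_W[OF that]] .
  show "bij_betw W_minus1_ident (Was 0) (range dcoset)"
    unfolding bij_betw_def
  proof
    show "inj_on W_minus1_ident (Was 0)"
      by (rule inj_onI) (metis Was_0 ident_const_cochain const_cochain_eq_iff)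
    show "W_minus1_ident ` Was 0 = range dcoset"
      using Was_0 ident_const_cochain const_cochain_Was by (auto simp: image_iff) metis+
  qed
  show "W_minus1_ident ` (Was 0 \<inter> Pi.W_part 0 q) = Pi.dcoset ` rev_parity G q" for q
  proof (intro set_eqI iffI)
    fix A assume "A \<in> W_minus1_ident ` (Was 0 \<inter> Pi.W_part 0 q)"
    then obtain v where v: "A = W_minus1_ident (const_cochain v)" "const_cochain v \<in> Pi.W_part 0 q" using Was_0 by blast
    have "A = dcoset (Pi.proj q v)" using v Pi.const_cochain_part_proj[OF v(2)] ident_const_cochain by simp
    then show "A \<in> Pi.dcoset ` rev_parity G q" using Pi.proj_G by blast
  next
    fix A assume "A \<in> Pi.dcoset ` rev_parity G q"
    then obtain v where "v \<in> rev_parity G q" "A = W_minus1_ident (const_cochain v)" by (auto simp: ident_const_cochain)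
    then show "A \<in> W_minus1_ident ` (Was 0 \<inter> Pi.W_part 0 q)" using Pi.const_cochain_part const_cochain_Was by blast
  qed
  fix X assume "X \<in> Was 0"
  then obtain u where u: "X = const_cochain u" using Was_0 by blast
  obtain w where w: "rep (dcoset u) = u + D w" using rep_dcoset by blast
  have "wscale 0 a (const_cochain u) = const_cochain (scale a u)" for a
    unfolding const_cochain_def by (subst wscale_mk) (auto simp: pval_def)
  then show "W_minus1_ident (wscale 0 a X) = Pi.dcoset (scale a (rep (W_minus1_ident X)))" for a
    using w by (simp add: u ident_const_cochain dcoset_eq_iff scale_right_distrib)
      (metis D_scale add.right_neutral add_diff_cancel_right' diff_add_cancel D_diff diff_0 minus_diff_eq uminus_add_conv_diff)
  fix Y assume "Y \<in> Was 0"
  then obtain v where v: "Y = const_cochain v" using Was_0 by blast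
  obtain z where z: "rep (dcoset v) = v + D z" using rep_dcoset by blast
  have "wadd 0 (const_cochain u) (const_cochain v) = const_cochain (u + v)"
    unfolding const_cochain_def by (subst wadd_mk) (auto simp: pval_def lconst_add)
  moreover have "dcoset (u + v) = dcoset (u + D w + (v + D z))"
  proof -
    have "u + v = (u + D w + (v + D z)) + D (- (w + z))" using D_diff[of 0 "w + z"] by (simp add: D_add)
    then show ?thesis unfolding dcoset_eq_iff by blast
  qed
  ultimately show "W_minus1_ident (wadd 0 X Y) = Pi.dcoset (rep (W_minus1_ident X) + rep (W_minus1_ident Y))"
    using w z by (simp add: u v ident_const_cochain)
qed

end

section \<open>Degree 0: maps of one argument as endomorphisms\<close>

declare One_nat_def [simp del]

lemma lessThan_1 [simp]: "{..<1 :: nat} = {0}"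
  by auto

lemma ball_args_1: "(\<forall>vs\<in>args 1. Q vs) \<longleftrightarrow> (\<forall>v. Q [v])"
  by (auto simp: args_1_iff)

context diff_supermodule
begin

lemma osum_1: "osum 1 0 = 0"
  by (simp add: osum_def lessThan_1)

lemma lsubst_id: "lsubst lvar P = P"
  by (induction P rule: lpoly_induct_all) (simp_all add: lsubst_add lsubst_lvar)

text \<open>With a single variable the elimination puts \<lambda>_0 = - \<partial>, so the
  identification \<open>W_0_ident\<close> reads off the normal form.\<close>

lemma elim_1: "P \<in> polys 1 \<Longrightarrow> elim 1 0 P = lconst (ksum (\<lambda>m. (\<lambda>u. - D u) ^^ lk m 0) P)"
proof (induction P rule: lpoly_induct)
  case (const v)
  have "((\<lambda>u. - D u) ^^ k) 0 = 0" for k by (induction k) auto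
  then have "ksum (\<lambda>m. (\<lambda>u. - D u) ^^ lk m 0) (lconst v) = v"
    unfolding lconst_def by (subst ksum_single) auto
  then show ?case by simp
next
  case (add P Q)
  have "((\<lambda>u. - D u) ^^ k) (u + v) = ((\<lambda>u. - D u) ^^ k) u + ((\<lambda>u. - D u) ^^ k) v" for k u v
    by (induction k) (auto simp: D_add)
  then have "ksum (\<lambda>m. (\<lambda>u. - D u) ^^ lk m 0) (P + Q)
      = ksum (\<lambda>m. (\<lambda>u. - D u) ^^ lk m 0) P + ksum (\<lambda>m. (\<lambda>u. - D u) ^^ lk m 0) Q"
    by (intro ksum_add)
  then show ?case by (simp only: elim_add add.IH lconst_add)
next
  case (lvar i P)
  then have i: "i = 0" by simp
  have s: "- D (sum f A) = (\<Sum>x\<in>A. - D (f x))" for f :: "(nat \<Rightarrow>\<^sub>0 nat) \<Rightarrow> 'v" and A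
    by (induction A rule: infinite_finite_induct) (auto simp: D_add)
  have "ksum (\<lambda>m. (\<lambda>u. - D u) ^^ lk m 0) (lvar 0 \<odot> P) = - D (ksum (\<lambda>m. (\<lambda>u. - D u) ^^ lk m 0) P)"
    unfolding ksum_lvar_pact by (simp add: ksum_def lookup_add s plus_1_eq_Suc)
  then show ?case unfolding i elim_lvar_same lvar.IH
    by (simp add: elim_op_def osum_1 lconst_uminus)
qed

text \<open>The inverse of the identification: a constant polynomial is its own normal form.\<close>

definition endo_cochain :: "('v \<Rightarrow> 'v) \<Rightarrow> 'v list \<Rightarrow> 'v lpoly" where "endo_cochain d vs = lconst (d (hd vs))"

lemma pval_endo_cochain: "pval n (endo_cochain d)"
  by (simp add: pval_def endo_cochain_def)

lemma eqv_1_lconst: "eqv 1 (lconst u) (lconst v) \<longleftrightarrow> u = v"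
  using eqv_iff_elim[of 0 1 "lconst u" "lconst v"] by simp

lemma W_0_ident_elim: "pval 1 (rp X) \<Longrightarrow> elim 1 0 (rp X [v]) = lconst (W_0_ident X v)"
  unfolding W_0_ident_def Let_def by (subst elim_1) (auto simp: pval_def args_1_iff ksum_def)

lemma W_1_endo_cochain: "X \<in> W 1 \<Longrightarrow> X = mk 1 (endo_cochain (W_0_ident X))"
proof -
  assume "X \<in> W 1"
  note x = W_E[OF this]
  note p = cochainD(1)[OF x(2)]
  have "mk 1 (rp X) = mk 1 (endo_cochain (W_0_ident X))"
    unfolding mk_eq_iff[OF p pval_endo_cochain]
  proof
    fix vs :: "'v list" assume "vs \<in> args 1"
    then obtain v where "vs = [v]" by (auto simp: args_1_iff)
    then show "eqv 1 (rp X vs) (endo_cochain (W_0_ident X) vs)"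
      unfolding endo_cochain_def using eqv_elim[of 0 1 "rp X [v]"] W_0_ident_elim[OF p, of v] by simp
  qed
  then show "X = mk 1 (endo_cochain (W_0_ident X))" using x(1) by simp
qed

lemma ident_endo_cochain: "W_0_ident (mk 1 (endo_cochain d)) = d"
proof
  fix v
  have e: "eqv 1 (rp (mk 1 (endo_cochain d)) [v]) (lconst (d v))"
    using rp_mk[OF pval_endo_cochain, of "[v]" 1] by (simp add: endo_cochain_def)
  have "pval 1 (rp (mk 1 (endo_cochain d)))"
    unfolding pval_def mk_def using rep_cls(1) by (simp add: endo_cochain_def)
  from W_0_ident_elim[OF this, of v] e show "W_0_ident (mk 1 (endo_cochain d)) v = d v"
    by (simp add: elim_eqv[of 0 1])
qed

lemma cochain_endo_cochain_iff:
  "cochain 1 (endo_cochain d) \<longleftrightarrow> Vector_Spaces.linear scale scale d \<and> (\<forall>v. d (D v) = D (d v))"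
proof -
  have "multi 1 (endo_cochain d) \<longleftrightarrow> (\<forall>c u w. d (scale c u + w) = scale c (d u) + d w)"
    unfolding multi_def ball_args_1 by (simp add: endo_cochain_def eqv_1_lconst[simplified] flip: lconst_add)
  also have "\<dots> \<longleftrightarrow> Vector_Spaces.linear scale scale d"
  proof
    assume l: "\<forall>c u w. d (scale c u + w) = scale c (d u) + d w"
    have add: "d (u + w) = d u + d w" for u w using l[rule_format, of 1 u w] by simp
    have "d 0 = 0" using add[of 0 0] by simp
    then have "d (scale c u) = scale c (d u)" for c u using l[rule_format, of c u 0] by simp
    with add show "Vector_Spaces.linear scale scale d"
      by (auto simp: Vector_Spaces.linear_iff vector_space_axioms)
  qed (simp add: Vector_Spaces.linear_iff)
  finally have m: "multi 1 (endo_cochain d) \<longleftrightarrow> Vector_Spaces.linear scale scale d" .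
  have "eqv 1 (lconst (d (D v))) (- (lvar 0 \<odot> lconst (d v))) \<longleftrightarrow> d (D v) = D (d v)" for v
    using eqv_iff_elim[of 0 1 "lconst (d (D v))" "- (lvar 0 \<odot> lconst (d v))"]
    by (simp add: elim_minus elim_lvar_same elim_op_def osum_1)
  then have s: "sesq 1 (endo_cochain d) \<longleftrightarrow> (\<forall>v. d (D v) = D (d v))"
    unfolding sesq_def ball_args_1 by (simp add: endo_cochain_def)
  have "perms 1 = {[0]}" by (simp add: lessThan_1)
  then have "sym_on 1 (endo_cochain d)" unfolding sym_on_def ball_args_1 by (simp add: endo_cochain_def)
  then show ?thesis using m s pval_endo_cochain by (auto simp: cochain_def)
qed

lemma has_parity_endo_cochain_iff: "has_parity 1 q (endo_cochain d) \<longleftrightarrow> (\<forall>p. \<forall>v\<in>G p. d v \<in> G (q + p))"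
proof -
  have h: "(\<forall>ps. homog ps [v] \<longrightarrow> Q ps) \<longleftrightarrow> (\<forall>p. v \<in> G p \<longrightarrow> Q [p])" for v Q
    by (auto simp: homog_def list_all2_Cons2)
  have "proj r u = u \<longleftrightarrow> u \<in> G r" for r u using proj_id proj_G by metis
  then have "eqv 1 (lconst u) (lconst (proj r u)) \<longleftrightarrow> u \<in> G r" for r u
    unfolding eqv_1_lconst by metis
  then show ?thesis unfolding has_parity_def ball_args_1 h by (simp add: endo_cochain_def) blast
qed

text \<open>For one argument there is a single unshuffle, the outer map receives the normal form of
  the inner value, and the box product becomes composition of endomorphisms.\<close>

lemma elim_box_1:
  assumes x: "cochain 1 x" and y: "cochain 1 y" and dx: "\<And>v. elim 1 0 (x [v]) = lconst (dx v)"
    and dy: "\<And>v. elim 1 0 (y [v]) = lconst (dy v)"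
  shows "elim 1 0 (multi_ext 1 (box_poly 1 1 x y) [v]) = lconst (dx (dy v))"
proof -
  have ab: "1 + 1 = Suc 1" by simp
  have u: "unsh 1 {0} = [0]" by (simp add: unsh_def lessThan_1)
  have "S \<subseteq> {0} \<and> card S = 1 \<longleftrightarrow> S = {0}" for S :: "nat set"
    unfolding subset_singleton_iff by auto
  then have "{S. S \<subseteq> {..<1 :: nat} \<and> card S = 1} = {{0}}"
    unfolding lessThan_1 by blast
  then have box_poly: "box_poly 1 1 x y ps vs = signed_summand 1 x y ps vs [0]" for ps vs by (simp add: box_poly_sum u)
  have i: "[0] \<in> perms 1" by (simp add: lessThan_1)
  have t: "elim 1 0 (box_summand 1 x y [0] [v]) = lconst (dx (dy v))" for v
  proof -
    note g = outer_val_add[OF i ab order_refl cochainD(2)[OF x], of "[]"] outer_val_D[OF i ab order_refl cochainD(3)[OF x], of "[]"]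
    have "eqv 1 (y [v]) (lconst (dy v))" using eqv_elim[of 0 1 "y [v]"] dy by simp
    then have "eqv 1 (evl (\<lambda>j. lvar ([0] ! j)) (outer_val 1 x [0] []) (y [v])) (evl (\<lambda>j. lvar ([0] ! j)) (outer_val 1 x [0] []) (lconst (dy v)))"
      by (intro additive_mod_evl_resp[OF g]) auto
    also have "eqv 1 \<dots> (outer_val 1 x [0] [] (dy v))" by (rule additive_mod_evl_lconst[OF g(1)]) simp
    also have "outer_val 1 x [0] [] (dy v) = lsubst lvar (x [dy v])"
      unfolding outer_val_def by (rule lsubst_cong[of _ 1]) (use cochainD(1)[OF x] in \<open>auto simp: phi_0 intro!: pvalD\<close>)
    also have "\<dots> = x [dy v]"
      by (rule lsubst_id)
    finally show ?thesis by (simp add: box_summand_def elim_eqv[of 0 1] dx)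
  qed
  have add: "d' (u + v) = d' u + d' v" if "cochain 1 z" "\<And>v. elim 1 0 (z [v]) = lconst (d' v)" for z d' u v
    using elim_eqv[OF zero_less_one multi_add[OF cochainD(2)[OF that(1)], of "[0]" 0 u v]]
    by (simp add: elim_add that(2) flip: lconst_add)
  have "{ps :: bit list. length ps = 1} = {[0], [1]}"
  proof -
    have "[p] \<in> {[0], [1]}" for p :: bit by (cases p) auto
    then show ?thesis by (auto simp: One_nat_def length_Suc_conv)
  qed
  then have "elim 1 0 (multi_ext 1 (box_poly 1 1 x y) [v]) = lconst (dx (dy (proj 0 v))) + lconst (dx (dy (proj 1 v)))"
    by (simp add: multi_ext_def box_poly signed_summand_def elim_add t)
  also have "\<dots> = lconst (dx (dy (proj 0 v + proj 1 v)))"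
    by (simp only: add[OF x dx] add[OF y dy] lconst_add)
  finally show ?thesis using proj_sum[of 0 v] by simp
qed

end

context comm_diff_superalgebra
begin

text \<open>The Leibniz rule for maps puts both values of \<open>d\<close> on the left, while a
  derivation has the term \<open>x * d y\<close>. Supercommutativity exchanges the two on
  homogeneous arguments, and additivity extends the rule to an arbitrary second factor.\<close>

lemma Der_part_iff:
  "d \<in> Der_part q \<longleftrightarrow> Vector_Spaces.linear scale scale d \<and> (\<forall>v. d (D v) = D (d v)) \<and>
    (\<forall>p. \<forall>v\<in>G p. d v \<in> G (q + p)) \<and>
    (\<forall>b c pb pc. b \<in> G pb \<and> c \<in> G pc \<longrightarrow> d (b * c) = d b * c + sg (pb * pc) (d c * b))"
proof -
  have sw: "sg (pb * pc) (d c * b) = scale (psign (q * pb)) (b * d c)"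
    if "\<forall>p. \<forall>v\<in>G p. d v \<in> G (q + p)" "b \<in> G pb" "c \<in> G pc" for b c pb pc
  proof -
    have "d c * b = sg ((q + pc) * pb) (b * d c)"
      using supercomm[of "d c" "q + pc" b pb] that by (simp add: psign_scale)
    then show ?thesis by (simp add: psign_scale algebra_simps)
  qed
  show ?thesis
  proof
    assume d: "d \<in> Der_part q"
    then have par: "\<forall>p. \<forall>v\<in>G p. d v \<in> G (q + p)" by (simp add: Der_part_def)
    have "d (b * c) = d b * c + sg (pb * pc) (d c * b)" if "b \<in> G pb" "c \<in> G pc" for b c pb pc
      using d that unfolding sw[OF par that] by (simp add: Der_part_def)
    then show "Vector_Spaces.linear scale scale d \<and> (\<forall>v. d (D v) = D (d v)) \<and>
        (\<forall>p. \<forall>v\<in>G p. d v \<in> G (q + p)) \<and>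
        (\<forall>b c pb pc. b \<in> G pb \<and> c \<in> G pc \<longrightarrow> d (b * c) = d b * c + sg (pb * pc) (d c * b))"
      using d by (auto simp: Der_part_def)
  next
    assume a: "Vector_Spaces.linear scale scale d \<and> (\<forall>v. d (D v) = D (d v)) \<and>
        (\<forall>p. \<forall>v\<in>G p. d v \<in> G (q + p)) \<and>
        (\<forall>b c pb pc. b \<in> G pb \<and> c \<in> G pc \<longrightarrow> d (b * c) = d b * c + sg (pb * pc) (d c * b))"
    then have par: "\<forall>p. \<forall>v\<in>G p. d v \<in> G (q + p)" and add: "d (u + v) = d u + d v" for u v
      by (auto simp: Vector_Spaces.linear_iff)
    have h: "d (x * y) = d x * y + scale (psign (q * p)) (x * d y)" if "x \<in> G p" "y \<in> G r" for x y p r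
      using a that unfolding sw[OF par that, symmetric] by blast
    have "d (x * y) = d x * y + scale (psign (q * p)) (x * d y)" if x: "x \<in> G p" for x y p
    proof -
      have "d (x * (proj 0 y + proj 1 y)) = d x * (proj 0 y + proj 1 y) + scale (psign (q * p)) (x * d (proj 0 y + proj 1 y))"
        unfolding distrib_left add h[OF x proj_G] by (simp add: scale_right_distrib)
      then show ?thesis using proj_sum[of 0 y] by simp
    qed
    then show "d \<in> Der_part q" using a by (simp add: Der_part_def)
  qed
qed

lemma leibniz_poly_endo_cochain_iff:
  "leibniz_poly 1 (endo_cochain d) \<longleftrightarrow> (\<forall>b c pb pc. b \<in> G pb \<and> c \<in> G pc \<longrightarrow> d (b * c) = d b * c + sg (pb * pc) (d c * b))"
proof -
  have m: "lconst u * lconst v = lconst (u * v)" "sg p (lconst u) = lconst (sg p u)" for u v :: 'v and p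
    by (simp_all add: lconst_mult sg_def lconst_uminus)
  have h: "Pi.homog [0] [0]" by (simp add: Pi.homog_def)
  have "leibniz_poly 1 (endo_cochain d) \<longleftrightarrow> (\<forall>v qs b c pb pc. Pi.homog qs [v] \<and> b \<in> G pb \<and> c \<in> G pc \<longrightarrow>
      d (b * c) = d b * c + sg (pb * pc) (d c * b))"
    unfolding leibniz_poly_def Let_def ball_args_1 by (simp add: endo_cochain_def m flip: lconst_add)
  also have "\<dots> \<longleftrightarrow> (\<forall>b c pb pc. b \<in> G pb \<and> c \<in> G pc \<longrightarrow> d (b * c) = d b * c + sg (pb * pc) (d c * b))"
    using h by blast
  finally show ?thesis .
qed

text \<open>Reversing the parity shifts argument and value alike, so an endomorphism has the same
  parity for \<Pi>V and for V.\<close>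

lemma endo_cochain_part_iff: "mk 1 (endo_cochain d) \<in> Was 1 \<and> mk 1 (endo_cochain d) \<in> Pi.W_part 1 q \<longleftrightarrow> d \<in> Der_part q"
proof -
  have "Pi.has_parity 1 q (endo_cochain d) \<longleftrightarrow> (\<forall>p. \<forall>v\<in>G p. d v \<in> G (q + p))"
    unfolding Pi.has_parity_endo_cochain_iff rev_parity_def
    by (metis (no_types) add.assoc bit_add_self add.right_neutral)
  then show ?thesis
    unfolding Was_mk[OF pval_endo_cochain] Der_part_iff leibniz_poly_endo_cochain_iff[symmetric] Pi.cochain_endo_cochain_iff[symmetric] conj_assoc[symmetric]
    using Pi.mk_W_part_iff Pi.cochain_endo_cochain_iff by blast
qed

lemma Der_part_ident:
  assumes "X \<in> Was 1" "X \<in> Pi.W_part 1 q" shows "W_0_ident X \<in> Der_part q"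
proof -
  have "X = mk 1 (endo_cochain (W_0_ident X))" by (rule Pi.W_1_endo_cochain[OF Was_W[OF assms(1)]])
  then show ?thesis using assms endo_cochain_part_iff[of "W_0_ident X" q] by simp
qed

lemma ident_wadd:
  assumes "X \<in> Was 1" "Y \<in> Was 1" shows "W_0_ident (wadd 1 X Y) = (\<lambda>v. W_0_ident X v + W_0_ident Y v)"
proof -
  have "wadd 1 (mk 1 (endo_cochain (W_0_ident X))) (mk 1 (endo_cochain (W_0_ident Y))) = mk 1 (endo_cochain (\<lambda>v. W_0_ident X v + W_0_ident Y v))"
    unfolding wadd_mk[OF pval_endo_cochain pval_endo_cochain] by (simp add: endo_cochain_def[abs_def] lconst_add)
  then show ?thesis
    using Pi.W_1_endo_cochain[OF Was_W[OF assms(1)]] Pi.W_1_endo_cochain[OF Was_W[OF assms(2)]] ident_endo_cochain by metis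
qed

lemma ident_wscale:
  assumes "X \<in> Was 1" shows "W_0_ident (wscale 1 a X) = (\<lambda>v. scale a (W_0_ident X v))"
proof -
  have "wscale 1 a (mk 1 (endo_cochain (W_0_ident X))) = mk 1 (endo_cochain (\<lambda>v. scale a (W_0_ident X v)))"
    unfolding wscale_mk[OF pval_endo_cochain] by (simp add: endo_cochain_def[abs_def])
  then show ?thesis using Pi.W_1_endo_cochain[OF Was_W[OF assms]] ident_endo_cochain by metis
qed

lemma end_proj_sum:
  assumes "d \<in> Der_part p" "e \<in> Der_part (p + 1)" shows "end_proj p (\<lambda>v. d v + e v) = d"
proof
  fix v
  have d: "d u \<in> G (p + r)" "d (u + w) = d u + d w" and e: "e u \<in> G (p + 1 + r)" if "u \<in> G r" for u w r
    using assms that unfolding Der_part_iff Vector_Spaces.linear_iff by blast+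
  have add: "d (u + w) = d u + d w" for u w
    using assms(1) unfolding Der_part_iff Vector_Spaces.linear_iff by blast
  have "proj (p + r) (d (proj r v) + e (proj r v)) = d (proj r v)" for r
  proof -
    have "p + r \<noteq> p + 1 + r" using bit_neq_add_1[of "p + r"] by (simp add: ac_simps)
    then show ?thesis
      unfolding proj_add using d(1)[OF proj_G] proj_other[OF e[OF proj_G]] by (simp add: proj_id)
  qed
  then have "end_proj p (\<lambda>v. d v + e v) v = d (proj 0 v + proj 1 v)"
    unfolding end_proj_def add by simp
  then show "end_proj p (\<lambda>v. d v + e v) v = d v" using proj_sum[of 0 v] by simp
qed

text \<open>This matches the parity components in the bracket of maps with those in the bracket of
  derivations.\<close>

lemma end_proj_ident:
  assumes X: "X \<in> Was 1" shows "end_proj p (W_0_ident X) = W_0_ident (Pi.wproj 1 p X)"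
proof -
  have "W_0_ident X = (\<lambda>v. W_0_ident (Pi.wproj 1 p X) v + W_0_ident (Pi.wproj 1 (p + 1) X) v)"
    using Pi.wproj_part(2)[OF Was_W[OF X], of p] ident_wadd[OF wproj_Was wproj_Was, OF X X] by metis
  moreover have "W_0_ident (Pi.wproj 1 q X) \<in> Der_part q" for q
    by (rule Der_part_ident[OF wproj_Was[OF X] Pi.wproj_part(1)[OF Was_W[OF X]]])
  ultimately show ?thesis using end_proj_sum by metis
qed

lemma lconst_sum: "lconst (sum f A) = (\<Sum>x\<in>A. lconst (f x :: 'v))"
  by (induction A rule: infinite_finite_induct) (auto simp: lconst_add)

lemma ident_wbracket:
  assumes X: "X \<in> Was 1" and Y: "Y \<in> Was 1"
  shows "W_0_ident (Pi.wbracket 1 1 X Y) = lie_bracket Der_lie (W_0_ident X) (W_0_ident Y)"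
proof
  fix v
  have ab: "1 + 1 = Suc 1" by simp
  let ?x = "\<lambda>p. rp (Pi.wproj 1 p X)" and ?y = "\<lambda>q. rp (Pi.wproj 1 q Y)"
  define dx dy where "dx = (\<lambda>p. end_proj p (W_0_ident X))" and "dy = (\<lambda>q. end_proj q (W_0_ident Y))"
  have x: "Pi.cochain 1 (?x p)" and y: "Pi.cochain 1 (?y p)" for p
    using Was_E(1)[OF wproj_Was] X Y by blast+
  have ex: "elim 1 0 (?x p [v]) = lconst (dx p v)" and ey: "elim 1 0 (?y p [v]) = lconst (dy p v)" for p v
    unfolding dx_def dy_def end_proj_ident[OF X] end_proj_ident[OF Y]
    by (rule W_0_ident_elim[OF Pi.cochainD(1)[OF x]], rule W_0_ident_elim[OF Pi.cochainD(1)[OF y]])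
  let ?z = "\<lambda>vs. \<Sum>(p, q)\<in>{0, 1} \<times> {0, 1}. Pi.bracket_poly 1 1 1 (p * q) (?x p) (?y q) vs"
  have z: "pval 1 ?z"
    by (rule Pi.cochainD(1)[OF Pi.cochain_sum]) (auto intro: Pi.cochain_bracket_poly[OF ab x y])
  have b: "elim 1 0 (Pi.bracket_poly 1 1 1 s (?x p) (?y q) [v]) = lconst (dx p (dy q v) - scale (psign s) (dy q (dx p v)))" for s p q
  proof -
    have "elim 1 0 (Pi.bracket_poly 1 1 1 s (?x p) (?y q) [v]) = lconst (dx p (dy q v)) + sg (s + 1) (lconst (dy q (dx p v)))"
      unfolding Pi.bracket_poly_def elim_add elim_sg
      by (simp only: Pi.elim_box_1[OF x y ex ey] Pi.elim_box_1[OF y x ey ex])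
    also have "\<dots> = lconst (dx p (dy q v) - scale (psign s) (dy q (dx p v)))"
      by (cases s) (simp_all add: sg_def psign_scale lconst_uminus flip: lconst_add lconst_uminus)
    finally show ?thesis .
  qed
  have w: "Pi.wbracket 1 1 X Y = mk 1 ?z" by (rule Pi.wbracket_mk[OF ab Was_W[OF X] Was_W[OF Y]])
  have "pval 1 (rp (Pi.wbracket 1 1 X Y))"
    using Pi.cochainD(1)[OF Was_E(1)[OF wbracket_Was[OF ab X Y]]] .
  then have "lconst (W_0_ident (Pi.wbracket 1 1 X Y) v) = elim 1 0 (rp (mk 1 ?z) [v])"
    using W_0_ident_elim w by metis
  also have "\<dots> = elim 1 0 (?z [v])"
    by (rule elim_eqv[OF zero_less_one rp_mk[OF z]]) (simp add: args_1_iff)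
  also have "\<dots> = lconst (\<Sum>(p, q)\<in>{0, 1} \<times> {0, 1}. dx p (dy q v) - scale (psign (p * q)) (dy q (dx p v)))"
    unfolding elim_sum lconst_sum by (intro sum.cong refl) (auto simp: b)
  finally show "W_0_ident (Pi.wbracket 1 1 X Y) v = lie_bracket Der_lie (W_0_ident X) (W_0_ident Y) v"
    by (simp add: Der_lie_def dx_def dy_def)
qed

lemma W_0_iso: "lie_superalgebra_iso W_0_ident Was_0 Der_lie"
  unfolding lie_superalgebra_iso_def superspace_iso_def
proof (intro conjI ballI allI)
  have id: "X = mk 1 (endo_cochain (W_0_ident X))" if "X \<in> Was 1" for X by (rule Pi.W_1_endo_cochain[OF Was_W[OF that]])
  have part: "W_0_ident ` (Was 1 \<inter> Pi.W_part 1 q) = Der_part q" for q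
  proof (intro set_eqI iffI)
    fix d assume "d \<in> W_0_ident ` (Was 1 \<inter> Pi.W_part 1 q)"
    then show "d \<in> Der_part q" using Der_part_ident by blast
  next
    fix d assume "d \<in> Der_part q"
    then have "mk 1 (endo_cochain d) \<in> Was 1 \<inter> Pi.W_part 1 q" "d = W_0_ident (mk 1 (endo_cochain d))"
      using endo_cochain_part_iff ident_endo_cochain by auto
    then show "d \<in> W_0_ident ` (Was 1 \<inter> Pi.W_part 1 q)" by blast
  qed
  then show "W_0_ident ` ss_part Was_0 q = ss_part Der_lie q" for q
    by (simp add: Was_0_def Der_lie_def)
  have "W_0_ident ` Was 1 = {\<lambda>v. d v + e v | d e. d \<in> Der_part 0 \<and> e \<in> Der_part 1}"
  proof (intro set_eqI iffI)
    fix f assume "f \<in> W_0_ident ` Was 1"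
    then obtain X where X: "X \<in> Was 1" "f = W_0_ident X" by blast
    have "f = (\<lambda>v. W_0_ident (Pi.wproj 1 0 X) v + W_0_ident (Pi.wproj 1 1 X) v)"
      using Pi.wproj_part(2)[OF Was_W[OF X(1)], of 0] ident_wadd[OF wproj_Was wproj_Was, OF X(1) X(1), of 0 1] X(2) by simp
    then show "f \<in> {\<lambda>v. d v + e v | d e. d \<in> Der_part 0 \<and> e \<in> Der_part 1}"
      using Der_part_ident[OF wproj_Was[OF X(1)] Pi.wproj_part(1)[OF Was_W[OF X(1)]]] by blast
  next
    fix f assume "f \<in> {\<lambda>v. d v + e v | d e. d \<in> Der_part 0 \<and> e \<in> Der_part 1}"
    then obtain d e where de: "d \<in> Der_part 0" "e \<in> Der_part 1" "f = (\<lambda>v. d v + e v)" by blast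
    obtain X where "X \<in> Was 1" "d = W_0_ident X" using de(1) unfolding part[symmetric] by blast
    moreover obtain Y where "Y \<in> Was 1" "e = W_0_ident Y" using de(2) unfolding part[symmetric] by blast
    ultimately have "f = W_0_ident (wadd 1 X Y)" "wadd 1 X Y \<in> Was 1"
      using de(3) ident_wadd wadd_Was by auto
    then show "f \<in> W_0_ident ` Was 1" by blast
  qed
  moreover have "inj_on W_0_ident (Was 1)"
  proof (rule inj_onI)
    fix X Y assume X: "X \<in> Was 1" and Y: "Y \<in> Was 1" and "W_0_ident X = W_0_ident Y"
    then have "mk 1 (endo_cochain (W_0_ident X)) = mk 1 (endo_cochain (W_0_ident Y))" by simp
    then show "X = Y" by (rule trans[OF id[OF X] trans[OF _ id[OF Y, symmetric]]])
  qed
  ultimately show "bij_betw W_0_ident (ss_carrier Was_0) (ss_carrier Der_lie)"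
    by (simp add: bij_betw_def Was_0_def Der_lie_def)
  fix X assume "X \<in> ss_carrier Was_0"
  then have X: "X \<in> Was 1" by (simp add: Was_0_def)
  show "W_0_ident (ss_scale Was_0 a X) = ss_scale Der_lie a (W_0_ident X)" for a
    using ident_wscale[OF X] by (simp add: Was_0_def Der_lie_def)
  fix Y assume "Y \<in> ss_carrier Was_0"
  then have Y: "Y \<in> Was 1" by (simp add: Was_0_def)
  show "W_0_ident (ss_add Was_0 X Y) = ss_add Der_lie (W_0_ident X) (W_0_ident Y)"
    using ident_wadd[OF X Y] by (simp add: Was_0_def Der_lie_def)
  show "W_0_ident (lie_bracket Was_0 X Y) = lie_bracket Der_lie (W_0_ident X) (W_0_ident Y)"
    using ident_wbracket[OF X Y] by (simp add: Was_0_def)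
qed

end

theorem proposition5p1:
  fixes scale :: "'f::field_char_0 \<Rightarrow> 'v::{ring, monoid_mult} \<Rightarrow> 'v"
    and G :: "bit \<Rightarrow> 'v set"
    and D :: "'v \<Rightarrow> 'v"
  assumes "comm_diff_superalgebra scale G D"
  shows "lie_subsuperalgebra
      (diff_supermodule.dsum scale D (comm_diff_superalgebra.Was scale G D))
      (diff_supermodule.W_lie scale (rev_parity G) D) \<and>
    superspace_iso diff_supermodule.W_minus1_ident
      (comm_diff_superalgebra.Was_minus1 scale G D)
      (diff_supermodule.V_mod_D scale (rev_parity G) D) \<and>
    lie_superalgebra_iso (diff_supermodule.W_0_ident D)
      (comm_diff_superalgebra.Was_0 scale G D)
      (comm_diff_superalgebra.Der_lie scale G D)"
proof -
  interpret comm_diff_superalgebra scale G D by (rule assms)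
  show ?thesis using subsuperalgebra_Was W_minus1_iso W_0_iso by blast
qed

end
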